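(* Let $G$ be an Eulerian directed graph with $m$ edges and vertex set $V$, $|V|\ge 2$, and let $\mathsf{P}$ be the transition matrix of the simple random walk on $G$, with stationary distribution $\pi$. (1) The spectral gap of $\mathsf{P}$ satisfies $$\lambda \ \geq\ 1-\cos\frac{2\pi}{m}.$$ (2) Suppose in addition that $$\forall A\subset V \text{ with } \pi(A)\leq 1/2,\ \forall v\in V:\quad \pi\left(N(A)\setminus \{v\}\right)\ \geq\ \pi(A).$$ Then every (complex) eigenvalue $\lambda_i\neq 1$ of $\mathsf{P}$ satisfies $$1-|\lambda_i|\ \geq\ 1-\cos\frac{2\pi}{m},$$ and for every $\epsilon>0$ $$\tau(\epsilon)\ \leq\ \frac{1}{-\log\cos\frac{2\pi}{m}}\,\log\frac{1-2/m}{\epsilon},$$ $$\tau_{\infty}(\epsilon)\ \leq\ \begin{cases}\displaystyle \min\left\{\frac{\log\frac{m-2}{2}+\log\frac1\epsilon}{-\log\cos\frac{2\pi}{m}},\ \frac{m^2}{6}+\frac{m^2}{8}\log\frac1\epsilon\right\} & \text{if } \epsilon\leq 1,\\[2ex] \displaystyle m^2\,\frac{1+3\epsilon}{3(1+\epsilon)^3} & \text{if } \epsilon>1.\end{cases}$$ (3) For the lazy simple random walk on $G$, with transition matrix $\frac12(I+\mathsf{P})$ (and with no expansion condition assumed beyond the strong connectivity of $G$), the spectral gap satisfies $\lambda\geq \frac12\left(1-\cos\frac{2\pi}{m}\right)$, every eigenvalue $\lambda_i\neq1$ of the transition matrix satisfies $1-|\lambda_i|\geq 1-\cos\frac{\pi}{m}$,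 and for every $\epsilon>0$ $$\tau(\epsilon)\ \leq\ \frac{1}{-\log\cos\frac{\pi}{m}}\,\log\frac{1-1/m}{\epsilon},$$ $$\tau_{\infty}(\epsilon)\ \leq\ \begin{cases}\displaystyle \min\left\{\frac{\log(m-1)+\log\frac1\epsilon}{-\log\cos\frac{\pi}{m}},\ \frac{2m^2}{3}+\frac{m^2}{2}\log\frac1\epsilon\right\} & \text{if } \epsilon\leq 1,\\[2ex] \displaystyle 4m^2\,\frac{1+3\epsilon}{3(1+\epsilon)^3} & \text{if } \epsilon>1.\end{cases}$$
   Context: An Eulerian graph is a finite, strongly connected directed graph in which every vertex $x$ has in-degree equal to its out-degree; this common value is denoted $\deg(x)$. Self-loops and parallel edges are allowed. $m$ is the number of directed edges. The simple random walk moves from $x$ along an outgoing edge chosen uniformly at random: $\mathsf{P}(x,y)=\#\{\text{edges from }x\text{ to }y\}/\deg(x)$. Its stationary distribution is $\pi(x)=\deg(x)/m$. (Inside cosines $\pi$ is the usual constant.) For $A\subset V$, $\pi(A)=\sum_{x\in A}\pi(x)$ and $N(A)=\{y\in V:\exists x\in A,\ \mathsf{P}(x,y)>0\}$. Spectral gap of an irreducible transition matrix $\mathsf{P}$ with stationary distribution $\pi$: with $\mathsf{P}^*(x,y)=\pi(y)\mathsf{P}(y,x)/\pi(x)$, $\lambda$ is the difference between the two largest eigenvalues of $\frac{\mathsf{P}+\mathsf{P}^*}{2}$, i.e. $$\lambda=\inf_{f:\,\mathrm{Var}_\pi(f)\neq0}\frac{\frac12\sum_{x,y}(f(x)-f(y))^2\pi(x)\mathsf{P}(x,y)}{\frac12\sum_{x,y}(f(x)-f(y))^2\pi(x)\pi(y)}.$$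 Mixing times: $\tau(\epsilon)$ is the worst-case (over the starting vertex $x$) number of steps $t$ needed for $\|\mathsf{P}^t(x,\cdot)-\pi\|_{TV}=\frac12\sum_y|\mathsf{P}^t(x,y)-\pi(y)|$ to drop to $\epsilon$; $\tau_\infty(\epsilon)$ is the same with the distance $\max_y\left|\frac{\mathsf{P}^t(x,y)}{\pi(y)}-1\right|$. A bound "mixing time $\leq T$" with $T$ real means: for every positive integer $t\geq T$ and every $x\in V$, the corresponding distance at time $t$ is at most $\epsilon$. By convention $\log 0=-\infty$ and $1/\infty=0$ (so $\frac{1}{-\log 0}=0$). *)

theory Defs
  imports "HOL-Analysis.Analysis" "Graph_Theory.Digraph_Component"
begin

section \<open>Eulerian digraphs and their simple random walk\<close>

definition eulerian_digraph :: "('a, 'b) pre_digraph \<Rightarrow> bool" where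
  "eulerian_digraph G \<longleftrightarrow>
     fin_digraph G \<and> strongly_connected G \<and> (\<forall>x\<in>verts G. in_degree G x = out_degree G x)"

definition srw :: "('a, 'b) pre_digraph \<Rightarrow> 'a \<Rightarrow> 'a \<Rightarrow> real" where
  "srw G x y = real (card {e \<in> arcs G. tail G e = x \<and> head G e = y}) / real (out_degree G x)"

definition srw_stat :: "('a, 'b) pre_digraph \<Rightarrow> 'a \<Rightarrow> real" where
  "srw_stat G x = real (out_degree G x) / real (card (arcs G))"

section \<open>Markov kernels on a finite state space\<close>

text \<open>
  A matrix indexed by a finite set \<open>V\<close> is a function of two arguments of which only the
  values on \<open>V\<close> are used.
\<close>

definition lazy_kernel :: "('a \<Rightarrow> 'a \<Rightarrow> real) \<Rightarrow> 'a \<Rightarrow> 'a \<Rightarrow> real" where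
  "lazy_kernel P x y = ((if x = y then 1 else 0) + P x y) / 2"

fun kernel_pow :: "'a set \<Rightarrow> ('a \<Rightarrow> 'a \<Rightarrow> real) \<Rightarrow> nat \<Rightarrow> 'a \<Rightarrow> 'a \<Rightarrow> real" where
  "kernel_pow V P 0 x y = (if x = y then 1 else 0)"
| "kernel_pow V P (Suc t) x y = (\<Sum>z\<in>V. P x z * kernel_pow V P t z y)"

definition out_nbhd :: "'a set \<Rightarrow> ('a \<Rightarrow> 'a \<Rightarrow> real) \<Rightarrow> 'a set \<Rightarrow> 'a set" where
  "out_nbhd V P A = {y \<in> V. \<exists>x\<in>A. P x y > 0}"

definition is_eigenvalue :: "'a set \<Rightarrow> ('a \<Rightarrow> 'a \<Rightarrow> 'k::field) \<Rightarrow> 'k \<Rightarrow> bool" where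
  "is_eigenvalue V M \<mu> \<longleftrightarrow>
     (\<exists>f. (\<exists>x\<in>V. f x \<noteq> 0) \<and> (\<forall>x\<in>V. (\<Sum>y\<in>V. M x y * f y) = \<mu> * f x))"

abbreviation complex_eigenvalue :: "'a set \<Rightarrow> ('a \<Rightarrow> 'a \<Rightarrow> real) \<Rightarrow> complex \<Rightarrow> bool" where
  "complex_eigenvalue V P \<equiv> is_eigenvalue V (\<lambda>x y. complex_of_real (P x y))"

definition reversal :: "('a \<Rightarrow> real) \<Rightarrow> ('a \<Rightarrow> 'a \<Rightarrow> real) \<Rightarrow> 'a \<Rightarrow> 'a \<Rightarrow> real" where
  "reversal \<pi> P x y = \<pi> y * P y x / \<pi> x"

definition additive_reversibilization ::
    "('a \<Rightarrow> real) \<Rightarrow> ('a \<Rightarrow> 'a \<Rightarrow> real) \<Rightarrow> 'a \<Rightarrow> 'a \<Rightarrow> real" where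
  "additive_reversibilization \<pi> P x y = (P x y + reversal \<pi> P x y) / 2"

text \<open>
  The difference between the two largest eigenvalues of the (\<open>\<pi>\<close>-self-adjoint) additive
  reversibilization.  For irreducible \<open>P\<close> its largest eigenvalue \<open>1\<close> is simple, so the second
  largest eigenvalue is the largest one distinct from it.  Both maxima exist if \<open>V\<close> has at least
  two elements, and the gap is then given by the usual variational formula: see
  \<open>spectral_gap_variational\<close> below.
\<close>

definition spectral_gap :: "'a set \<Rightarrow> ('a \<Rightarrow> 'a \<Rightarrow> real) \<Rightarrow> ('a \<Rightarrow> real) \<Rightarrow> real" where
  "spectral_gap V P \<pi> =
     (let K = additive_reversibilization \<pi> P;
          \<mu>\<^sub>0 = (GREATEST \<mu>. is_eigenvalue V K \<mu>);
          \<mu>\<^sub>1 = (GREATEST \<mu>. is_eigenvalue V K \<mu> \<and> \<mu> \<noteq> \<mu>\<^sub>0)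
      in \<mu>\<^sub>0 - \<mu>\<^sub>1)"

section \<open>Mixing time bounds\<close>

definition tv_dist :: "'a set \<Rightarrow> ('a \<Rightarrow> 'a \<Rightarrow> real) \<Rightarrow> ('a \<Rightarrow> real) \<Rightarrow> nat \<Rightarrow> 'a \<Rightarrow> real" where
  "tv_dist V P \<pi> t x = 1/2 * (\<Sum>y\<in>V. \<bar>kernel_pow V P t x y - \<pi> y\<bar>)"

definition rel_sup_dist :: "'a set \<Rightarrow> ('a \<Rightarrow> 'a \<Rightarrow> real) \<Rightarrow> ('a \<Rightarrow> real) \<Rightarrow> nat \<Rightarrow> 'a \<Rightarrow> real" where
  "rel_sup_dist V P \<pi> t x = (MAX y\<in>V. \<bar>kernel_pow V P t x y / \<pi> y - 1\<bar>)"

text \<open>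
  \<open>\<tau>(\<epsilon>) \<le> T\<close> and \<open>\<tau>\<^sub>\<infinity>(\<epsilon>) \<le> T\<close> for real \<open>T\<close> (possibly nonpositive): the distance is at most
  \<open>\<epsilon>\<close> at every positive integer time \<open>t \<ge> T\<close>, from every starting state.
\<close>

definition tau_le ::
    "'a set \<Rightarrow> ('a \<Rightarrow> 'a \<Rightarrow> real) \<Rightarrow> ('a \<Rightarrow> real) \<Rightarrow> real \<Rightarrow> real \<Rightarrow> bool" where
  "tau_le V P \<pi> \<epsilon> T \<longleftrightarrow> (\<forall>t::nat. 0 < t \<and> T \<le> real t \<longrightarrow> (\<forall>x\<in>V. tv_dist V P \<pi> t x \<le> \<epsilon>))"

definition tau_inf_le ::
    "'a set \<Rightarrow> ('a \<Rightarrow> 'a \<Rightarrow> real) \<Rightarrow> ('a \<Rightarrow> real) \<Rightarrow> real \<Rightarrow> real \<Rightarrow> bool" where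
  "tau_inf_le V P \<pi> \<epsilon> T \<longleftrightarrow>
     (\<forall>t::nat. 0 < t \<and> T \<le> real t \<longrightarrow> (\<forall>x\<in>V. rel_sup_dist V P \<pi> t x \<le> \<epsilon>))"

text \<open>\<open>1 / (- log c)\<close> with the convention \<open>log 0 = -\<infinity>\<close>, \<open>1 / \<infinity> = 0\<close>.\<close>

definition inv_neg_log :: "real \<Rightarrow> real" where
  "inv_neg_log c = (if c = 0 then 0 else 1 / (- ln c))"

section \<open>The variational formula for the spectral gap\<close>

definition dirichlet_form ::
    "'a set \<Rightarrow> ('a \<Rightarrow> real) \<Rightarrow> ('a \<Rightarrow> 'a \<Rightarrow> real) \<Rightarrow> ('a \<Rightarrow> real) \<Rightarrow> real" where
  "dirichlet_form V \<pi> P f = 1/2 * (\<Sum>x\<in>V. \<Sum>y\<in>V. (f x - f y)\<^sup>2 * \<pi> x * P x y)"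

definition variance_on :: "'a set \<Rightarrow> ('a \<Rightarrow> real) \<Rightarrow> ('a \<Rightarrow> real) \<Rightarrow> real" where
  "variance_on V \<pi> f = 1/2 * (\<Sum>x\<in>V. \<Sum>y\<in>V. (f x - f y)\<^sup>2 * \<pi> x * \<pi> y)"

definition dirichlet_bilin ::
    "'a set \<Rightarrow> ('a \<Rightarrow> real) \<Rightarrow> ('a \<Rightarrow> 'a \<Rightarrow> real) \<Rightarrow> ('a \<Rightarrow> real) \<Rightarrow> ('a \<Rightarrow> real) \<Rightarrow> real" where
  "dirichlet_bilin V \<pi> P f g = 1/2 * (\<Sum>x\<in>V. \<Sum>y\<in>V. (f x - f y) * (g x - g y) * \<pi> x * P x y)"

lemma dirichlet_form_bilin: "dirichlet_form V \<pi> P f = dirichlet_bilin V \<pi> P f f"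
  by (simp add: dirichlet_form_def dirichlet_bilin_def power2_eq_square)

lemma variance_on_dirichlet: "variance_on V \<pi> f = dirichlet_form V \<pi> (\<lambda>x y. \<pi> y) f"
  by (simp add: dirichlet_form_def variance_on_def)

lemma dirichlet_form_add:
  "dirichlet_form V \<pi> P (\<lambda>x. f x + t * g x) =
     dirichlet_form V \<pi> P f + 2 * t * dirichlet_bilin V \<pi> P f g + t\<^sup>2 * dirichlet_form V \<pi> P g"
proof -
  have "(\<Sum>x\<in>V. \<Sum>y\<in>V. ((f x + t * g x) - (f y + t * g y))\<^sup>2 * \<pi> x * P x y) =
    (\<Sum>x\<in>V. \<Sum>y\<in>V. (f x - f y)\<^sup>2 * \<pi> x * P x y
        + 2 * t * ((f x - f y) * (g x - g y) * \<pi> x * P x y) + t\<^sup>2 * ((g x - g y)\<^sup>2 * \<pi> x * P x y))"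
    by (intro sum.cong refl) (simp add: power2_eq_square algebra_simps)
  also have "\<dots> = (\<Sum>x\<in>V. \<Sum>y\<in>V. (f x - f y)\<^sup>2 * \<pi> x * P x y)
        + 2 * t * (\<Sum>x\<in>V. \<Sum>y\<in>V. (f x - f y) * (g x - g y) * \<pi> x * P x y)
        + t\<^sup>2 * (\<Sum>x\<in>V. \<Sum>y\<in>V. (g x - g y)\<^sup>2 * \<pi> x * P x y)"
    by (simp add: sum.distrib sum_distrib_left)
  finally show ?thesis
    unfolding dirichlet_form_def dirichlet_bilin_def by (simp only:) (simp add: algebra_simps)
qed

lemma dirichlet_form_nonneg:
  assumes "\<And>x. x \<in> V \<Longrightarrow> 0 \<le> \<pi> x" "\<And>x y. x \<in> V \<Longrightarrow> y \<in> V \<Longrightarrow> 0 \<le> P x y"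
  shows "0 \<le> dirichlet_form V \<pi> P f"
  unfolding dirichlet_form_def using assms by (auto intro!: sum_nonneg mult_nonneg_nonneg)

lemma dirichlet_form_constant:
  assumes "\<And>x y. x \<in> V \<Longrightarrow> y \<in> V \<Longrightarrow> f x = f y"
  shows "dirichlet_form V \<pi> P f = 0"
proof -
  have "(\<Sum>x\<in>V. \<Sum>y\<in>V. (f x - f y)\<^sup>2 * \<pi> x * P x y) = (\<Sum>x\<in>V. \<Sum>y\<in>V. 0)"
  proof (intro sum.cong refl)
    fix x y assume "x \<in> V" "y \<in> V"
    from assms[OF this] have "f x - f y = 0" by (rule right_minus_eq[THEN iffD2])
    then show "(f x - f y)\<^sup>2 * \<pi> x * P x y = 0" by (simp only:) simp
  qed
  then show ?thesis by (simp add: dirichlet_form_def)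
qed

lemma dirichlet_bilin_eq:
  assumes pos: "\<And>x. x \<in> V \<Longrightarrow> 0 < \<pi> x"
    and rows: "\<And>x. x \<in> V \<Longrightarrow> (\<Sum>y\<in>V. P x y) = 1"
    and stat: "\<And>y. y \<in> V \<Longrightarrow> (\<Sum>x\<in>V. \<pi> x * P x y) = \<pi> y"
  shows "dirichlet_bilin V \<pi> P f g =
    (\<Sum>x\<in>V. \<pi> x * g x * (f x - (\<Sum>y\<in>V. additive_reversibilization \<pi> P x y * f y)))"
proof -
  let ?S = "\<lambda>a. \<Sum>x\<in>V. \<Sum>y\<in>V. a x y * (\<pi> x * P x y)"
  have e1: "?S (\<lambda>x y. f x * g x) = (\<Sum>x\<in>V. \<pi> x * g x * f x)"
  proof (intro sum.cong refl)
    fix x assume "x \<in> V"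
    have "(\<Sum>y\<in>V. f x * g x * (\<pi> x * P x y)) = f x * g x * \<pi> x * (\<Sum>y\<in>V. P x y)"
      by (simp add: sum_distrib_left mult_ac)
    then show "(\<Sum>y\<in>V. f x * g x * (\<pi> x * P x y)) = \<pi> x * g x * f x"
      using rows[OF \<open>x \<in> V\<close>] by simp
  qed
  have e2: "?S (\<lambda>x y. f y * g y) = (\<Sum>x\<in>V. \<pi> x * g x * f x)"
  proof -
    have "?S (\<lambda>x y. f y * g y) = (\<Sum>y\<in>V. \<Sum>x\<in>V. f y * g y * (\<pi> x * P x y))"
      by (rule sum.swap)
    also have "\<dots> = (\<Sum>y\<in>V. f y * g y * (\<Sum>x\<in>V. \<pi> x * P x y))"
      by (simp add: sum_distrib_left)
    also have "\<dots> = (\<Sum>x\<in>V. \<pi> x * g x * f x)"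
      by (intro sum.cong refl) (simp add: stat)
    finally show ?thesis .
  qed
  have e3: "?S (\<lambda>x y. f x * g y) = (\<Sum>x\<in>V. \<Sum>y\<in>V. f y * g x * (\<pi> y * P y x))"
    by (rule sum.swap)
  have e4: "(\<Sum>x\<in>V. \<pi> x * g x * (\<Sum>y\<in>V. additive_reversibilization \<pi> P x y * f y)) =
      1/2 * (?S (\<lambda>x y. f y * g x) + (\<Sum>x\<in>V. \<Sum>y\<in>V. f y * g x * (\<pi> y * P y x)))"
  proof -
    have "(\<Sum>x\<in>V. \<pi> x * g x * (\<Sum>y\<in>V. additive_reversibilization \<pi> P x y * f y)) =
      (\<Sum>x\<in>V. \<Sum>y\<in>V. 1/2 * (f y * g x * (\<pi> x * P x y) + f y * g x * (\<pi> y * P y x)))"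
      unfolding sum_distrib_left
    proof (intro sum.cong refl)
      fix x y assume "x \<in> V" "y \<in> V"
      with pos[of x] show "\<pi> x * g x * (additive_reversibilization \<pi> P x y * f y) =
          1/2 * (f y * g x * (\<pi> x * P x y) + f y * g x * (\<pi> y * P y x))"
        by (simp add: additive_reversibilization_def reversal_def field_simps)
    qed
    also have "\<dots> = 1/2 * (?S (\<lambda>x y. f y * g x) + (\<Sum>x\<in>V. \<Sum>y\<in>V. f y * g x * (\<pi> y * P y x)))"
      by (simp only: sum.distrib flip: sum_distrib_left)
    finally show ?thesis .
  qed
  have "dirichlet_bilin V \<pi> P f g =
      1/2 * (?S (\<lambda>x y. f x * g x) + ?S (\<lambda>x y. f y * g y) - ?S (\<lambda>x y. f x * g y) - ?S (\<lambda>x y. f y * g x))"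
    unfolding dirichlet_bilin_def sum.distrib[symmetric] sum_subtractf[symmetric]
    by (intro arg_cong[of _ _ "\<lambda>x. 1/2 * x"] sum.cong refl) (simp add: algebra_simps)
  also have "\<dots> = (\<Sum>x\<in>V. \<pi> x * g x * f x)
      - (\<Sum>x\<in>V. \<pi> x * g x * (\<Sum>y\<in>V. additive_reversibilization \<pi> P x y * f y))"
    unfolding e4 e1 e2 e3 by (simp add: algebra_simps)
  also have "\<dots> = (\<Sum>x\<in>V. \<pi> x * g x * (f x - (\<Sum>y\<in>V. additive_reversibilization \<pi> P x y * f y)))"
    by (simp only: right_diff_distrib sum_subtractf)
  finally show ?thesis .
qed

lemma covariance_eq:
  assumes pos: "\<And>x. x \<in> V \<Longrightarrow> 0 < \<pi> x" and one: "(\<Sum>x\<in>V. \<pi> x) = 1"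
  shows "dirichlet_bilin V \<pi> (\<lambda>x y. \<pi> y) f g = (\<Sum>x\<in>V. \<pi> x * g x * (f x - (\<Sum>y\<in>V. \<pi> y * f y)))"
proof -
  have "dirichlet_bilin V \<pi> (\<lambda>x y. \<pi> y) f g = (\<Sum>x\<in>V. \<pi> x * g x *
      (f x - (\<Sum>y\<in>V. additive_reversibilization \<pi> (\<lambda>x y. \<pi> y) x y * f y)))"
    by (rule dirichlet_bilin_eq) (auto simp: pos one simp flip: sum_distrib_right)
  also have "\<dots> = (\<Sum>x\<in>V. \<pi> x * g x * (f x - (\<Sum>y\<in>V. \<pi> y * f y)))"
  proof (intro sum.cong refl)
    fix x assume "x \<in> V"
    have "(\<Sum>y\<in>V. additive_reversibilization \<pi> (\<lambda>x y. \<pi> y) x y * f y) = (\<Sum>y\<in>V. \<pi> y * f y)"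
      using pos[OF \<open>x \<in> V\<close>]
      by (intro sum.cong refl) (simp add: additive_reversibilization_def reversal_def)
    then show "\<pi> x * g x * (f x - (\<Sum>y\<in>V. additive_reversibilization \<pi> (\<lambda>x y. \<pi> y) x y * f y)) =
        \<pi> x * g x * (f x - (\<Sum>y\<in>V. \<pi> y * f y))" by simp
  qed
  finally show ?thesis .
qed

lemma kernel_pow_nonneg:
  assumes "\<And>x y. x \<in> V \<Longrightarrow> y \<in> V \<Longrightarrow> 0 \<le> P x y" "x \<in> V" "y \<in> V"
  shows "0 \<le> kernel_pow V P t x y"
  using assms(2) by (induction t arbitrary: x) (auto intro!: sum_nonneg mult_nonneg_nonneg assms)

lemma dirichlet_form_zero_imp_constant:
  assumes fin: "finite V"
    and pos: "\<And>x. x \<in> V \<Longrightarrow> 0 < \<pi> x"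
    and nonneg: "\<And>x y. x \<in> V \<Longrightarrow> y \<in> V \<Longrightarrow> 0 \<le> P x y"
    and irred: "\<And>x y. x \<in> V \<Longrightarrow> y \<in> V \<Longrightarrow> \<exists>t. 0 < kernel_pow V P t x y"
    and zero: "dirichlet_form V \<pi> P f = 0" and "x \<in> V" "y \<in> V"
  shows "f x = f y"
proof -
  have step: "f u = f v" if "u \<in> V" "v \<in> V" "0 < P u v" for u v
  proof -
    have *: "(\<Sum>x\<in>V. \<Sum>y\<in>V. (f x - f y)\<^sup>2 * \<pi> x * P x y) = 0"
      using zero by (simp add: dirichlet_form_def)
    have nn: "0 \<le> (f x - f y)\<^sup>2 * \<pi> x * P x y" if "x \<in> V" "y \<in> V" for x y
      using pos[OF that(1)] nonneg[OF that] by simp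
    have "(\<Sum>y\<in>V. (f u - f y)\<^sup>2 * \<pi> u * P u y) = 0"
      by (rule sum_nonneg_0[OF fin sum_nonneg[OF nn] * \<open>u \<in> V\<close>])
    then have "(f u - f v)\<^sup>2 * \<pi> u * P u v = 0"
      by (rule sum_nonneg_0[OF fin nn[OF \<open>u \<in> V\<close>] _ \<open>v \<in> V\<close>, rotated])
    then show ?thesis using that pos[of u] by auto
  qed
  have "f u = f y" if "u \<in> V" "0 < kernel_pow V P t u y" for t u
    using that
  proof (induction t arbitrary: u)
    case 0
    then show ?case by (simp split: if_splits)
  next
    case (Suc t)
    have "\<exists>z\<in>V. 0 < P u z * kernel_pow V P t z y"
    proof (rule ccontr)
      assume "\<not> ?thesis"
      then have "(\<Sum>z\<in>V. P u z * kernel_pow V P t z y) \<le> 0"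
        by (intro sum_nonpos) (auto simp: not_less)
      with Suc.prems show False by simp
    qed
    then obtain z where z: "z \<in> V" "0 < P u z * kernel_pow V P t z y" by blast
    have "0 < P u z" "0 < kernel_pow V P t z y"
      using z nonneg[OF Suc.prems(1) z(1)] by (auto simp: zero_less_mult_iff)
    with step[OF Suc.prems(1) z(1)] Suc.IH[OF z(1)] show ?case by simp
  qed
  with irred[OF \<open>x \<in> V\<close> \<open>y \<in> V\<close>] \<open>x \<in> V\<close> show ?thesis by blast
qed

lemma linear_coeff_zero:
  fixes a b :: real
  assumes "\<And>t. 0 \<le> t * a + t\<^sup>2 * b"
  shows "a = 0"
proof (rule ccontr)
  assume "a \<noteq> 0"
  define d where "d = \<bar>b\<bar> + 1"
  have d: "d > 0" "b < d" by (auto simp: d_def)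
  have "0 \<le> (- a / d) * a + (- a / d)\<^sup>2 * b" by (rule assms)
  also have "\<dots> = (a\<^sup>2 / d\<^sup>2) * (b - d)"
    using d by (simp add: power2_eq_square field_simps)
  also have "\<dots> < 0" using \<open>a \<noteq> 0\<close> d by (intro mult_pos_neg) auto
  finally show False by simp
qed

text \<open>The infimum in the variational formula is attained.\<close>

lemma rayleigh_minimizer:
  assumes fin: "finite V" and card: "2 \<le> card V"
    and pos: "\<And>x. x \<in> V \<Longrightarrow> 0 < \<pi> x" and one: "(\<Sum>x\<in>V. \<pi> x) = 1"
  obtains f where "(\<Sum>x\<in>V. \<pi> x * f x) = 0" "variance_on V \<pi> f = 1"
    "\<And>g. dirichlet_form V \<pi> P f * variance_on V \<pi> g \<le> dirichlet_form V \<pi> P g"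
proof -
  have var: "variance_on V \<pi> f = (\<Sum>x\<in>V. \<pi> x * (f x)\<^sup>2)" if "(\<Sum>x\<in>V. \<pi> x * f x) = 0" for f
    unfolding variance_on_dirichlet dirichlet_form_bilin
    by (subst covariance_eq) (auto simp: pos one that power2_eq_square mult_ac)
  have var_nonneg: "0 \<le> variance_on V \<pi> f" for f
    unfolding variance_on_dirichlet by (rule dirichlet_form_nonneg) (auto intro: less_imp_le pos)
  define S :: "('a \<Rightarrow> real) set" where
    "S = PiE UNIV (\<lambda>x. if x \<in> V then {- (1 / \<pi> x + 1) .. 1 / \<pi> x + 1} else {0})
       \<inter> {f. (\<Sum>x\<in>V. \<pi> x * f x) = 0} \<inter> {f. (\<Sum>x\<in>V. \<pi> x * (f x)\<^sup>2) = 1}"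
  have coord: "continuous_on UNIV (\<lambda>f::'a \<Rightarrow> real. f x)" for x
    by (rule continuous_on_product_coordinates)
  have "compact S" unfolding S_def
  proof (intro compact_Int_closed)
    show "compact (PiE UNIV (\<lambda>x. if x \<in> V then {- (1 / \<pi> x + 1) .. 1 / \<pi> x + 1} else {0::real}))"
      using compactin_PiE[of "\<lambda>_::'a. euclidean :: real topology" UNIV
          "\<lambda>x. if x \<in> V then {- (1 / \<pi> x + 1) .. 1 / \<pi> x + 1} else {0}"]
      by (simp add: euclidean_product_topology)
    show "closed {f::'a \<Rightarrow> real. (\<Sum>x\<in>V. \<pi> x * f x) = 0}"
      by (intro closed_Collect_eq continuous_intros coord)
    show "closed {f::'a \<Rightarrow> real. (\<Sum>x\<in>V. \<pi> x * (f x)\<^sup>2) = 1}"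
      by (intro closed_Collect_eq continuous_intros coord)
  qed
  have shift: "variance_on V \<pi> (\<lambda>x. if x \<in> V then (g x - a) / s else 0) = variance_on V \<pi> g / s\<^sup>2"
      "dirichlet_form V \<pi> P (\<lambda>x. if x \<in> V then (g x - a) / s else 0) = dirichlet_form V \<pi> P g / s\<^sup>2"
    for g :: "'a \<Rightarrow> real" and a s
    unfolding variance_on_def dirichlet_form_def
    by (auto simp: sum_divide_distrib diff_divide_distrib[symmetric] power_divide intro!: sum.cong)
  have norm_mem: "(\<lambda>x. if x \<in> V then (g x - (\<Sum>y\<in>V. \<pi> y * g y)) / sqrt (variance_on V \<pi> g) else 0) \<in> S"
    (is "?h \<in> S") if g: "variance_on V \<pi> g > 0" for g
  proof -
    have "(\<Sum>x\<in>V. \<pi> x * ?h x)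
        = (\<Sum>x\<in>V. \<pi> x * g x - \<pi> x * (\<Sum>y\<in>V. \<pi> y * g y)) / sqrt (variance_on V \<pi> g)"
      unfolding sum_divide_distrib by (intro sum.cong) (auto simp: algebra_simps)
    also have "\<dots> = 0"
      by (simp add: sum_subtractf one flip: sum_distrib_right)
    finally have m0: "(\<Sum>x\<in>V. \<pi> x * ?h x) = 0" .
    have v1: "(\<Sum>x\<in>V. \<pi> x * (?h x)\<^sup>2) = 1"
      using shift(1)[of g] var[OF m0] g by simp
    have "?h x \<in> {- (1 / \<pi> x + 1) .. 1 / \<pi> x + 1}" if "x \<in> V" for x
    proof -
      have "\<pi> x * (?h x)\<^sup>2 \<le> (\<Sum>x\<in>V. \<pi> x * (?h x)\<^sup>2)"
        by (rule member_le_sum[OF that _ fin]) (simp add: less_imp_le[OF pos])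
      then have "(?h x)\<^sup>2 \<le> 1 / \<pi> x" using v1 pos[OF that] by (simp add: field_simps)
      also have "\<dots> \<le> (1 / \<pi> x + 1)\<^sup>2" using pos[OF that] by (simp add: power2_eq_square field_simps)
      finally have "\<bar>?h x\<bar> \<le> \<bar>1 / \<pi> x + 1\<bar>" by (rule power2_le_iff_abs_le[THEN iffD1, rotated, of _ "\<bar>1 / \<pi> x + 1\<bar>", simplified])
      then show ?thesis using pos[OF that] by (simp add: abs_le_iff)
    qed
    then show ?thesis unfolding S_def using m0 v1 by auto
  qed
  obtain a b where ab: "a \<in> V" "b \<in> V" "a \<noteq> b"
    using card by (metis card_le_Suc0_iff_eq fin not_less_eq_eq numeral_2_eq_2)
  have "variance_on V \<pi> (\<lambda>x. if x = a then 1 else 0) > 0" (is "variance_on V \<pi> ?d > 0")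
  proof -
    have nn: "0 \<le> (?d x - ?d y)\<^sup>2 * \<pi> x * \<pi> y" if "x \<in> V" "y \<in> V" for x y
      by (intro mult_nonneg_nonneg zero_le_power2 less_imp_le[OF pos] that)
    have "0 < (?d a - ?d b)\<^sup>2 * \<pi> a * \<pi> b" using ab pos by simp
    also have "\<dots> \<le> (\<Sum>y\<in>V. (?d a - ?d y)\<^sup>2 * \<pi> a * \<pi> y)"
      by (rule member_le_sum[OF ab(2) _ fin]) (rule nn[OF ab(1)], blast)
    also have "\<dots> \<le> (\<Sum>x\<in>V. \<Sum>y\<in>V. (?d x - ?d y)\<^sup>2 * \<pi> x * \<pi> y)"
      by (rule member_le_sum[where f = "\<lambda>x. \<Sum>y\<in>V. (?d x - ?d y)\<^sup>2 * \<pi> x * \<pi> y", OF ab(1) _ fin])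
        (rule sum_nonneg, rule nn, auto)
    finally show ?thesis by (simp add: variance_on_def)
  qed
  from norm_mem[OF this] have "S \<noteq> {}" by blast
  moreover have "continuous_on S (dirichlet_form V \<pi> P)"
    unfolding dirichlet_form_def
    by (intro continuous_intros continuous_on_subset[OF coord]) auto
  ultimately obtain f where f: "f \<in> S" "\<And>g. g \<in> S \<Longrightarrow> dirichlet_form V \<pi> P f \<le> dirichlet_form V \<pi> P g"
    using continuous_attains_inf[OF \<open>compact S\<close>] by blast
  have f0: "(\<Sum>x\<in>V. \<pi> x * f x) = 0" "variance_on V \<pi> f = 1"
    using f(1) var[of f] by (auto simp: S_def)
  show thesis
  proof (rule that[OF f0])
    fix g
    show "dirichlet_form V \<pi> P f * variance_on V \<pi> g \<le> dirichlet_form V \<pi> P g"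
    proof (cases "variance_on V \<pi> g = 0")
      case False
      then have v: "variance_on V \<pi> g > 0" using var_nonneg[of g] by simp
      show ?thesis using f(2)[OF norm_mem[OF v]] v by (simp add: shift field_simps)
    next
      case True
      have "g x = g y" if "x \<in> V" "y \<in> V" for x y
      proof (rule dirichlet_form_zero_imp_constant[of V \<pi> "\<lambda>x y. \<pi> y" g x y])
        fix x y assume "x \<in> V" "y \<in> V"
        have "kernel_pow V (\<lambda>x. \<pi>) (Suc 0) x y = \<pi> y"
          using \<open>y \<in> V\<close> fin by (simp add: if_distrib[of "\<lambda>t. _ * t"] cong: if_cong)
        then show "\<exists>t. 0 < kernel_pow V (\<lambda>x. \<pi>) t x y" using pos[OF \<open>y \<in> V\<close>] by metis
      qed (use that fin pos True in \<open>auto simp: variance_on_dirichlet intro: less_imp_le\<close>)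
      then have "dirichlet_form V \<pi> P g = 0" by (rule dirichlet_form_constant)
      with True show ?thesis by simp
    qed
  qed
qed

theorem spectral_gap_variational:
  assumes fin: "finite V" and card: "2 \<le> card V"
    and pos: "\<And>x. x \<in> V \<Longrightarrow> 0 < \<pi> x" and one: "(\<Sum>x\<in>V. \<pi> x) = 1"
    and nonneg: "\<And>x y. x \<in> V \<Longrightarrow> y \<in> V \<Longrightarrow> 0 \<le> P x y"
    and rows: "\<And>x. x \<in> V \<Longrightarrow> (\<Sum>y\<in>V. P x y) = 1"
    and stat: "\<And>y. y \<in> V \<Longrightarrow> (\<Sum>x\<in>V. \<pi> x * P x y) = \<pi> y"
    and irred: "\<And>x y. x \<in> V \<Longrightarrow> y \<in> V \<Longrightarrow> \<exists>t. 0 < kernel_pow V P t x y"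
  shows "spectral_gap V P \<pi> =
    (INF f\<in>{f. variance_on V \<pi> f \<noteq> 0}. dirichlet_form V \<pi> P f / variance_on V \<pi> f)"
proof -
  define K where "K = additive_reversibilization \<pi> P"
  obtain f0 where f0: "(\<Sum>x\<in>V. \<pi> x * f0 x) = 0" "variance_on V \<pi> f0 = 1"
    and min: "\<And>g. dirichlet_form V \<pi> P f0 * variance_on V \<pi> g \<le> dirichlet_form V \<pi> P g"
    by (rule rayleigh_minimizer[OF fin card pos one, where P = P]) (assumption, rule that)
  define c where "c = dirichlet_form V \<pi> P f0"
  have B: "dirichlet_bilin V \<pi> P f g = (\<Sum>x\<in>V. \<pi> x * g x * (f x - (\<Sum>y\<in>V. K x y * f y)))" for f g
    unfolding K_def by (rule dirichlet_bilin_eq[OF pos rows stat])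
  have C: "dirichlet_bilin V \<pi> (\<lambda>x y. \<pi> y) f g = (\<Sum>x\<in>V. \<pi> x * g x * (f x - (\<Sum>y\<in>V. \<pi> y * f y)))" for f g
    by (rule covariance_eq[OF pos one])
  have E_nonneg: "0 \<le> dirichlet_form V \<pi> P f" for f
    by (rule dirichlet_form_nonneg) (auto intro: nonneg less_imp_le pos)
  have eig: "dirichlet_bilin V \<pi> P f g = (1 - \<mu>) * (\<Sum>x\<in>V. \<pi> x * g x * f x)"
    if "\<forall>x\<in>V. (\<Sum>y\<in>V. K x y * f y) = \<mu> * f x" for f g \<mu>
    unfolding B sum_distrib_left using that by (intro sum.cong) (auto simp: algebra_simps)
  have sq_pos: "0 < (\<Sum>x\<in>V. \<pi> x * f x * f x)" if "\<exists>x\<in>V. f x \<noteq> 0" for f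
  proof -
    from that obtain x where x: "x \<in> V" "f x \<noteq> 0" by blast
    have "0 < \<pi> x * f x * f x" using x pos by (simp add: mult.assoc zero_less_mult_iff) linarith
    then show ?thesis
      by (rule sum_pos2[OF fin x(1)])
        (simp add: mult.assoc less_imp_le[OF pos])
  qed
  have le1: "\<mu> \<le> 1" if "is_eigenvalue V K \<mu>" for \<mu>
  proof -
    from that obtain f where f: "\<exists>x\<in>V. f x \<noteq> 0" "\<forall>x\<in>V. (\<Sum>y\<in>V. K x y * f y) = \<mu> * f x"
      by (auto simp: is_eigenvalue_def)
    have "0 \<le> (1 - \<mu>) * (\<Sum>x\<in>V. \<pi> x * f x * f x)"
      using E_nonneg[of f] eig[OF f(2), of f] by (simp add: dirichlet_form_bilin)
    then show ?thesis using sq_pos[OF f(1)] by (simp add: zero_le_mult_iff)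
  qed
  have is1: "is_eigenvalue V K 1"
  proof -
    have "(\<Sum>y\<in>V. K x y) = 1" if "x \<in> V" for x
    proof -
      have "(\<Sum>y\<in>V. K x y) = ((\<Sum>y\<in>V. P x y) + (\<Sum>y\<in>V. \<pi> y * P y x) / \<pi> x) / 2"
        unfolding K_def additive_reversibilization_def reversal_def
        by (simp add: sum.distrib flip: sum_divide_distrib)
      then show ?thesis using rows stat pos[of x] that by simp
    qed
    moreover have "V \<noteq> {}" using card by auto
    ultimately show ?thesis unfolding is_eigenvalue_def by (intro exI[of _ "\<lambda>_. 1"]) auto
  qed
  have mu0: "(GREATEST \<mu>. is_eigenvalue V K \<mu>) = 1"
    by (rule Greatest_equality) (auto intro: is1 le1)
  have "c \<noteq> 0"
  proof
    assume "c = 0"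
    then have zero: "dirichlet_form V \<pi> P f0 = 0" by (simp add: c_def)
    have "variance_on V \<pi> f0 = 0" unfolding variance_on_dirichlet
      by (rule dirichlet_form_constant)
        (rule dirichlet_form_zero_imp_constant[OF fin pos nonneg irred zero])
    with f0(2) show False by simp
  qed
  have isc: "is_eigenvalue V K (1 - c)"
  proof -
    have "(\<Sum>y\<in>V. K x y * f0 y) = (1 - c) * f0 x" if x: "x \<in> V" for x
    proof -
      let ?g = "\<lambda>z. if z = x then 1 else 0 :: real"
      let ?B = "dirichlet_bilin V \<pi> P f0 ?g" and ?C = "dirichlet_bilin V \<pi> (\<lambda>x y. \<pi> y) f0 ?g"
      have "0 \<le> t * (2 * (?B - c * ?C)) + t\<^sup>2 * (dirichlet_form V \<pi> P ?g - c * variance_on V \<pi> ?g)" for t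
        using min[of "\<lambda>z. f0 z + t * ?g z"] f0(2)
        unfolding variance_on_dirichlet dirichlet_form_add c_def[symmetric]
        by (simp add: algebra_simps)
      from linear_coeff_zero[OF this] have "?B = c * ?C" by simp
      moreover have "?B = \<pi> x * (f0 x - (\<Sum>y\<in>V. K x y * f0 y))"
        unfolding B using x fin by (simp add: if_distrib if_distribR cong: if_cong)
      moreover have "?C = \<pi> x * f0 x"
        unfolding C f0 using x fin by (simp add: if_distrib if_distribR cong: if_cong)
      ultimately have "\<pi> x * (f0 x - (\<Sum>y\<in>V. K x y * f0 y)) = \<pi> x * (c * f0 x)" by simp
      then have "f0 x - (\<Sum>y\<in>V. K x y * f0 y) = c * f0 x"
        using pos[OF x] by (simp only: mult_left_cancel[OF less_imp_neq[OF pos[OF x], symmetric]])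
      then show ?thesis by (simp add: algebra_simps)
    qed
    moreover have "\<exists>x\<in>V. f0 x \<noteq> 0"
    proof (rule ccontr)
      assume "\<not> ?thesis"
      then have "variance_on V \<pi> f0 = 0"
        unfolding variance_on_def by (auto intro!: sum.neutral)
      with f0(2) show False by simp
    qed
    ultimately show ?thesis unfolding is_eigenvalue_def by blast
  qed
  have lec: "\<mu> \<le> 1 - c" if "is_eigenvalue V K \<mu>" "\<mu> \<noteq> 1" for \<mu>
  proof -
    from that obtain f where f: "\<exists>x\<in>V. f x \<noteq> 0" "\<forall>x\<in>V. (\<Sum>y\<in>V. K x y * f y) = \<mu> * f x"
      by (auto simp: is_eigenvalue_def)
    have "dirichlet_bilin V \<pi> P f (\<lambda>_. 1) = 0" by (simp add: dirichlet_bilin_def)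
    with eig[OF f(2), of "\<lambda>_. 1"] that(2) have "(\<Sum>x\<in>V. \<pi> x * f x) = 0" by simp
    then have "variance_on V \<pi> f = (\<Sum>x\<in>V. \<pi> x * f x * f x)"
      by (simp add: variance_on_dirichlet dirichlet_form_bilin C)
    then have "c * (\<Sum>x\<in>V. \<pi> x * f x * f x) \<le> (1 - \<mu>) * (\<Sum>x\<in>V. \<pi> x * f x * f x)"
      using min[of f] eig[OF f(2), of f] by (simp add: dirichlet_form_bilin c_def)
    then show ?thesis using sq_pos[OF f(1)] by simp
  qed
  have "(GREATEST \<mu>. is_eigenvalue V K \<mu> \<and> \<mu> \<noteq> 1) = 1 - c"
    by (rule Greatest_equality) (use isc lec \<open>c \<noteq> 0\<close> in auto)
  then have "spectral_gap V P \<pi> = c"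
    unfolding spectral_gap_def Let_def K_def[symmetric] mu0 by simp
  moreover have "(INF f\<in>{f. variance_on V \<pi> f \<noteq> 0}. dirichlet_form V \<pi> P f / variance_on V \<pi> f) = c"
  proof (rule cInf_eq_minimum)
    show "c \<in> (\<lambda>f. dirichlet_form V \<pi> P f / variance_on V \<pi> f) ` {f. variance_on V \<pi> f \<noteq> 0}"
      using f0(2) by (intro image_eqI[of _ _ f0]) (auto simp: c_def)
  next
    fix r assume "r \<in> (\<lambda>f. dirichlet_form V \<pi> P f / variance_on V \<pi> f) ` {f. variance_on V \<pi> f \<noteq> 0}"
    then obtain f where f: "variance_on V \<pi> f \<noteq> 0" "r = dirichlet_form V \<pi> P f / variance_on V \<pi> f" by blast
    have "0 \<le> variance_on V \<pi> f"
      unfolding variance_on_dirichlet by (rule dirichlet_form_nonneg) (auto intro: less_imp_le pos)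
    with f(1) have "0 < variance_on V \<pi> f" by simp
    then show "c \<le> r" using min[of f] f(2) by (simp add: c_def pos_le_divide_eq)
  qed
  ultimately show ?thesis by simp
qed

end

theory Submission
  imports Defs "Graph_Theory.Euler"
begin

text \<open>
  \<^bold>\<open>The spectral gap.\<close>  A balanced, strongly connected digraph has an Eulerian circuit, a closed
  walk of length \<open>m\<close> that uses every arc once.  Read along this circuit, a function on the vertices
  becomes a function on the cycle \<open>\<int>/m\<close>; its variance under \<open>\<pi>\<close> is the variance under the uniform
  distribution, and its Dirichlet form is the one of the cycle.  So the Poincare inequality of
  the walk (\<open>poincare\<close>) is the discrete Wirtinger inequality on the cycle (\<open>discrete_wirtinger\<close>),
  whose sharp constant \<open>1 - cos (2 pi / m)\<close> comes from the discrete Fourier transform.  The lazy walk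
  has half the Dirichlet form.

  \<^bold>\<open>Convergence.\<close>  This is the method of evolving sets.  The row \<open>P\<^sup>t(x, \<cdot>)\<close> is a mixture
  of copies of \<open>\<pi>\<close> conditioned on random sets \<open>S\<^sub>t\<close>, with \<open>S\<^sub>0 = {x}\<close>, and its total
  variation and \<open>L\<^sup>2\<close> distances from \<open>\<pi>\<close> are at most the average of a concave function \<open>F\<close> of the measure \<open>\<pi>(S\<^sub>t)\<close>,
  divided by \<open>\<pi> x\<close>: \<open>a (1 - a)\<close> for total variation and \<open>sqrt (a (1 - a))\<close> for the \<open>L\<^sup>2\<close> distance.  Given \<open>S\<^sub>t = A\<close>
  with measure \<open>a\<close>, the next set can be chosen as follows: a fair coin decides whether its mean
  measure is \<open>a + h\<close> or \<open>a - h\<close>, where the overlap \<open>h\<close> is the sum over \<open>y\<close> of the smaller one of the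
  stationary flows from \<open>A\<close> and from its complement into \<open>y\<close>.  By Jensen's inequality \<open>F\<close> then drops
  at least from \<open>F a\<close> to \<open>(F (a + h) + F (a - h)) / 2\<close> (\<open>evolve_concave\<close>).  Let \<open>d\<close> be a lower bound
  for the overlap of all nontrivial sets.

  For \<open>F a = sin (pi a)\<close> the addition theorem turns this into a contraction by \<open>cos (pi d)\<close>.  As every
  nontrivial set has measure between \<open>d\<close> and \<open>1 - d\<close>, comparing \<open>a (1 - a)\<close> with \<open>sin (pi a)\<close> on this
  interval gives total variation at most \<open>(1 - d) cos (pi d)\<^sup>t\<close> (\<open>tv_dist_le\<close>), from which
  the eigenvalue bound and the first bounds on the mixing times follow.

  For \<open>F a = sqrt (a (1 - a))\<close> the relative drop grows with the distance of \<open>a\<close> from \<open>1/2\<close>.  A second use of Jensen's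
  inequality makes it a recursion for the bound on the \<open>L\<^sup>2\<close> distance alone (\<open>chi_bound_step\<close>), a
  discrete version of a differential equation that can be solved explicitly
  (\<open>decaying_sequence_bound\<close>).  The uniform distance at time \<open>s + t\<close> is at most the product of
  the \<open>L\<^sup>2\<close> distance of the chain at time \<open>s\<close> and the one of its time reversal at time \<open>t\<close>.

  It remains to bound the overlap for the chain and for its reversal.  Stationary flows are
  multiples of \<open>1 / m\<close>.  For the lazy walk the overlap of \<open>A\<close> is the mean of the flows across the
  boundary of \<open>A\<close> in the two directions, hence at least \<open>1 / m\<close>.  Under the expansion condition it
  is at least \<open>2 / m\<close>: if at most one vertex received flow both from \<open>A\<close> and from its complement, then
  removing it from the neighbourhood of the smaller one of these sets would leave too little mass
  (\<open>overlap_of_expansion\<close>, and \<open>reversal_overlap_of_expansion\<close> for the reversal).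
\<close>

section \<open>Inequalities for one step of the set process\<close>

text \<open>
  The difference of the two sides vanishes at \<open>0\<close> and at \<open>pi / 2\<close>, and its derivative
  \<open>(pi\<^sup>2 - 8 - 4 x\<^sup>2) cos x\<close> changes sign once, from plus to minus, so the difference rises from zero
  and falls back to zero.
\<close>

lemma steckin_inequality:
  fixes x :: real
  assumes "0 \<le> x" "x \<le> pi / 2"
  shows "8 * x * cos x \<le> (pi\<^sup>2 - 4 * x\<^sup>2) * sin x"
proof -
  define w where "w = (\<lambda>x::real. (pi\<^sup>2 - 4 * x\<^sup>2) * sin x - 8 * x * cos x)"
  define x0 where "x0 = sqrt (pi\<^sup>2 - 8) / 2"
  have pi8: "pi\<^sup>2 - 8 > 0"
  proof -
    have "3 * 3 < pi * pi" using pi_gt3 by (intro mult_strict_mono) auto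
    then show ?thesis by (simp add: power2_eq_square)
  qed
  have x0: "0 \<le> x0" "4 * x0\<^sup>2 = pi\<^sup>2 - 8" using pi8 by (auto simp: x0_def power_divide)
  have der: "(w has_real_derivative (pi\<^sup>2 - 8 - 4 * x\<^sup>2) * cos x) (at x)" for x
    unfolding w_def
    by (auto intro!: derivative_eq_intros simp: algebra_simps)
  have "0 \<le> w x"
  proof (cases "x \<le> x0")
    case True
    have "w 0 \<le> w x"
    proof (rule DERIV_nonneg_imp_nondecreasing[OF assms(1)])
      fix y assume y: "0 \<le> y" "y \<le> x"
      have "y\<^sup>2 \<le> x0\<^sup>2" using y True by (intro power_mono) auto
      moreover have "0 \<le> cos y" using y assms by (intro cos_ge_zero) auto
      ultimately have "0 \<le> (pi\<^sup>2 - 8 - 4 * y\<^sup>2) * cos y" using x0 by (intro mult_nonneg_nonneg) auto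
      then show "\<exists>D. (w has_real_derivative D) (at y) \<and> 0 \<le> D" using der by blast
    qed
    then show ?thesis by (simp add: w_def)
  next
    case False
    have "w (pi / 2) \<le> w x"
    proof (rule DERIV_nonpos_imp_nonincreasing[OF assms(2)])
      fix y assume y: "x \<le> y" "y \<le> pi / 2"
      have "x0\<^sup>2 \<le> y\<^sup>2" using y False x0 by (intro power_mono) auto
      moreover have "0 \<le> cos y" using y assms by (intro cos_ge_zero) auto
      ultimately have "(pi\<^sup>2 - 8 - 4 * y\<^sup>2) * cos y \<le> 0" using x0 by (intro mult_nonpos_nonneg) auto
      then show "\<exists>D. (w has_real_derivative D) (at y) \<and> D \<le> 0" using der by blast
    qed
    then show ?thesis by (simp add: w_def power_divide)
  qed
  then show ?thesis by (simp add: w_def)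
qed

text \<open>
  The quotient \<open>sin (pi a) / (a (1 - a))\<close> increases up to \<open>a = 1/2\<close>: after the substitution
  \<open>a = 1/2 - x / pi\<close> the numerator of its derivative is a positive multiple of the difference of the
  two sides of Steckin's inequality.
\<close>

lemma logistic_over_sine_antimono:
  fixes q a :: real
  assumes q: "0 < q" "q \<le> a" and a: "a \<le> 1/2"
  shows "a * (1 - a) * sin (pi * q) \<le> q * (1 - q) * sin (pi * a)"
proof -
  define G where "G = (\<lambda>a::real. sin (pi * a) / (a * (1 - a)))"
  have "G q \<le> G a"
  proof (rule DERIV_nonneg_imp_nondecreasing[OF q(2)])
    fix y assume y: "q \<le> y" "y \<le> a"
    then have y01: "0 < y" "y \<le> 1/2" using q a by auto
    define D where "D = (pi * cos (pi * y) * (y * (1 - y)) - sin (pi * y) * (1 - 2 * y)) / (y * (1 - y))\<^sup>2"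
    have "(G has_real_derivative D) (at y)"
      unfolding G_def D_def using y01
      by (auto intro!: derivative_eq_intros simp: power2_eq_square algebra_simps)
    moreover have "0 \<le> D"
    proof -
      define x where "x = pi / 2 - pi * y"
      have x: "0 \<le> x" "x \<le> pi / 2" using y01 by (auto simp: x_def field_simps)
      have yx: "y = 1/2 - x / pi" by (simp add: x_def field_simps)
      have "pi * y = pi / 2 - x" by (simp add: x_def)
      then have tr: "cos (pi * y) = sin x" "sin (pi * y) = cos x"
        by (simp_all add: cos_diff sin_diff)
      have "4 * pi * (pi * cos (pi * y) * (y * (1 - y)) - sin (pi * y) * (1 - 2 * y))
          = (pi\<^sup>2 - 4 * x\<^sup>2) * sin x - 8 * x * cos x"
        unfolding tr unfolding yx by (simp add: power2_eq_square field_simps)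
      also have "\<dots> \<ge> 0" using steckin_inequality[OF x] by simp
      finally have "0 \<le> pi * cos (pi * y) * (y * (1 - y)) - sin (pi * y) * (1 - 2 * y)"
        using pi_gt_zero by (auto simp: zero_le_mult_iff simp del: pi_gt_zero)
      then show ?thesis unfolding D_def by simp
    qed
    ultimately show "\<exists>D. (G has_real_derivative D) (at y) \<and> 0 \<le> D" by blast
  qed
  then show ?thesis using q a by (simp add: G_def field_simps)
qed

text \<open>
  Both sides are symmetric under \<open>a \<mapsto> 1 - a\<close>, so monotonicity on the left half of the interval
  suffices.  The range \<open>q \<le> a \<le> 1 - q\<close> is essential: without the gap at the ends the best constant
  in place of \<open>q (1 - q) / sin (pi q)\<close> would be \<open>1 / pi\<close>, which is larger.
\<close>

lemma logistic_le_sine: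
  fixes q a :: real
  assumes q: "0 < q" "q \<le> a" and a: "a \<le> 1 - q"
  shows "a * (1 - a) * sin (pi * q) \<le> q * (1 - q) * sin (pi * a)"
proof (cases "a \<le> 1/2")
  case True
  then show ?thesis using logistic_over_sine_antimono[OF q] by simp
next
  case False
  have "sin (pi * (1 - a)) = sin (pi * a)" by (simp add: right_diff_distrib sin_diff)
  then show ?thesis
    using logistic_over_sine_antimono[of q "1 - a"] False q a by (simp add: mult.commute)
qed

text \<open>
  The right-hand side is the Taylor polynomial of degree two in \<open>d\<close> of the left-hand side.  The two
  radicands are \<open>w + h\<close> and \<open>w - h\<close> with \<open>w = z - d\<^sup>2\<close> and \<open>h = d (1 - 2 a)\<close>.  Bounding the mean of the
  roots by \<open>sqrt w - h\<^sup>2 / (8 w sqrt w)\<close> and \<open>sqrt w\<close> by its tangent at \<open>z\<close>, the terms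
  \<open>d\<^sup>2 / (2 sqrt z)\<close> cancel because \<open>h\<^sup>2 = d\<^sup>2 (1 - 4 z)\<close>.
\<close>

lemma sqrt_logistic_average:
  fixes a d :: real
  assumes d: "0 \<le> d" "d \<le> a" "d \<le> 1 - a" and a: "0 < a" "a < 1"
  defines "z \<equiv> a * (1 - a)"
  shows "(sqrt ((a + d) * (1 - (a + d))) + sqrt ((a - d) * (1 - (a - d)))) / 2
      \<le> sqrt z - d\<^sup>2 / (8 * z * sqrt z)"
proof -
  define w h where "w = z - d\<^sup>2" and "h = d * (1 - 2 * a)"
  have z: "0 < z" using a by (simp add: z_def)
  have wh: "(a + d) * (1 - (a + d)) = w + h" "(a - d) * (1 - (a - d)) = w - h"
    by (simp_all add: w_def h_def z_def power2_eq_square algebra_simps)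
  have wh0: "0 \<le> w + h" "0 \<le> w - h"
    unfolding wh[symmetric] using d a by (auto intro!: mult_nonneg_nonneg)
  have h2: "h\<^sup>2 = d\<^sup>2 * (1 - 4 * z)"
    by (simp add: h_def z_def power2_eq_square algebra_simps)
  show ?thesis
  proof (cases "w = 0")
    case True
    with wh0 have h: "h = 0" by simp
    have dz: "d\<^sup>2 = z" using True by (simp add: w_def)
    with h2 h z have z4: "z = 1/4" by simp
    have "sqrt z = 1/2" unfolding z4 by (simp add: real_sqrt_divide)
    then show ?thesis unfolding wh by (simp only: True h dz) (simp add: z4)
  next
    case False
    then have w: "0 < w" using wh0 by simp
    define s where "s = sqrt w"
    define r where "r = sqrt z"
    have s: "0 < s" "s\<^sup>2 = w" and r: "0 < r" "r\<^sup>2 = z" using w z by (auto simp: s_def r_def)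
    have sr: "s \<le> r" by (simp add: s_def r_def w_def)
    have "(sqrt (w + h) + sqrt (w - h)) / 2 \<le> s - h\<^sup>2 / (8 * s ^ 3)"
    proof -
      define A B where "A = sqrt (w + h)" and "B = sqrt (w - h)"
      have AB: "A\<^sup>2 = w + h" "B\<^sup>2 = w - h" "0 \<le> A" "0 \<le> B" using wh0 by (auto simp: A_def B_def)
      have hw: "h\<^sup>2 \<le> w\<^sup>2" using wh0 by (intro abs_le_square_iff[THEN iffD1]) auto
      have "(A * B)\<^sup>2 = w\<^sup>2 - h\<^sup>2" unfolding power_mult_distrib AB(1,2) by (simp add: power2_eq_square algebra_simps)
      also have "\<dots> \<le> (w - h\<^sup>2 / (2 * w))\<^sup>2"
        using w by (simp add: power2_diff)
      finally have "A * B \<le> w - h\<^sup>2 / (2 * w)"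
      proof (rule power2_le_imp_le)
        have "h\<^sup>2 \<le> 2 * w\<^sup>2" using hw zero_le_power2[of w] by linarith
        then show "0 \<le> w - h\<^sup>2 / (2 * w)"
          using w by (simp add: field_simps power2_eq_square)
      qed
      then have "(A + B)\<^sup>2 \<le> 4 * w - h\<^sup>2 / w"
        using AB by (simp add: power2_sum)
      also have "\<dots> \<le> (2 * s - h\<^sup>2 / (4 * s ^ 3))\<^sup>2"
      proof -
        have "4 * s * (h\<^sup>2 / (4 * s ^ 3)) = h\<^sup>2 / w"
          unfolding s(2)[symmetric] using s(1) by (simp add: power2_eq_square power3_eq_cube)
        then have "(2 * s - h\<^sup>2 / (4 * s ^ 3))\<^sup>2 = 4 * w - h\<^sup>2 / w + (h\<^sup>2 / (4 * s ^ 3))\<^sup>2"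
          by (simp add: power2_diff power_mult_distrib s(2))
        then show ?thesis by simp
      qed
      finally have "A + B \<le> 2 * s - h\<^sup>2 / (4 * s ^ 3)"
      proof (rule power2_le_imp_le)
        have "w\<^sup>2 = s ^ 3 * s" unfolding s(2)[symmetric] by (simp add: power2_eq_square power3_eq_cube)
        then have "h\<^sup>2 \<le> s ^ 3 * s" using hw by simp
        moreover have "0 < s ^ 3 * s" using s(1) by simp
        ultimately have "h\<^sup>2 \<le> 8 * (s ^ 3 * s)" by linarith
        then show "0 \<le> 2 * s - h\<^sup>2 / (4 * s ^ 3)"
          using s(1) by (simp add: pos_divide_le_eq mult_ac)
      qed
      then show ?thesis by (simp add: A_def B_def)
    qed
    also have "\<dots> \<le> (r - d\<^sup>2 / (2 * r)) - h\<^sup>2 / (8 * r ^ 3)"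
    proof -
      have "0 \<le> (r - s)\<^sup>2" by simp
      then have "2 * r * s \<le> r\<^sup>2 + s\<^sup>2" by (simp add: power2_diff algebra_simps)
      then have "s \<le> r - d\<^sup>2 / (2 * r)"
        using r s w_def by (simp add: field_simps power2_eq_square)
      moreover have "h\<^sup>2 / (8 * r ^ 3) \<le> h\<^sup>2 / (8 * s ^ 3)"
        using s sr by (intro divide_left_mono mult_mono power_mono mult_pos_pos) auto
      ultimately show ?thesis by simp
    qed
    also have "\<dots> = r - d\<^sup>2 / (8 * r ^ 3)"
    proof -
      have "h\<^sup>2 / (8 * r ^ 3) = d\<^sup>2 / (8 * r ^ 3) - d\<^sup>2 / (2 * r)"
        unfolding h2 r(2)[symmetric] using r(1) by (simp add: field_simps power2_eq_square power3_eq_cube)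
      then show ?thesis by simp
    qed
    also have "\<dots> = sqrt z - d\<^sup>2 / (8 * z * sqrt z)"
      using r by (simp add: r_def power3_eq_cube)
    finally show ?thesis unfolding wh .
  qed
qed

lemma concave_sin_pi: "concave_on {0..1} (\<lambda>a::real. sin (pi * a))"
proof (rule f''_le0_imp_concave)
  fix x :: real assume x: "x \<in> {0..1}"
  show "((\<lambda>a. sin (pi * a)) has_real_derivative pi * cos (pi * x)) (at x)"
    by (auto intro!: derivative_eq_intros)
  show "((\<lambda>x. pi * cos (pi * x)) has_real_derivative - (pi\<^sup>2 * sin (pi * x))) (at x)"
    by (auto intro!: derivative_eq_intros simp: power2_eq_square)
  have "0 \<le> sin (pi * x)" using x by (intro sin_ge_zero) auto
  then show "- (pi\<^sup>2 * sin (pi * x)) \<le> 0" by simp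
qed simp

text \<open>
  This is the Cauchy-Schwarz inequality \<open>sqrt (p q) + sqrt (r s) \<le> sqrt ((p + r) (q + s))\<close>; it covers
  the endpoints, where the function has no derivative.
\<close>

lemma concave_sqrt_logistic: "concave_on {0..1} (\<lambda>a::real. sqrt (a * (1 - a)))"
  unfolding concave_on_iff
proof (intro conjI ballI allI impI)
  fix a b u v :: real
  assume ab: "a \<in> {0..1}" "b \<in> {0..1}" and uv: "0 \<le> u" "0 \<le> v" "u + v = 1"
  define p q r s where "p = u * a" and "q = u * (1 - a)" and "r = v * b" and "s = v * (1 - b)"
  have nn: "0 \<le> p" "0 \<le> q" "0 \<le> r" "0 \<le> s" using ab uv by (auto simp: p_def q_def r_def s_def)
  have "u * sqrt (a * (1 - a)) = sqrt (u\<^sup>2 * (a * (1 - a)))" using uv by (simp add: real_sqrt_mult)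
  then have 1: "u * sqrt (a * (1 - a)) = sqrt (p * q)" by (simp add: p_def q_def power2_eq_square mult_ac)
  have "v * sqrt (b * (1 - b)) = sqrt (v\<^sup>2 * (b * (1 - b)))" using uv by (simp add: real_sqrt_mult)
  then have 2: "v * sqrt (b * (1 - b)) = sqrt (r * s)" by (simp add: r_def s_def power2_eq_square mult_ac)
  have "1 - (u * a + v * b) = q + s" using uv by (simp add: q_def s_def algebra_simps)
  then have 3: "(u *\<^sub>R a + v *\<^sub>R b) * (1 - (u *\<^sub>R a + v *\<^sub>R b)) = (p + r) * (q + s)"
    by (simp add: p_def r_def)
  have "sqrt (p * q) + sqrt (r * s) \<le> sqrt ((p + r) * (q + s))"
  proof (rule real_le_rsqrt)
    have "sqrt (p * q) * sqrt (r * s) = sqrt ((p * s) * (q * r))"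
      by (simp add: mult_ac flip: real_sqrt_mult)
    also have "\<dots> \<le> (p * s + q * r) / 2"
      using nn by (intro arith_geo_mean_sqrt mult_nonneg_nonneg)
    finally have "2 * (sqrt (p * q) * sqrt (r * s)) \<le> p * s + q * r" by simp
    then show "(sqrt (p * q) + sqrt (r * s))\<^sup>2 \<le> (p + r) * (q + s)"
      using nn by (simp add: power2_sum algebra_simps)
  qed
  then show "u * sqrt (a * (1 - a)) + v * sqrt (b * (1 - b))
      \<le> sqrt ((u *\<^sub>R a + v *\<^sub>R b) * (1 - (u *\<^sub>R a + v *\<^sub>R b)))"
    unfolding 1 2 3 .
qed simp

section \<open>The decay of the L2 bound\<close>

text \<open>
  If \<open>a\<close> is the stationary measure of a set, then \<open>y = sqrt ((1 - a) / a)\<close> is the \<open>L\<^sup>2\<close> distance from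
  equilibrium of the stationary distribution conditioned on this set.  Up to a factor that depends on
  the overlap only, one step of the set process lowers \<open>sqrt z\<close>, \<open>z = a (1 - a)\<close>, by \<open>1 / (z sqrt z)\<close>;
  divided by \<open>a\<close> this is \<open>(1 + y\<^sup>2)\<^sup>4 / y\<^sup>3\<close>.  This is convex but blows up at \<open>0\<close>.  The line \<open>16 y\<close> touches its graph
  at \<open>y = 1\<close> and replaces it below \<open>1\<close>, which gives a convex increasing minorant that vanishes at \<open>0\<close>,
  as it has to for the full set.
\<close>

definition decay_rate :: "real \<Rightarrow> real" where
  "decay_rate y = (if y \<le> 1 then 16 * y else (1 + y\<^sup>2) ^ 4 / y ^ 3)"

text \<open>
  Convexity in the form needed for Jensen's inequality.  The value at \<open>0\<close>, attained by the full set,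
  is treated apart from the positive ones: there is no drop there, and the line has to lie below zero.
\<close>

lemma decay_rate_supporting_line:
  assumes "0 \<le> Y"
  obtains s c where "\<And>y. 0 < y \<Longrightarrow> s * y + c \<le> (1 + y\<^sup>2) ^ 4 / y ^ 3" "c \<le> 0" "s * Y + c = decay_rate Y"
proof (cases "Y \<le> 1")
  case True
  show thesis
  proof (rule that[of 16 0])
    fix y :: real assume y: "0 < y"
    have "0 \<le> (y - 1)\<^sup>2" by simp
    then have "2 * y \<le> 1 + y\<^sup>2" by (simp add: power2_diff)
    then have "(2 * y) ^ 4 \<le> (1 + y\<^sup>2) ^ 4" using y by (intro power_mono) auto
    then show "16 * y + 0 \<le> (1 + y\<^sup>2) ^ 4 / y ^ 3"
      using y by (simp add: field_simps power_mult_distrib power_numeral_reduce)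
  qed (use True in \<open>auto simp: decay_rate_def\<close>)
next
  case False
  define f f' f'' :: "real \<Rightarrow> real" where
    "f y = 1 / y ^ 3 + 4 / y + 6 * y + 4 * y ^ 3 + y ^ 5" and
    "f' y = - (3 / y ^ 4) - 4 / y\<^sup>2 + 6 + 12 * y\<^sup>2 + 5 * y ^ 4" and
    "f'' y = 12 / y ^ 5 + 8 / y ^ 3 + 24 * y + 20 * y ^ 3" for y
  have f: "(1 + y\<^sup>2) ^ 4 / y ^ 3 = f y" if "0 < y" for y
    using that by (simp add: f_def field_simps power_numeral_reduce)
  have tangent: "f' Y * (y - Y) \<le> f y - f Y" if "0 < y" for y
  proof (rule f''_imp_f'[where C = "{0<..}" and f = f and f' = f' and f'' = f''])
    fix x :: real assume x: "x \<in> {0<..}"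
    show "(f has_real_derivative f' x) (at x)"
      unfolding f_def f'_def using x
      by (auto intro!: derivative_eq_intros simp: field_simps power_numeral_reduce)
    show "(f' has_real_derivative f'' x) (at x)"
      unfolding f'_def f''_def using x
      by (auto intro!: derivative_eq_intros simp: field_simps power_numeral_reduce)
    show "0 \<le> f'' x" unfolding f''_def using x by auto
  qed (use that False in auto)
  have "Y ^ 3 * (f Y - f' Y * Y) = 4 * ((1 + Y\<^sup>2) ^ 3 * (1 - Y\<^sup>2))"
    using False by (simp add: f_def f'_def field_simps power_numeral_reduce)
  also have "\<dots> \<le> 0"
    using False by (intro mult_nonneg_nonpos) (auto simp: one_le_power)
  finally have "f Y - f' Y * Y \<le> 0"
    using False by (simp add: mult_le_0_iff)
  then show thesis
    using that[of "f' Y" "f Y - f' Y * Y"] tangent f False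
    by (simp add: decay_rate_def algebra_simps)
qed

lemma decay_rate_pos: "0 < y \<Longrightarrow> 0 < decay_rate y"
  by (auto simp: decay_rate_def intro!: divide_pos_pos zero_less_power add_pos_nonneg)

text \<open>
  This is the antiderivative of \<open>- 1 / decay_rate\<close> that vanishes at infinity: the time in which a
  solution of \<open>y' = - decay_rate y\<close> comes down from infinity to \<open>y\<close>.  The two branches meet at
  \<open>1/24\<close>.
\<close>

definition decay_time :: "real \<Rightarrow> real" where
  "decay_time y = (if y \<le> 1 then 1/24 - ln y / 16 else (1 + 3 * y\<^sup>2) / (12 * (1 + y\<^sup>2) ^ 3))"

text \<open>
  As the rate increases with \<open>y\<close>, the integral of its reciprocal over \<open>[u, v]\<close> is at least the length
  of the interval divided by the rate at the right end.  So a discrete step gains at least as much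
  time as the differential equation does.
\<close>

lemma decay_time_step:
  assumes "0 < u" "u \<le> v"
  shows "(v - u) / decay_rate v \<le> decay_time u - decay_time v"
proof -
  have low: "(v - u) / decay_rate v \<le> decay_time u - decay_time v" if "0 < u" "u \<le> v" "v \<le> 1" for u v
  proof -
    have "ln (u / v) \<le> u / v - 1" using that by (intro ln_le_minus_one) auto
    then have "(v - u) / v \<le> ln v - ln u" using that by (simp add: ln_div field_simps)
    then show ?thesis using that by (simp add: decay_rate_def decay_time_def field_simps)
  qed
  have rate: "decay_rate y = (1 + y\<^sup>2) ^ 4 / y ^ 3"
    and time: "decay_time y = (1 + 3 * y\<^sup>2) / (12 * (1 + y\<^sup>2) ^ 3)" if "1 \<le> y" for y
    using that by (auto simp: decay_rate_def decay_time_def)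
  have mono: "decay_rate u \<le> decay_rate v" if uv: "1 \<le> u" "u \<le> v" for u v
  proof -
    have "1 * 1 \<le> u * v" using uv by (intro mult_mono) auto
    then have "0 \<le> (v - u) * (u * v - 1)" using uv by (intro mult_nonneg_nonneg) auto
    then have "(1 + u\<^sup>2) / u \<le> (1 + v\<^sup>2) / v"
      using uv by (simp add: field_simps power2_eq_square)
    then have "((1 + u\<^sup>2) / u) ^ 3 * (1 + u\<^sup>2) \<le> ((1 + v\<^sup>2) / v) ^ 3 * (1 + v\<^sup>2)"
      using uv by (intro mult_mono power_mono add_mono) auto
    then show ?thesis using uv
      by (simp add: rate power_divide power_numeral_reduce mult_ac)
  qed
  have high: "(v - u) / decay_rate v \<le> decay_time u - decay_time v" if uv: "1 \<le> u" "u \<le> v" for u v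
  proof (cases "u = v")
    case False
    then have "u < v" using uv by simp
    define D :: "real \<Rightarrow> real" where "D y = - (y ^ 3 / (1 + y\<^sup>2) ^ 4)" for y
    have nz: "1 + y\<^sup>2 \<noteq> (0::real)" for y by (smt (verit) zero_le_power2)
    have der: "((\<lambda>y. (1 + 3 * y\<^sup>2) / (12 * (1 + y\<^sup>2) ^ 3)) has_real_derivative D y) (at y)" for y
      unfolding D_def using nz[of y]
      by (auto intro!: derivative_eq_intros simp: nz)
        (simp add: divide_simps, simp add: algebra_simps power_numeral_reduce)
    obtain x where x: "u < x" "x < v" "decay_time v - decay_time u = (v - u) * D x"
      using MVT2[OF \<open>u < v\<close>, of "\<lambda>y. (1 + 3 * y\<^sup>2) / (12 * (1 + y\<^sup>2) ^ 3)" D] der uv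
      by (auto simp: time)
    have D: "D x = - (1 / decay_rate x)" using x uv by (simp add: D_def rate)
    have "1 / decay_rate v \<le> 1 / decay_rate x"
      using x uv mono[of x v] decay_rate_pos[of x] by (intro divide_left_mono mult_pos_pos decay_rate_pos) auto
    then have "(v - u) * (1 / decay_rate v) \<le> (v - u) * (1 / decay_rate x)"
      using uv by (intro mult_left_mono) auto
    then show ?thesis using x(3) D by simp
  qed simp
  show ?thesis
  proof (cases "v \<le> 1 \<or> 1 \<le> u")
    case True
    then show ?thesis using low high assms by blast
  next
    case False
    have "(1 - u) / decay_rate v \<le> (1 - u) / decay_rate 1"
      using False mono[of 1 v] by (intro divide_left_mono mult_pos_pos decay_rate_pos) auto
    also have "\<dots> \<le> decay_time u - decay_time 1" using low[of u 1] assms False by simp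
    finally show ?thesis using high[of 1 v] False by (simp add: diff_divide_distrib)
  qed
qed

text \<open>
  After \<open>t\<close> steps the sequence is at least as far as the differential equation is at time \<open>t\<close>, and in
  fact further: the equation starts at infinity, while the sequence starts at a finite value, which is
  worth at least \<open>4/3\<close> steps.  For odd \<open>T\<close> this head start makes up for the half step lost in
  \<open>T div 2\<close>.
\<close>

lemma decaying_sequence_bound:
  fixes Y :: "nat \<Rightarrow> real"
  assumes d: "0 < d" "d \<le> 1/2"
    and nonneg: "\<And>t. 0 \<le> Y t" and start: "Y 0 \<le> sqrt (1 / d - 1)"
    and step: "\<And>t. Y (Suc t) \<le> Y t - d\<^sup>2 / 8 * decay_rate (Y t)"
    and eps: "0 < \<epsilon>"
    and T: "(if \<epsilon> \<le> 1 then 4 / d\<^sup>2 * (1/6 + ln (1 / \<epsilon>) / 8)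
              else 4 / d\<^sup>2 * ((1 + 3 * \<epsilon>) / (3 * (1 + \<epsilon>) ^ 3))) \<le> real T"
  shows "(Y (T div 2))\<^sup>2 \<le> \<epsilon>"
proof (rule ccontr)
  assume "\<not> ?thesis"
  then have "sqrt \<epsilon> < sqrt ((Y (T div 2))\<^sup>2)" by (intro real_sqrt_less_mono) simp
  then have big: "sqrt \<epsilon> < Y (T div 2)" using nonneg by simp
  define k where "k = d\<^sup>2 / 8"
  have k: "0 < k" using d by (simp add: k_def)
  have "k * (real t + 4/3) \<le> decay_time (Y t)" if "0 < Y t" for t
    using that
  proof (induction t)
    case 0
    define y where "y = sqrt (1 / d - 1)"
    have d1: "1 \<le> 1 / d - 1" using d by (simp add: field_simps)
    then have y: "1 \<le> y" "1 + y\<^sup>2 = 1 / d" by (auto simp: y_def)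
    then have y2: "y\<^sup>2 = 1 / d - 1" by simp
    have "k * (4/3) \<le> decay_time y"
    proof -
      have "decay_time y = (1 + 3 * (1 / d - 1)) / (12 * (1 / d) ^ 3)"
        unfolding y2[symmetric] y(2)[symmetric] using y(1) by (auto simp: decay_time_def)
      also have "\<dots> = d\<^sup>2 * (3 - 2 * d) / 12"
        using d by (simp add: field_simps power_numeral_reduce)
      \<comment> \<open>this is where \<open>d \<le> 1/2\<close> yields the head start\<close>
      also have "\<dots> \<ge> d\<^sup>2 * 2 / 12"
        using d by (intro divide_right_mono mult_left_mono) auto
      finally show ?thesis by (simp add: k_def)
    qed
    also have "\<dots> \<le> decay_time (Y 0)"
    proof -
      have "0 \<le> (y - Y 0) / decay_rate y"
        using start y(1) decay_rate_pos[of y] by (simp add: y_def)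
      also have "\<dots> \<le> decay_time (Y 0) - decay_time y"
        by (rule decay_time_step) (use 0 start in \<open>auto simp: y_def\<close>)
      finally show ?thesis by simp
    qed
    finally show ?case by simp
  next
    case (Suc t)
    have rate0: "0 \<le> decay_rate (Y t)"
      using decay_rate_pos[of "Y t"] nonneg[of t] by (cases "Y t = 0") (auto simp: decay_rate_def)
    have dec: "Y (Suc t) \<le> Y t - k * decay_rate (Y t)" using step[of t] by (simp add: k_def)
    moreover have "0 \<le> k * decay_rate (Y t)" using rate0 k by simp
    ultimately have le: "Y (Suc t) \<le> Y t" by linarith
    with Suc.prems have pos: "0 < Y t" by linarith
    have "k \<le> (Y t - Y (Suc t)) / decay_rate (Y t)"
      using dec decay_rate_pos[OF pos] by (simp add: field_simps)
    also have "\<dots> \<le> decay_time (Y (Suc t)) - decay_time (Y t)"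
      by (rule decay_time_step[OF Suc.prems le])
    finally show ?case using Suc.IH[OF pos] by (simp add: algebra_simps)
  qed
  note time = this
  let ?e = "sqrt \<epsilon>" and ?Y = "Y (T div 2)"
  have e: "0 < ?e" using eps by simp
  have "0 < (?Y - ?e) / decay_rate ?Y"
    using big e by (intro divide_pos_pos decay_rate_pos) linarith+
  also have "\<dots> \<le> decay_time ?e - decay_time ?Y"
    by (rule decay_time_step[OF e]) (use big in simp)
  finally have "decay_time ?Y < decay_time ?e" by simp
  moreover have "decay_time ?e \<le> k * (real T / 2)"
  proof (cases "\<epsilon> \<le> 1")
    case True
    then have "decay_time ?e = 1/24 - ln \<epsilon> / 32" using eps by (simp add: decay_time_def ln_sqrt)
    also have "\<dots> = k * (4 / d\<^sup>2 * (1/6 + ln (1 / \<epsilon>) / 8) / 2)"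
      using d eps by (simp add: k_def ln_div field_simps)
    also have "\<dots> \<le> k * (real T / 2)"
      using T True k by (intro mult_left_mono divide_right_mono) auto
    finally show ?thesis .
  next
    case False
    then have "decay_time ?e = (1 + 3 * \<epsilon>) / (12 * (1 + \<epsilon>) ^ 3)" using eps by (simp add: decay_time_def)
    also have "\<dots> = k * (4 / d\<^sup>2 * ((1 + 3 * \<epsilon>) / (3 * (1 + \<epsilon>) ^ 3)) / 2)"
      using d by (simp add: k_def divide_simps)
    also have "\<dots> \<le> k * (real T / 2)"
      using T False k by (intro mult_left_mono divide_right_mono) auto
    finally show ?thesis .
  qed
  moreover have "k * (real T / 2) \<le> k * (real (T div 2) + 4/3)"
    using k by (intro mult_left_mono) (auto simp: field_simps)
  ultimately show False using time[of "T div 2"] big e by linarith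
qed

section \<open>Random sets with given inclusion probabilities\<close>

text \<open>
  The law of the random subset of \<open>V\<close> that contains each \<open>y\<close> independently with probability \<open>p y\<close>.
  Only the inclusion probabilities matter below; independence is the choice with the simplest
  formula.
\<close>

definition random_subset :: "'a set \<Rightarrow> ('a \<Rightarrow> real) \<Rightarrow> 'a set \<Rightarrow> real" where
  "random_subset V p B = (\<Prod>y\<in>B. p y) * (\<Prod>y\<in>V - B. 1 - p y)"

lemma random_subset_nonneg:
  assumes "\<And>y. y \<in> V \<Longrightarrow> 0 \<le> p y \<and> p y \<le> 1" "B \<in> Pow V"
  shows "0 \<le> random_subset V p B"
  unfolding random_subset_def using assms by (intro mult_nonneg_nonneg prod_nonneg) auto

lemma random_subset_sum:
  assumes "finite V"
  shows "(\<Sum>B\<in>Pow V. random_subset V p B) = 1"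
  using prod_add[OF assms, of p "\<lambda>y. 1 - p y"] by (simp add: random_subset_def)

text \<open>
  Replacing the exclusion factor \<open>1 - p y\<close> by \<open>0\<close> removes exactly the subsets that avoid \<open>y\<close>, and the
  expanded product then collapses to \<open>p y\<close>.
\<close>

lemma random_subset_marginal:
  assumes "finite V" "y \<in> V"
  shows "(\<Sum>B\<in>Pow V. random_subset V p B * of_bool (y \<in> B)) = p y"
proof -
  let ?q = "\<lambda>z. if z = y then 0 else 1 - p z"
  have "(\<Sum>B\<in>Pow V. random_subset V p B * of_bool (y \<in> B)) = (\<Sum>B\<in>Pow V. prod p B * prod ?q (V - B))"
  proof (intro sum.cong refl)
    fix B assume "B \<in> Pow V"
    show "random_subset V p B * of_bool (y \<in> B) = prod p B * prod ?q (V - B)"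
    proof (cases "y \<in> B")
      case True
      then have "prod ?q (V - B) = (\<Prod>z\<in>V - B. 1 - p z)" by (intro prod.cong) auto
      then show ?thesis using True by (simp add: random_subset_def)
    next
      case False
      then have "prod ?q (V - B) = 0" using assms by (intro prod_zero) auto
      then show ?thesis using False by simp
    qed
  qed
  also have "\<dots> = (\<Prod>z\<in>V. p z + ?q z)" by (rule prod_add[OF assms(1), symmetric])
  also have "\<dots> = (\<Prod>z\<in>V. if z = y then p y else 1)" by (intro prod.cong) auto
  also have "\<dots> = p y" using assms by (simp add: prod.delta)
  finally show ?thesis .
qed

lemma weighted_sum_of_measures:
  fixes w :: "'a set \<Rightarrow> real"
  assumes "finite V"
  shows "(\<Sum>B\<in>Pow V. w B * sum f B) = (\<Sum>y\<in>V. f y * (\<Sum>B\<in>Pow V. w B * of_bool (y \<in> B)))"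
proof -
  have "(\<Sum>B\<in>Pow V. w B * sum f B) = (\<Sum>B\<in>Pow V. \<Sum>y\<in>V. f y * (w B * of_bool (y \<in> B)))"
  proof (intro sum.cong refl)
    fix B assume "B \<in> Pow V"
    then have "sum f B = (\<Sum>y\<in>V. f y * of_bool (y \<in> B))"
      using assms by (intro sum.mono_neutral_cong_left) auto
    then show "w B * sum f B = (\<Sum>y\<in>V. f y * (w B * of_bool (y \<in> B)))"
      by (simp add: sum_distrib_left mult_ac)
  qed
  also have "\<dots> = (\<Sum>y\<in>V. f y * (\<Sum>B\<in>Pow V. w B * of_bool (y \<in> B)))"
    by (subst sum.swap) (simp add: sum_distrib_left)
  finally show ?thesis .
qed

lemma random_subset_jensen:
  assumes fin: "finite V" and p: "\<And>y. y \<in> V \<Longrightarrow> 0 \<le> p y \<and> p y \<le> 1"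
    and \<mu>: "\<And>y. y \<in> V \<Longrightarrow> 0 \<le> \<mu> y" "sum \<mu> V \<le> 1"
    and F: "concave_on {0..1} F"
  shows "(\<Sum>B\<in>Pow V. random_subset V p B * F (sum \<mu> B)) \<le> F (\<Sum>y\<in>V. \<mu> y * p y)"
proof -
  have "(\<Sum>B\<in>Pow V. random_subset V p B * F (sum \<mu> B))
      \<le> F (\<Sum>B\<in>Pow V. random_subset V p B *\<^sub>R sum \<mu> B)"
  proof (rule concave_on_sum[OF _ _ F])
    show "sum \<mu> B \<in> {0..1}" if "B \<in> Pow V" for B
    proof -
      have "sum \<mu> B \<le> sum \<mu> V" using that fin \<mu> by (intro sum_mono2) auto
      then show ?thesis using that \<mu> by (auto intro: sum_nonneg)
    qed
  qed (use fin p in \<open>auto simp: random_subset_sum intro: random_subset_nonneg\<close>)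
  also have "(\<Sum>B\<in>Pow V. random_subset V p B *\<^sub>R sum \<mu> B) = (\<Sum>y\<in>V. \<mu> y * p y)"
    using weighted_sum_of_measures[OF fin, of "random_subset V p" \<mu>]
    by (simp add: random_subset_marginal[OF fin])
  finally show ?thesis .
qed

lemma L2_set_sum_le: "finite I \<Longrightarrow> L2_set (\<lambda>y. \<Sum>i\<in>I. f i y) A \<le> (\<Sum>i\<in>I. L2_set (f i) A)"
proof (induction I rule: finite_induct)
  case empty
  then show ?case by (simp add: L2_set_def)
next
  case (insert i I)
  then show ?case using L2_set_triangle_ineq[of "f i" "\<lambda>y. \<Sum>i\<in>I. f i y" A] by simp
qed

text \<open>
  The inclusion probabilities of the two random subsets between which a fair coin decides in one step
  of the set process; their average is \<open>q\<close>.
\<close>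

lemma half_truncation:
  fixes q :: real
  assumes "0 \<le> q \<and> q \<le> 1"
  shows "0 \<le> min 1 (2 * q) \<and> min 1 (2 * q) \<le> 1" "0 \<le> max 0 (2 * q - 1) \<and> max 0 (2 * q - 1) \<le> 1"
  using assms by auto

lemma kernel_pow_add:
  assumes "finite V" "x \<in> V"
  shows "kernel_pow V P (s + t) x y = (\<Sum>z\<in>V. kernel_pow V P s x z * kernel_pow V P t z y)"
  using assms(2)
proof (induction s arbitrary: x)
  case 0
  then show ?case using assms(1) by (simp add: if_distribR if_distrib cong: if_cong)
next
  case (Suc s)
  have "kernel_pow V P (Suc s + t) x y
      = (\<Sum>u\<in>V. \<Sum>z\<in>V. P x u * (kernel_pow V P s u z * kernel_pow V P t z y))"
    using Suc.IH by (simp add: sum_distrib_left)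
  also have "\<dots> = (\<Sum>z\<in>V. \<Sum>u\<in>V. P x u * (kernel_pow V P s u z * kernel_pow V P t z y))"
    by (rule sum.swap)
  finally show ?case by (simp add: sum_distrib_right mult.assoc)
qed

lemma kernel_pow_Suc_right:
  assumes "finite V" "x \<in> V" "y \<in> V"
  shows "kernel_pow V P (Suc t) x y = (\<Sum>z\<in>V. kernel_pow V P t x z * P z y)"
proof -
  have "kernel_pow V P (Suc 0) z y = P z y" for z
    using assms by (simp add: if_distrib[of "\<lambda>t. _ * t"] cong: if_cong)
  then show ?thesis using kernel_pow_add[OF assms(1,2), of P t "Suc 0" y] by simp
qed

section \<open>Evolving sets of a stationary chain\<close>

locale stationary_chain =
  fixes V :: "'a set" and P :: "'a \<Rightarrow> 'a \<Rightarrow> real" and \<pi> :: "'a \<Rightarrow> real"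
  assumes finite_V: "finite V"
    and stat_pos: "\<And>x. x \<in> V \<Longrightarrow> 0 < \<pi> x"
    and stat_sum: "sum \<pi> V = 1"
    and P_nonneg: "\<And>x y. x \<in> V \<Longrightarrow> y \<in> V \<Longrightarrow> 0 \<le> P x y"
    and P_row: "\<And>x. x \<in> V \<Longrightarrow> (\<Sum>y\<in>V. P x y) = 1"
    and stat_eq: "\<And>y. y \<in> V \<Longrightarrow> (\<Sum>x\<in>V. \<pi> x * P x y) = \<pi> y"
begin

definition flow :: "'a set \<Rightarrow> 'a \<Rightarrow> real" where
  "flow A y = (\<Sum>x\<in>A. \<pi> x * P x y)"

definition overlap :: "'a set \<Rightarrow> real" where
  "overlap A = (\<Sum>y\<in>V. min (flow A y) (flow (V - A) y))"

lemma stat_nonneg: "x \<in> V \<Longrightarrow> 0 \<le> \<pi> x"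
  using stat_pos by (rule less_imp_le)

lemma finite_subset_V: "A \<subseteq> V \<Longrightarrow> finite A"
  using finite_V finite_subset by blast

lemma flow_nonneg: "A \<subseteq> V \<Longrightarrow> y \<in> V \<Longrightarrow> 0 \<le> flow A y"
  unfolding flow_def by (intro sum_nonneg mult_nonneg_nonneg) (auto intro: stat_nonneg P_nonneg)

lemma flow_compl: "A \<subseteq> V \<Longrightarrow> y \<in> V \<Longrightarrow> flow A y + flow (V - A) y = \<pi> y"
  unfolding flow_def using sum.subset_diff[of A V "\<lambda>x. \<pi> x * P x y"] finite_V stat_eq[of y] by simp

lemma flow_le: "A \<subseteq> V \<Longrightarrow> y \<in> V \<Longrightarrow> flow A y \<le> \<pi> y"
  using flow_compl[of A y] flow_nonneg[of "V - A" y] by auto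

lemma flow_total: "A \<subseteq> V \<Longrightarrow> (\<Sum>y\<in>V. flow A y) = sum \<pi> A"
  unfolding flow_def by (subst sum.swap) (auto simp: P_row simp flip: sum_distrib_left intro!: sum.cong)

lemma stat_measure: "A \<subseteq> V \<Longrightarrow> 0 \<le> sum \<pi> A" "A \<subseteq> V \<Longrightarrow> sum \<pi> A \<le> 1"
  using sum_mono2[of V A \<pi>] finite_V stat_pos stat_sum by (fastforce intro: sum_nonneg less_imp_le)+

lemma stat_measure_compl: "A \<subseteq> V \<Longrightarrow> sum \<pi> (V - A) = 1 - sum \<pi> A"
  using sum_diff[OF finite_V, of A \<pi>] stat_sum by simp

lemma stat_measure_pos: "A \<subseteq> V \<Longrightarrow> A \<noteq> {} \<Longrightarrow> 0 < sum \<pi> A"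
  using stat_pos by (intro sum_pos finite_subset_V) auto

lemma overlap_bounds:
  assumes "A \<subseteq> V"
  shows "0 \<le> overlap A" "overlap A \<le> sum \<pi> A" "overlap A \<le> 1 - sum \<pi> A"
proof -
  show "0 \<le> overlap A" unfolding overlap_def using assms by (intro sum_nonneg) (auto intro: flow_nonneg)
  have "overlap A \<le> sum (flow A) V" "overlap A \<le> sum (flow (V - A)) V"
    unfolding overlap_def by (intro sum_mono; simp)+
  then show "overlap A \<le> sum \<pi> A" "overlap A \<le> 1 - sum \<pi> A"
    using assms by (simp_all add: flow_total stat_measure_compl)
qed

text \<open>
  One step of the set process from \<open>A\<close>.  Each \<open>y\<close> is to belong to the next set with probability
  \<open>r = flow A y / \<pi> y\<close>.  A fair coin selects the inclusion probabilities \<open>min 1 (2 r)\<close> or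
  \<open>max 0 (2 r - 1)\<close>; these are the ones of the classical evolving set \<open>{y. u \<le> r}\<close> for \<open>u\<close> uniform in
  the lower or in the upper half of \<open>[0, 1]\<close>.  This split moves the mean measure by the overlap, up or
  down.
\<close>

definition evolve :: "'a set \<Rightarrow> 'a set \<Rightarrow> real" where
  "evolve A B = (random_subset V (\<lambda>y. min 1 (2 * (flow A y / \<pi> y))) B
               + random_subset V (\<lambda>y. max 0 (2 * (flow A y / \<pi> y) - 1)) B) / 2"

lemma flow_ratio: "A \<subseteq> V \<Longrightarrow> y \<in> V \<Longrightarrow> 0 \<le> flow A y / \<pi> y \<and> flow A y / \<pi> y \<le> 1"
  using flow_nonneg[of A y] flow_le[of A y] stat_pos[of y] by (auto simp: field_simps)

lemma evolve_nonneg: "A \<in> Pow V \<Longrightarrow> B \<in> Pow V \<Longrightarrow> 0 \<le> evolve A B"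
  unfolding evolve_def
  by (intro divide_nonneg_nonneg add_nonneg_nonneg random_subset_nonneg half_truncation flow_ratio) simp_all

lemma evolve_marginal:
  assumes "y \<in> V"
  shows "(\<Sum>B\<in>Pow V. evolve A B * of_bool (y \<in> B)) = flow A y / \<pi> y"
proof -
  have "(\<Sum>B\<in>Pow V. evolve A B * of_bool (y \<in> B))
      = (min 1 (2 * (flow A y / \<pi> y)) + max 0 (2 * (flow A y / \<pi> y) - 1)) / 2"
    unfolding evolve_def
    by (simp add: random_subset_marginal[OF finite_V assms] add_divide_distrib distrib_right sum.distrib
        flip: sum_divide_distrib)
  also have "\<dots> = flow A y / \<pi> y" by (simp add: min_def max_def)
  finally show ?thesis .
qed

text \<open>
  Jensen's inequality for each outcome of the coin: the mean measures are \<open>sum \<pi> A + overlap A\<close> and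
  \<open>sum \<pi> A - overlap A\<close>, because \<open>\<pi> y\<close> times the truncated inclusion probability is the flow from \<open>A\<close>
  plus or minus the smaller one of the flows from \<open>A\<close> and from its complement.
\<close>

lemma evolve_concave:
  assumes A: "A \<in> Pow V" and F: "concave_on {0..1} F"
  shows "(\<Sum>B\<in>Pow V. evolve A B * F (sum \<pi> B))
      \<le> (F (sum \<pi> A + overlap A) + F (sum \<pi> A - overlap A)) / 2"
proof -
  let ?r = "\<lambda>y. flow A y / \<pi> y"
  have r: "0 \<le> ?r y \<and> ?r y \<le> 1" if "y \<in> V" for y using flow_ratio[of A y] A that by simp
  have up: "\<pi> y * min 1 (2 * ?r y) = flow A y + min (flow A y) (flow (V - A) y)"
    and down: "\<pi> y * max 0 (2 * ?r y - 1) = flow A y - min (flow A y) (flow (V - A) y)"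
    if "y \<in> V" for y
  proof -
    define r where "r = ?r y"
    have "flow A y = \<pi> y * r" using stat_pos[OF that] by (simp add: r_def)
    moreover from this have "flow (V - A) y = \<pi> y * (1 - r)"
      using flow_compl[of A y] A that by (simp add: algebra_simps)
    ultimately have m: "flow A y = \<pi> y * r" "min (flow A y) (flow (V - A) y) = \<pi> y * min r (1 - r)"
      using stat_nonneg[OF that] by (simp_all add: min_mult_distrib_left)
    show "\<pi> y * min 1 (2 * ?r y) = flow A y + min (flow A y) (flow (V - A) y)"
      "\<pi> y * max 0 (2 * ?r y - 1) = flow A y - min (flow A y) (flow (V - A) y)"
      unfolding m(2) unfolding r_def[symmetric] m(1) distrib_left[symmetric] right_diff_distrib[symmetric]
      by (auto simp: min_def max_def)
  qed
  have "(\<Sum>B\<in>Pow V. random_subset V (\<lambda>y. min 1 (2 * ?r y)) B * F (sum \<pi> B))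
      \<le> F (\<Sum>y\<in>V. \<pi> y * min 1 (2 * ?r y))"
    by (rule random_subset_jensen[OF finite_V half_truncation(1)[OF r] stat_nonneg _ F]) (simp_all add: stat_sum)
  moreover have "(\<Sum>B\<in>Pow V. random_subset V (\<lambda>y. max 0 (2 * ?r y - 1)) B * F (sum \<pi> B))
      \<le> F (\<Sum>y\<in>V. \<pi> y * max 0 (2 * ?r y - 1))"
    by (rule random_subset_jensen[OF finite_V half_truncation(2)[OF r] stat_nonneg _ F]) (simp_all add: stat_sum)
  moreover have "(\<Sum>y\<in>V. \<pi> y * min 1 (2 * ?r y)) = sum \<pi> A + overlap A"
    by (subst sum.cong[OF refl up]) (use A in \<open>simp_all add: sum.distrib flow_total overlap_def\<close>)
  moreover have "(\<Sum>y\<in>V. \<pi> y * max 0 (2 * ?r y - 1)) = sum \<pi> A - overlap A"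
    by (subst sum.cong[OF refl down]) (use A in \<open>simp_all add: sum_subtractf flow_total overlap_def\<close>)
  ultimately show ?thesis
    unfolding evolve_def times_divide_eq_left distrib_right sum.distrib sum_divide_distrib[symmetric]
    by simp
qed

text \<open>
  The distribution of the set process started at \<open>{x}\<close>.
\<close>

primrec set_weight :: "'a \<Rightarrow> nat \<Rightarrow> 'a set \<Rightarrow> real" where
  "set_weight x 0 = (\<lambda>B. of_bool (B = {x}))"
| "set_weight x (Suc t) = (\<lambda>B. \<Sum>A\<in>Pow V. set_weight x t A * evolve A B)"

lemma set_weight_nonneg: "x \<in> V \<Longrightarrow> B \<in> Pow V \<Longrightarrow> 0 \<le> set_weight x t B"
  by (induction t arbitrary: B) (auto intro!: sum_nonneg mult_nonneg_nonneg evolve_nonneg)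

lemma set_weight_0: "x \<in> V \<Longrightarrow> (\<Sum>B\<in>Pow V. set_weight x 0 B * g B) = g {x}"
  using finite_V by (subst sum.remove[of _ "{x}"]) (auto intro!: sum.neutral)

lemma set_weight_Suc:
  "(\<Sum>B\<in>Pow V. set_weight x (Suc t) B * g B)
    = (\<Sum>A\<in>Pow V. set_weight x t A * (\<Sum>B\<in>Pow V. evolve A B * g B))"
proof -
  have "(\<Sum>B\<in>Pow V. set_weight x (Suc t) B * g B)
      = (\<Sum>B\<in>Pow V. \<Sum>A\<in>Pow V. set_weight x t A * (evolve A B * g B))"
    by (simp add: sum_distrib_right mult.assoc)
  also have "\<dots> = (\<Sum>A\<in>Pow V. \<Sum>B\<in>Pow V. set_weight x t A * (evolve A B * g B))"
    by (rule sum.swap)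
  finally show ?thesis by (simp add: sum_distrib_left)
qed

text \<open>
  Duality of the set process and the chain: the inclusion probabilities evolve by the same linear
  recursion as the density of \<open>P\<^sup>t(x, \<cdot>)\<close> with respect to \<open>\<pi>\<close>.
\<close>

lemma set_weight_marginal:
  assumes x: "x \<in> V" and "y \<in> V"
  shows "(\<Sum>B\<in>Pow V. set_weight x t B * of_bool (y \<in> B)) = \<pi> x * kernel_pow V P t x y / \<pi> y"
  using assms(2)
proof (induction t arbitrary: y)
  case 0
  then show ?case using x stat_pos[of y] by (simp only: set_weight_0[OF x]) auto
next
  case (Suc t)
  have "(\<Sum>B\<in>Pow V. set_weight x (Suc t) B * of_bool (y \<in> B))
      = (\<Sum>A\<in>Pow V. set_weight x t A * (\<Sum>z\<in>A. \<pi> z * P z y)) / \<pi> y"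
    unfolding set_weight_Suc evolve_marginal[OF Suc.prems] flow_def times_divide_eq_right
    by (rule sum_divide_distrib[symmetric])
  also have "\<dots> = (\<Sum>z\<in>V. \<pi> z * P z y * (\<pi> x * kernel_pow V P t x z / \<pi> z)) / \<pi> y"
    unfolding weighted_sum_of_measures[OF finite_V] using Suc.IH by simp
  also have "\<dots> = (\<Sum>z\<in>V. \<pi> x * (kernel_pow V P t x z * P z y)) / \<pi> y"
    using stat_pos by (intro arg_cong2[where f = "(/)"] sum.cong refl) force
  finally show ?case
    unfolding kernel_pow_Suc_right[OF finite_V x Suc.prems] by (simp add: sum_distrib_left)
qed

lemma kernel_pow_row: "x \<in> V \<Longrightarrow> (\<Sum>y\<in>V. kernel_pow V P t x y) = 1"
proof (induction t arbitrary: x)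
  case 0
  then show ?case using finite_V by simp
next
  case (Suc t)
  have "(\<Sum>y\<in>V. kernel_pow V P (Suc t) x y) = (\<Sum>z\<in>V. \<Sum>y\<in>V. P x z * kernel_pow V P t z y)"
    by (simp, rule sum.swap)
  also have "\<dots> = (\<Sum>z\<in>V. P x z)" using Suc.IH by (simp flip: sum_distrib_left)
  finally show ?case using P_row Suc.prems by simp
qed

lemma kernel_pow_stat: "y \<in> V \<Longrightarrow> (\<Sum>x\<in>V. \<pi> x * kernel_pow V P t x y) = \<pi> y"
proof (induction t arbitrary: y)
  case 0
  then show ?case using finite_V by (simp add: if_distrib[of "\<lambda>t. _ * t"] cong: if_cong)
next
  case (Suc t)
  have "(\<Sum>x\<in>V. \<pi> x * kernel_pow V P (Suc t) x y)
      = (\<Sum>x\<in>V. \<Sum>z\<in>V. \<pi> x * P x z * kernel_pow V P t z y)"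
    by (simp add: sum_distrib_left mult.assoc)
  also have "\<dots> = (\<Sum>z\<in>V. (\<Sum>x\<in>V. \<pi> x * P x z) * kernel_pow V P t z y)"
    by (subst sum.swap) (simp add: sum_distrib_right)
  finally show ?case using Suc stat_eq by simp
qed

lemma set_weight_mean:
  assumes "x \<in> V"
  shows "(\<Sum>B\<in>Pow V. set_weight x t B * sum \<pi> B) = \<pi> x"
proof -
  have "(\<Sum>B\<in>Pow V. set_weight x t B * sum \<pi> B) = (\<Sum>y\<in>V. \<pi> x * kernel_pow V P t x y)"
    unfolding weighted_sum_of_measures[OF finite_V] set_weight_marginal[OF assms]
    using stat_pos set_weight_marginal[OF assms] by (intro sum.cong) force+
  also have "\<dots> = \<pi> x" using kernel_pow_row[OF assms] by (simp flip: sum_distrib_left)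
  finally show ?thesis .
qed

text \<open>
  The signed deviation of the density from \<open>1\<close> is a mixture of the deviations of indicator functions.
  Every norm of it is therefore at most the average of a function of the measure of the random set;
  the next lemmas evaluate this function for the \<open>L\<^sup>1\<close> and the \<open>L\<^sup>2\<close> norm.
\<close>

lemma density_mixture:
  assumes "x \<in> V" "y \<in> V"
  shows "\<pi> x * (kernel_pow V P t x y / \<pi> y - 1)
      = (\<Sum>B\<in>Pow V. set_weight x t B * (of_bool (y \<in> B) - sum \<pi> B))"
  using set_weight_marginal[OF assms, of t] set_weight_mean[OF assms(1), of t]
  by (simp add: right_diff_distrib sum_subtractf)

lemma tv_dist_mixture:
  assumes x: "x \<in> V"
  shows "\<pi> x * tv_dist V P \<pi> t x \<le> (\<Sum>B\<in>Pow V. set_weight x t B * (sum \<pi> B * (1 - sum \<pi> B)))"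
proof -
  have dev: "(\<Sum>y\<in>V. \<pi> y * \<bar>of_bool (y \<in> B) - sum \<pi> B\<bar>) = 2 * (sum \<pi> B * (1 - sum \<pi> B))"
    if "B \<in> Pow V" for B
  proof -
    have B: "B \<subseteq> V" using that by simp
    have "(\<Sum>y\<in>V. \<pi> y * \<bar>of_bool (y \<in> B) - sum \<pi> B\<bar>)
        = (\<Sum>y\<in>V - B. \<pi> y * sum \<pi> B) + (\<Sum>y\<in>B. \<pi> y * (1 - sum \<pi> B))"
      unfolding sum.subset_diff[OF B finite_V] using stat_measure[OF B]
      by (intro arg_cong2[where f = "(+)"] sum.cong) auto
    then show ?thesis
      by (simp add: stat_measure_compl[OF B] flip: sum_distrib_right)
  qed
  have "\<pi> x * tv_dist V P \<pi> t x = (\<Sum>y\<in>V. \<pi> y * \<bar>\<pi> x * (kernel_pow V P t x y / \<pi> y - 1)\<bar>) / 2"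
    unfolding tv_dist_def times_divide_eq_left mult_1 times_divide_eq_right
    unfolding sum_distrib_left
  proof (intro arg_cong2[where f = "(/)"] sum.cong refl)
    fix y assume y: "y \<in> V"
    have e: "\<pi> y * (\<pi> x * (kernel_pow V P t x y / \<pi> y - 1)) = \<pi> x * (kernel_pow V P t x y - \<pi> y)"
      using stat_pos[OF y] by (simp add: field_simps)
    have "\<pi> x * \<bar>kernel_pow V P t x y - \<pi> y\<bar> = \<bar>\<pi> y * (\<pi> x * (kernel_pow V P t x y / \<pi> y - 1))\<bar>"
      unfolding e using stat_pos[OF x] by (simp add: abs_mult)
    then show "\<pi> x * \<bar>kernel_pow V P t x y - \<pi> y\<bar> = \<pi> y * \<bar>\<pi> x * (kernel_pow V P t x y / \<pi> y - 1)\<bar>"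
      using stat_pos[OF y] by (simp only: abs_mult[of "\<pi> y"] abs_of_pos)
  qed
  also have "\<dots> \<le> (\<Sum>y\<in>V. \<pi> y * (\<Sum>B\<in>Pow V. set_weight x t B * \<bar>of_bool (y \<in> B) - sum \<pi> B\<bar>)) / 2"
  proof (intro divide_right_mono sum_mono mult_left_mono)
    fix y assume y: "y \<in> V"
    have "\<bar>\<pi> x * (kernel_pow V P t x y / \<pi> y - 1)\<bar>
        \<le> (\<Sum>B\<in>Pow V. \<bar>set_weight x t B * (of_bool (y \<in> B) - sum \<pi> B)\<bar>)"
      unfolding density_mixture[OF x y] by (rule sum_abs)
    also have "\<dots> = (\<Sum>B\<in>Pow V. set_weight x t B * \<bar>of_bool (y \<in> B) - sum \<pi> B\<bar>)"
      using set_weight_nonneg[OF x] by (intro sum.cong refl) (simp add: abs_mult)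
    finally show "\<bar>\<pi> x * (kernel_pow V P t x y / \<pi> y - 1)\<bar> \<le> \<dots>" .
  qed (use stat_pos in \<open>auto intro: less_imp_le\<close>)
  also have "\<dots> = (\<Sum>B\<in>Pow V. set_weight x t B * (\<Sum>y\<in>V. \<pi> y * \<bar>of_bool (y \<in> B) - sum \<pi> B\<bar>)) / 2"
    unfolding sum_distrib_left by (subst sum.swap) (simp add: mult_ac)
  also have "\<dots> = (\<Sum>B\<in>Pow V. set_weight x t B * (sum \<pi> B * (1 - sum \<pi> B)))"
    unfolding sum_divide_distrib by (intro sum.cong refl) (simp add: dev)
  finally show ?thesis .
qed

text \<open>
  The \<open>L\<^sup>2(\<pi>)\<close> distance of the density of \<open>P\<^sup>t(x, \<cdot>)\<close> from the constant \<open>1\<close>.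
\<close>

definition chi_dist :: "nat \<Rightarrow> 'a \<Rightarrow> real" where
  "chi_dist t x = L2_set (\<lambda>y. sqrt (\<pi> y) * (kernel_pow V P t x y / \<pi> y - 1)) V"

lemma chi_dist_mixture:
  assumes x: "x \<in> V"
  shows "\<pi> x * chi_dist t x \<le> (\<Sum>B\<in>Pow V. set_weight x t B * sqrt (sum \<pi> B * (1 - sum \<pi> B)))"
proof -
  have dev: "L2_set (\<lambda>y. sqrt (\<pi> y) * (of_bool (y \<in> B) - sum \<pi> B)) V = sqrt (sum \<pi> B * (1 - sum \<pi> B))"
    if "B \<in> Pow V" for B
  proof -
    have B: "B \<subseteq> V" using that by simp
    have "(\<Sum>y\<in>V. (sqrt (\<pi> y) * (of_bool (y \<in> B) - sum \<pi> B))\<^sup>2)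
        = (\<Sum>y\<in>V - B. \<pi> y * (sum \<pi> B)\<^sup>2) + (\<Sum>y\<in>B. \<pi> y * (1 - sum \<pi> B)\<^sup>2)"
      unfolding sum.subset_diff[OF B finite_V] using stat_pos B
      by (intro arg_cong2[where f = "(+)"] sum.cong) (auto simp: power_mult_distrib less_imp_le)
    also have "\<dots> = sum \<pi> B * (1 - sum \<pi> B)"
      unfolding sum_distrib_right[symmetric] stat_measure_compl[OF B]
      by (simp add: power2_eq_square algebra_simps)
    finally show ?thesis unfolding L2_set_def by simp
  qed
  have "\<pi> x * chi_dist t x = L2_set (\<lambda>y. \<pi> x * (sqrt (\<pi> y) * (kernel_pow V P t x y / \<pi> y - 1))) V"
    unfolding chi_dist_def using stat_pos[OF x] by (simp add: L2_set_right_distrib)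
  also have "\<dots> = L2_set (\<lambda>y. \<Sum>B\<in>Pow V. set_weight x t B * (sqrt (\<pi> y) * (of_bool (y \<in> B) - sum \<pi> B))) V"
  proof (intro L2_set_cong refl)
    fix y assume y: "y \<in> V"
    have "\<pi> x * (sqrt (\<pi> y) * (kernel_pow V P t x y / \<pi> y - 1))
        = sqrt (\<pi> y) * (\<pi> x * (kernel_pow V P t x y / \<pi> y - 1))" by simp
    then show "\<pi> x * (sqrt (\<pi> y) * (kernel_pow V P t x y / \<pi> y - 1))
        = (\<Sum>B\<in>Pow V. set_weight x t B * (sqrt (\<pi> y) * (of_bool (y \<in> B) - sum \<pi> B)))"
      unfolding density_mixture[OF x y] by (simp add: sum_distrib_left mult_ac)
  qed
  also have "\<dots> \<le> (\<Sum>B\<in>Pow V. L2_set (\<lambda>y. set_weight x t B * (sqrt (\<pi> y) * (of_bool (y \<in> B) - sum \<pi> B))) V)"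
    using finite_V by (intro L2_set_sum_le) simp
  also have "\<dots> = (\<Sum>B\<in>Pow V. set_weight x t B * sqrt (sum \<pi> B * (1 - sum \<pi> B)))"
    using set_weight_nonneg[OF x] dev by (intro sum.cong refl) (simp flip: L2_set_right_distrib)
  finally show ?thesis .
qed

lemma reversal_chain: "stationary_chain V (reversal \<pi> P) \<pi>"
proof
  show "(\<Sum>y\<in>V. reversal \<pi> P x y) = 1" if "x \<in> V" for x
    using stat_eq[OF that] stat_pos[OF that] by (simp add: reversal_def flip: sum_divide_distrib)
  show "(\<Sum>x\<in>V. \<pi> x * reversal \<pi> P x y) = \<pi> y" if "y \<in> V" for y
  proof -
    have "(\<Sum>x\<in>V. \<pi> x * reversal \<pi> P x y) = (\<Sum>x\<in>V. \<pi> y * P y x)"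
      using stat_pos by (intro sum.cong) (force simp: reversal_def)+
    then show ?thesis using P_row[OF that] by (simp flip: sum_distrib_left)
  qed
qed (use finite_V stat_pos stat_sum P_nonneg in \<open>auto simp: reversal_def less_imp_le\<close>)

lemma kernel_pow_reversal:
  assumes "x \<in> V" "y \<in> V"
  shows "kernel_pow V (reversal \<pi> P) t x y = \<pi> y * kernel_pow V P t y x / \<pi> x"
  using assms(1)
proof (induction t arbitrary: x)
  case 0
  then show ?case using stat_pos[of x] by auto
next
  case (Suc t)
  have "kernel_pow V (reversal \<pi> P) (Suc t) x y
      = (\<Sum>z\<in>V. \<pi> y * (kernel_pow V P t y z * P z x) / \<pi> x)"
    unfolding kernel_pow.simps
  proof (intro sum.cong refl)
    fix z assume z: "z \<in> V"
    show "reversal \<pi> P x z * kernel_pow V (reversal \<pi> P) t z y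
        = \<pi> y * (kernel_pow V P t y z * P z x) / \<pi> x"
      unfolding Suc.IH[OF z] reversal_def using stat_pos[OF z] by simp
  qed
  then show ?case
    unfolding kernel_pow_Suc_right[OF finite_V assms(2) Suc.prems]
    by (simp add: sum_distrib_left sum_divide_distrib)
qed

text \<open>
  The density at time \<open>s + t\<close> minus \<open>1\<close> is the inner product of the centred density of the chain from \<open>x\<close>
  at time \<open>s\<close> and the one of the reversed chain from \<open>y\<close> at time \<open>t\<close>; the estimate is the
  Cauchy-Schwarz inequality.
\<close>

lemma density_error_le_chi_dist:
  assumes x: "x \<in> V" and y: "y \<in> V"
  shows "\<bar>kernel_pow V P (s + t) x y / \<pi> y - 1\<bar>
      \<le> chi_dist s x * stationary_chain.chi_dist V (reversal \<pi> P) \<pi> t y"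
proof -
  interpret rev: stationary_chain V "reversal \<pi> P" \<pi> by (rule reversal_chain)
  let ?f = "\<lambda>z. kernel_pow V P s x z / \<pi> z - 1"
  let ?g = "\<lambda>z. kernel_pow V (reversal \<pi> P) t y z / \<pi> z - 1"
  have g: "?g z = kernel_pow V P t z y / \<pi> y - 1" if "z \<in> V" for z
    using kernel_pow_reversal[OF y that, of t] stat_pos[OF that] by simp
  have "(\<Sum>z\<in>V. (sqrt (\<pi> z) * ?f z) * (sqrt (\<pi> z) * ?g z))
      = (\<Sum>z\<in>V. kernel_pow V P s x z * kernel_pow V P t z y / \<pi> y - kernel_pow V P s x z
            - \<pi> z * kernel_pow V P t z y / \<pi> y + \<pi> z)"
  proof (intro sum.cong refl)
    fix z assume z: "z \<in> V"
    have "(sqrt (\<pi> z) * ?f z) * (sqrt (\<pi> z) * ?g z) = (sqrt (\<pi> z) * sqrt (\<pi> z)) * (?f z * ?g z)"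
      by (simp only: mult_ac)
    also have "\<dots> = \<pi> z * (?f z * ?g z)" using stat_nonneg[OF z] by simp
    also have "\<dots> = kernel_pow V P s x z * kernel_pow V P t z y / \<pi> y - kernel_pow V P s x z
            - \<pi> z * kernel_pow V P t z y / \<pi> y + \<pi> z"
      unfolding g[OF z] using stat_pos[OF z] stat_pos[OF y] by (simp add: field_simps)
    finally show "(sqrt (\<pi> z) * ?f z) * (sqrt (\<pi> z) * ?g z) = \<dots>" .
  qed
  also have "\<dots> = kernel_pow V P (s + t) x y / \<pi> y - 1"
    unfolding sum.distrib sum_subtractf kernel_pow_add[OF finite_V x]
    using kernel_pow_row[OF x] kernel_pow_stat[OF y] stat_sum stat_pos[OF y]
    by (simp flip: sum_divide_distrib)
  finally have "\<bar>kernel_pow V P (s + t) x y / \<pi> y - 1\<bar>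
      \<le> (\<Sum>z\<in>V. \<bar>sqrt (\<pi> z) * ?f z\<bar> * \<bar>sqrt (\<pi> z) * ?g z\<bar>)"
    by (metis (no_types, lifting) abs_mult sum_abs sum.cong)
  also have "\<dots> \<le> chi_dist s x * rev.chi_dist t y"
    unfolding chi_dist_def rev.chi_dist_def by (rule L2_set_mult_ineq)
  finally show ?thesis .
qed

end

section \<open>Mixing of chains with positive overlap\<close>

locale expanding_chain = stationary_chain +
  fixes d :: real
  assumes d_pos: "0 < d"
    and expansion: "\<And>A. A \<subseteq> V \<Longrightarrow> A \<noteq> {} \<Longrightarrow> A \<noteq> V \<Longrightarrow> d \<le> overlap A"
    and two_states: "2 \<le> card V"
begin

lemma nontrivial_measure:
  assumes "A \<subseteq> V" "A \<noteq> {}" "A \<noteq> V"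
  shows "d \<le> sum \<pi> A" "sum \<pi> A \<le> 1 - d"
  using overlap_bounds[OF assms(1)] expansion[OF assms] by simp_all

text \<open>
  The overlap of a set is at most its measure and at most the measure of its complement, so a lower
  bound for the overlap also bounds the measure of every state.
\<close>

lemma single_measure:
  assumes "x \<in> V"
  shows "d \<le> \<pi> x" "\<pi> x \<le> 1 - d"
proof -
  have "{x} \<noteq> V" using two_states by auto
  with nontrivial_measure[of "{x}"] assms show "d \<le> \<pi> x" "\<pi> x \<le> 1 - d" by simp_all
qed

lemma d_half: "d \<le> 1/2"
proof -
  obtain x where "x \<in> V" using two_states by fastforce
  then show ?thesis using single_measure[of x] by simp
qed

definition contraction :: real where "contraction = cos (pi * d)"

lemma contraction_bounds: "0 \<le> contraction" "contraction < 1"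
proof -
  have le: "pi * d \<le> pi / 2" using d_half by simp
  show "0 \<le> contraction" unfolding contraction_def using d_pos le by (intro cos_ge_zero) (auto intro: order_trans[of _ 0])
  have "cos (pi * d) < cos 0" using d_pos le by (intro cos_monotone_0_pi) auto
  then show "contraction < 1" by (simp add: contraction_def)
qed

lemma trivial_overlap: "overlap {} = 0" "overlap V = 0"
  using overlap_bounds[of "{}"] overlap_bounds[of V] stat_sum by simp_all

text \<open>
  The addition theorem: \<open>sin (pi a)\<close> is an eigenfunction of the averaging over \<open>a + h\<close> and \<open>a - h\<close>, with
  eigenvalue \<open>cos (pi h)\<close>.  Trivial sets have overlap \<open>0\<close>, but there the sine vanishes.
\<close>

lemma sine_step:
  assumes A: "A \<in> Pow V"
  shows "(\<Sum>B\<in>Pow V. evolve A B * sin (pi * sum \<pi> B)) \<le> contraction * sin (pi * sum \<pi> A)"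
proof -
  let ?a = "sum \<pi> A" and ?h = "overlap A"
  have "(\<Sum>B\<in>Pow V. evolve A B * sin (pi * sum \<pi> B)) \<le> (sin (pi * (?a + ?h)) + sin (pi * (?a - ?h))) / 2"
    by (rule evolve_concave[OF A concave_sin_pi])
  also have "\<dots> = cos (pi * ?h) * sin (pi * ?a)"
    by (simp add: distrib_left right_diff_distrib sin_add sin_diff)
  also have "\<dots> \<le> contraction * sin (pi * ?a)"
  proof (cases "A = {} \<or> A = V")
    case True
    then show ?thesis using trivial_overlap stat_sum by auto
  next
    case False
    have h: "d \<le> ?h" "?h \<le> 1/2" using expansion[of A] overlap_bounds[of A] A False by auto
    have "cos (pi * ?h) \<le> contraction"
      unfolding contraction_def using h d_pos by (intro cos_monotone_0_pi_le) auto
    moreover have "0 \<le> sin (pi * ?a)" using A stat_measure[of A] by (intro sin_ge_zero) auto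
    ultimately show ?thesis by (rule mult_right_mono)
  qed
  finally show ?thesis .
qed

lemma sine_decay:
  assumes x: "x \<in> V"
  shows "(\<Sum>B\<in>Pow V. set_weight x t B * sin (pi * sum \<pi> B)) \<le> contraction ^ t * sin (pi * \<pi> x)"
proof (induction t)
  case 0
  show ?case unfolding set_weight_0[OF x] by simp
next
  case (Suc t)
  have "(\<Sum>B\<in>Pow V. set_weight x (Suc t) B * sin (pi * sum \<pi> B))
      \<le> (\<Sum>A\<in>Pow V. set_weight x t A * (contraction * sin (pi * sum \<pi> A)))"
    unfolding set_weight_Suc using x
    by (intro sum_mono mult_left_mono sine_step set_weight_nonneg)
  also have "\<dots> = contraction * (\<Sum>A\<in>Pow V. set_weight x t A * sin (pi * sum \<pi> A))"
    by (simp add: sum_distrib_left mult_ac)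
  also have "\<dots> \<le> contraction * (contraction ^ t * sin (pi * \<pi> x))"
    by (intro mult_left_mono Suc.IH contraction_bounds)
  finally show ?case by (simp add: mult.assoc)
qed

lemma sin_pi_d_pos: "0 < sin (pi * d)"
  using d_pos d_half by (intro sin_gt_zero) auto

text \<open>
  The function \<open>a (1 - a)\<close> of the set process is replaced by the multiple of \<open>sin (pi a)\<close> that agrees with
  it at \<open>d\<close>, the sine decays geometrically, and at time \<open>0\<close> one returns from
  \<open>sin (pi \<pi> x) / \<pi> x\<close> to \<open>sin (pi d) / d\<close> by concavity.
\<close>

lemma tv_dist_le:
  assumes x: "x \<in> V"
  shows "tv_dist V P \<pi> t x \<le> (1 - d) * contraction ^ t"
proof -
  have xpos: "0 < \<pi> x" by (rule stat_pos[OF x])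
  have "\<pi> x * tv_dist V P \<pi> t x * sin (pi * d)
      \<le> (\<Sum>B\<in>Pow V. set_weight x t B * (sum \<pi> B * (1 - sum \<pi> B))) * sin (pi * d)"
    using tv_dist_mixture[OF x] sin_pi_d_pos by (intro mult_right_mono) auto
  also have "\<dots> = (\<Sum>B\<in>Pow V. set_weight x t B * (sum \<pi> B * (1 - sum \<pi> B) * sin (pi * d)))"
    by (simp add: sum_distrib_right mult.assoc)
  also have "\<dots> \<le> (\<Sum>B\<in>Pow V. set_weight x t B * (d * (1 - d) * sin (pi * sum \<pi> B)))"
  proof (intro sum_mono mult_left_mono set_weight_nonneg x)
    fix B assume B: "B \<in> Pow V"
    show "sum \<pi> B * (1 - sum \<pi> B) * sin (pi * d) \<le> d * (1 - d) * sin (pi * sum \<pi> B)"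
    proof (cases "B = {} \<or> B = V")
      case True
      then show ?thesis using stat_sum by auto
    next
      case False
      then show ?thesis using nontrivial_measure[of B] B d_pos by (intro logistic_le_sine) auto
    qed
  qed
  also have "\<dots> = d * (1 - d) * (\<Sum>B\<in>Pow V. set_weight x t B * sin (pi * sum \<pi> B))"
    by (simp add: sum_distrib_left mult_ac)
  also have "\<dots> \<le> d * (1 - d) * (contraction ^ t * sin (pi * \<pi> x))"
    using d_pos d_half by (intro mult_left_mono sine_decay x) auto
  also have "\<dots> \<le> (1 - d) * contraction ^ t * (\<pi> x * sin (pi * d))"
  proof -
    \<comment> \<open>concavity along the segment from \<open>0\<close> to \<open>\<pi> x\<close>, which contains \<open>d\<close>\<close>
    have "d * sin (pi * \<pi> x) \<le> \<pi> x * sin (pi * d)"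
    proof -
      let ?l = "d / \<pi> x"
      have l: "0 \<le> ?l" "?l \<le> 1" using d_pos xpos single_measure[OF x] by auto
      have "(1 - ?l) * sin (pi * 0) + ?l * sin (pi * \<pi> x) \<le> sin (pi * ((1 - ?l) *\<^sub>R 0 + ?l *\<^sub>R \<pi> x))"
        by (rule concave_onD[OF concave_sin_pi l]) (use single_measure[OF x] xpos d_pos in auto)
      then show ?thesis using xpos by (simp add: field_simps)
    qed
    then have "(1 - d) * contraction ^ t * (d * sin (pi * \<pi> x)) \<le> (1 - d) * contraction ^ t * (\<pi> x * sin (pi * d))"
      using d_half contraction_bounds by (intro mult_left_mono) auto
    then show ?thesis by (simp add: mult_ac)
  qed
  finally have "(\<pi> x * sin (pi * d)) * tv_dist V P \<pi> t x \<le> (\<pi> x * sin (pi * d)) * ((1 - d) * contraction ^ t)"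
    by (simp add: mult_ac)
  then show ?thesis using xpos sin_pi_d_pos by simp
qed

lemma pointwise_le_tv_dist:
  assumes x: "x \<in> V" and y: "y \<in> V"
  shows "\<bar>kernel_pow V P t x y - \<pi> y\<bar> \<le> tv_dist V P \<pi> t x"
proof -
  let ?e = "\<lambda>z. kernel_pow V P t x z - \<pi> z"
  have "sum ?e V = 0" using kernel_pow_row[OF x] stat_sum by (simp add: sum_subtractf)
  then have "?e y = - sum ?e (V - {y})" using sum.remove[OF finite_V y, of ?e] by simp
  also have "\<bar>\<dots>\<bar> \<le> (\<Sum>z\<in>V - {y}. \<bar>?e z\<bar>)" by simp
  finally have "2 * \<bar>?e y\<bar> \<le> (\<Sum>z\<in>V. \<bar>?e z\<bar>)"
    using sum.remove[OF finite_V y, of "\<lambda>z. \<bar>?e z\<bar>"] by simp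
  then show ?thesis by (simp add: tv_dist_def)
qed

lemma rel_sup_dist_le_iff:
  assumes "x \<in> V"
  shows "rel_sup_dist V P \<pi> t x \<le> b \<longleftrightarrow> (\<forall>y\<in>V. \<bar>kernel_pow V P t x y / \<pi> y - 1\<bar> \<le> b)"
  unfolding rel_sup_dist_def using finite_V assms by (subst Max_le_iff) auto

lemma rel_sup_dist_le_contraction:
  assumes x: "x \<in> V"
  shows "rel_sup_dist V P \<pi> t x \<le> (1 - d) / d * contraction ^ t"
  unfolding rel_sup_dist_le_iff[OF x]
proof
  fix y assume y: "y \<in> V"
  have "kernel_pow V P t x y / \<pi> y - 1 = (kernel_pow V P t x y - \<pi> y) / \<pi> y"
    using stat_pos[OF y] by (simp add: field_simps)
  then have "\<bar>kernel_pow V P t x y / \<pi> y - 1\<bar> = \<bar>kernel_pow V P t x y - \<pi> y\<bar> / \<pi> y"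
    using stat_pos[OF y] by (simp only: abs_divide abs_of_pos)
  also have "\<dots> \<le> ((1 - d) * contraction ^ t) / d"
    using pointwise_le_tv_dist[OF x y, of t] tv_dist_le[OF x, of t] single_measure[OF y] d_pos d_half contraction_bounds
    by (intro frac_le) auto
  finally show "\<bar>kernel_pow V P t x y / \<pi> y - 1\<bar> \<le> (1 - d) / d * contraction ^ t" by simp
qed

text \<open>
  The drop of \<open>sqrt (a (1 - a))\<close> is linearised by a supporting line of \<open>decay_rate\<close>.  In the variables
  \<open>sqrt (a (1 - a))\<close> and \<open>a\<close> the result is linear, so it can be averaged over the set process.
\<close>

lemma sqrt_logistic_step:
  assumes A: "A \<in> Pow V" and line: "\<And>y. 0 < y \<Longrightarrow> s * y + c \<le> (1 + y\<^sup>2) ^ 4 / y ^ 3" "c \<le> 0"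
  shows "(\<Sum>B\<in>Pow V. evolve A B * sqrt (sum \<pi> B * (1 - sum \<pi> B)))
     \<le> sqrt (sum \<pi> A * (1 - sum \<pi> A)) - d\<^sup>2 / 8 * (s * sqrt (sum \<pi> A * (1 - sum \<pi> A)) + c * sum \<pi> A)"
proof -
  let ?a = "sum \<pi> A" and ?h = "overlap A"
  have 1: "(\<Sum>B\<in>Pow V. evolve A B * sqrt (sum \<pi> B * (1 - sum \<pi> B)))
      \<le> (sqrt ((?a + ?h) * (1 - (?a + ?h))) + sqrt ((?a - ?h) * (1 - (?a - ?h)))) / 2"
    by (rule evolve_concave[OF A concave_sqrt_logistic])
  show ?thesis
  proof (cases "A = {} \<or> A = V")
    case True
    have "d\<^sup>2 / 8 * c \<le> 0" using line(2) by (intro mult_nonneg_nonpos) auto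
    then show ?thesis using 1 True trivial_overlap stat_sum by auto
  next
    case False
    with A have ne: "A \<subseteq> V" "A \<noteq> {}" "A \<noteq> V" by auto
    note h = expansion[OF ne] overlap_bounds[OF ne(1)]
    have a: "0 < ?a" "?a < 1" using nontrivial_measure[OF ne] d_pos by auto
    define z where "z = ?a * (1 - ?a)"
    define y where "y = sqrt ((1 - ?a) / ?a)"
    have z: "0 < z" and y: "0 < y" using a by (auto simp: z_def y_def)
    have y2: "y\<^sup>2 = (1 - ?a) / ?a" using a by (simp add: y_def)
    have zy: "z = ?a\<^sup>2 * y\<^sup>2" unfolding y2 z_def using a by (simp add: power2_eq_square)
    have sz: "sqrt z = ?a * y" unfolding zy using a y by (simp add: real_sqrt_mult)
    have "1 + y\<^sup>2 = 1 / ?a" unfolding y2 using a by (simp add: field_simps)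
    then have "(1 + y\<^sup>2) ^ 4 / y ^ 3 = 1 / (?a ^ 4 * y ^ 3)" by (simp add: power_one_over)
    with line(1)[OF y] have "?a * (s * y + c) \<le> ?a * (1 / (?a ^ 4 * y ^ 3))"
      using a by (intro mult_left_mono) auto
    also have "\<dots> = 1 / (z * sqrt z)"
      unfolding sz unfolding zy using a y by (simp add: power_numeral_reduce field_simps)
    finally have key: "s * sqrt z + c * ?a \<le> 1 / (z * sqrt z)"
      unfolding sz by (simp add: algebra_simps)
    have "(sqrt ((?a + ?h) * (1 - (?a + ?h))) + sqrt ((?a - ?h) * (1 - (?a - ?h)))) / 2
        \<le> sqrt z - ?h\<^sup>2 / (8 * z * sqrt z)"
      unfolding z_def using h a by (intro sqrt_logistic_average) auto
    also have "?h\<^sup>2 / (8 * z * sqrt z) = ?h\<^sup>2 / 8 * (1 / (z * sqrt z))" by simp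
    also have "sqrt z - \<dots> \<le> sqrt z - d\<^sup>2 / 8 * (1 / (z * sqrt z))"
      using h d_pos z by (intro diff_left_mono mult_right_mono divide_right_mono power_mono) auto
    also have "\<dots> \<le> sqrt z - d\<^sup>2 / 8 * (s * sqrt z + c * ?a)"
      by (intro diff_left_mono mult_left_mono key) simp
    finally show ?thesis using 1 unfolding z_def by linarith
  qed
qed

definition chi_bound :: "'a \<Rightarrow> nat \<Rightarrow> real" where
  "chi_bound x t = (\<Sum>B\<in>Pow V. set_weight x t B * sqrt (sum \<pi> B * (1 - sum \<pi> B))) / \<pi> x"

lemma chi_dist_le_chi_bound: "x \<in> V \<Longrightarrow> chi_dist t x \<le> chi_bound x t"
  using chi_dist_mixture[of x t] stat_pos[of x] by (simp add: chi_bound_def field_simps)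

lemma chi_bound_nonneg: "x \<in> V \<Longrightarrow> 0 \<le> chi_bound x t"
  unfolding chi_bound_def using stat_measure
  by (intro divide_nonneg_nonneg sum_nonneg mult_nonneg_nonneg set_weight_nonneg stat_nonneg) auto

lemma chi_bound_start:
  assumes x: "x \<in> V"
  shows "chi_bound x 0 \<le> sqrt (1 / d - 1)"
proof -
  have xp: "0 < \<pi> x" by (rule stat_pos[OF x])
  have "chi_bound x 0 = sqrt (\<pi> x * (1 - \<pi> x)) / sqrt ((\<pi> x)\<^sup>2)"
    unfolding chi_bound_def set_weight_0[OF x] using xp by simp
  also have "\<dots> = sqrt (1 / \<pi> x - 1)"
    unfolding real_sqrt_divide[symmetric] using xp by (simp add: power2_eq_square field_simps)
  also have "\<dots> \<le> sqrt (1 / d - 1)"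
    using single_measure[OF x] d_pos by (simp add: frac_le)
  finally show ?thesis .
qed

text \<open>
  Averaging the linearised drop, with the line that touches \<open>decay_rate\<close> at the current value, is Jensen's
  inequality for the weights \<open>set_weight x t A * sum \<pi> A / \<pi> x\<close>, which add up to \<open>1\<close>.
\<close>

lemma chi_bound_step:
  assumes x: "x \<in> V"
  shows "chi_bound x (Suc t) \<le> chi_bound x t - d\<^sup>2 / 8 * decay_rate (chi_bound x t)"
proof -
  let ?Y = "chi_bound x t"
  obtain s c where line: "\<And>y. 0 < y \<Longrightarrow> s * y + c \<le> (1 + y\<^sup>2) ^ 4 / y ^ 3" "c \<le> 0" "s * ?Y + c = decay_rate ?Y"
    using decay_rate_supporting_line[OF chi_bound_nonneg[OF x, of t]] by blast
  let ?q = "\<lambda>A. sqrt (sum \<pi> A * (1 - sum \<pi> A))"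
  have q: "(\<Sum>A\<in>Pow V. set_weight x n A * ?q A) = \<pi> x * chi_bound x n" for n
    unfolding chi_bound_def using stat_pos[OF x] by simp
  have lin: "(\<Sum>A\<in>I. w A * (g A - k * (s * g A + c * p A)))
      = (\<Sum>A\<in>I. w A * g A) - k * (s * (\<Sum>A\<in>I. w A * g A) + c * (\<Sum>A\<in>I. w A * p A))"
    for I and w g p :: "'a set \<Rightarrow> real" and k
    by (simp add: algebra_simps sum.distrib sum_subtractf sum_distrib_left)
  have "\<pi> x * chi_bound x (Suc t) \<le> (\<Sum>A\<in>Pow V. set_weight x t A * (?q A - d\<^sup>2 / 8 * (s * ?q A + c * sum \<pi> A)))"
    unfolding q[symmetric] set_weight_Suc
    by (intro sum_mono mult_left_mono sqrt_logistic_step line set_weight_nonneg x)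
  also have "\<dots> = (\<Sum>A\<in>Pow V. set_weight x t A * ?q A)
      - d\<^sup>2 / 8 * (s * (\<Sum>A\<in>Pow V. set_weight x t A * ?q A) + c * (\<Sum>A\<in>Pow V. set_weight x t A * sum \<pi> A))"
    by (rule lin)
  also have "\<dots> = \<pi> x * (?Y - d\<^sup>2 / 8 * (s * ?Y + c))"
    unfolding q set_weight_mean[OF x] by (simp add: algebra_simps)
  finally show ?thesis unfolding line(3) using stat_pos[OF x] by simp
qed

lemma chi_bound_antimono:
  assumes x: "x \<in> V" and "s \<le> t"
  shows "chi_bound x t \<le> chi_bound x s"
proof (rule decseqD[OF decseq_SucI assms(2)])
  fix n
  have "0 \<le> decay_rate (chi_bound x n)"
    using decay_rate_pos[of "chi_bound x n"] chi_bound_nonneg[OF x, of n]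
    by (cases "chi_bound x n = 0") (auto simp: decay_rate_def)
  then have "0 \<le> d\<^sup>2 / 8 * decay_rate (chi_bound x n)" by simp
  then show "chi_bound x (Suc n) \<le> chi_bound x n" using chi_bound_step[OF x, of n] by linarith
qed

text \<open>
  With \<open>k = d\<^sup>2 / 8\<close> this is \<open>2 * decay_time (sqrt \<epsilon>) / k\<close>: each of the two \<open>L\<^sup>2\<close> distances whose product
  bounds the uniform distance has to come down to \<open>sqrt \<epsilon>\<close>.
\<close>

definition sup_time :: "real \<Rightarrow> real" where
  "sup_time \<epsilon> = (if \<epsilon> \<le> 1 then 4 / d\<^sup>2 * (1/6 + ln (1 / \<epsilon>) / 8)
              else 4 / d\<^sup>2 * ((1 + 3 * \<epsilon>) / (3 * (1 + \<epsilon>) ^ 3)))"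

lemma chi_bound_half_time:
  assumes "x \<in> V" "0 < \<epsilon>" "sup_time \<epsilon> \<le> real T"
  shows "(chi_bound x (T div 2))\<^sup>2 \<le> \<epsilon>"
  by (rule decaying_sequence_bound[OF d_pos d_half chi_bound_nonneg[OF assms(1)]
        chi_bound_start[OF assms(1)] chi_bound_step[OF assms(1)] assms(2)])
    (use assms(3) in \<open>simp add: sup_time_def\<close>)

text \<open>
  The time is split into \<open>T div 2\<close> steps of the chain and the remaining steps, at least as many, of its
  reversal.
\<close>

lemma rel_sup_dist_le_sup_time:
  assumes rev: "expanding_chain V (reversal \<pi> P) \<pi> d"
    and x: "x \<in> V" and eps: "0 < \<epsilon>" and T: "sup_time \<epsilon> \<le> real T"
  shows "rel_sup_dist V P \<pi> T x \<le> \<epsilon>"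
  unfolding rel_sup_dist_le_iff[OF x]
proof
  fix y assume y: "y \<in> V"
  interpret rev: expanding_chain V "reversal \<pi> P" \<pi> d by (rule rev)
  let ?s = "T div 2"
  have le: "chi_dist ?s x \<le> sqrt \<epsilon>" "rev.chi_dist (T - ?s) y \<le> sqrt \<epsilon>"
  proof -
    have "chi_bound x ?s \<le> sqrt \<epsilon>"
      using chi_bound_half_time[OF x eps T] by (rule real_le_rsqrt)
    then show "chi_dist ?s x \<le> sqrt \<epsilon>" using chi_dist_le_chi_bound[OF x, of ?s] by linarith
    have "rev.chi_bound y ?s \<le> sqrt \<epsilon>"
      using rev.chi_bound_half_time[OF y eps, of T] T
      by (intro real_le_rsqrt) (simp add: rev.sup_time_def sup_time_def)
    then show "rev.chi_dist (T - ?s) y \<le> sqrt \<epsilon>"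
      using rev.chi_dist_le_chi_bound[OF y, of "T - ?s"] rev.chi_bound_antimono[OF y, of ?s "T - ?s"] by linarith
  qed
  have "?s + (T - ?s) = T" by simp
  then have "\<bar>kernel_pow V P T x y / \<pi> y - 1\<bar> \<le> chi_dist ?s x * rev.chi_dist (T - ?s) y"
    using density_error_le_chi_dist[OF x y, of ?s "T - ?s"] by simp
  also have "\<dots> \<le> sqrt \<epsilon> * sqrt \<epsilon>"
    using le eps by (intro mult_mono) (auto simp: rev.chi_dist_def)
  finally show "\<bar>kernel_pow V P T x y / \<pi> y - 1\<bar> \<le> \<epsilon>" using eps by simp
qed

lemma contraction_time:
  assumes "0 < t" "0 < b" "0 < \<epsilon>" "inv_neg_log contraction * ln (b / \<epsilon>) \<le> real t"
  shows "b * contraction ^ t \<le> \<epsilon>"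
proof (cases "contraction = 0")
  case True
  then show ?thesis using assms by (simp add: power_0_left)
next
  case False
  then have c: "0 < contraction" "contraction < 1" using contraction_bounds by auto
  then have l: "ln contraction < 0" by simp
  then have "ln (b / \<epsilon>) \<le> real t * (- ln contraction)"
    using assms(4) False by (simp add: inv_neg_log_def field_simps)
  then have "ln (b * contraction ^ t) \<le> ln \<epsilon>"
    using assms c by (simp add: ln_div ln_mult ln_realpow)
  then show ?thesis using assms c by (simp add: ln_le_cancel_iff)
qed

theorem tau_le_contraction:
  assumes "0 < \<epsilon>"
  shows "tau_le V P \<pi> \<epsilon> (inv_neg_log contraction * ln ((1 - d) / \<epsilon>))"
  unfolding tau_le_def
proof (intro allI impI ballI)
  fix t x assume t: "0 < t \<and> inv_neg_log contraction * ln ((1 - d) / \<epsilon>) \<le> real t" and x: "x \<in> V"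
  have "(1 - d) * contraction ^ t \<le> \<epsilon>" using t assms d_half by (intro contraction_time) auto
  with tv_dist_le[OF x, of t] show "tv_dist V P \<pi> t x \<le> \<epsilon>" by linarith
qed

theorem tau_inf_le_contraction:
  assumes "0 < \<epsilon>"
  shows "tau_inf_le V P \<pi> \<epsilon> (inv_neg_log contraction * (ln ((1 - d) / d) + ln (1 / \<epsilon>)))"
proof -
  have eq: "ln ((1 - d) / d) + ln (1 / \<epsilon>) = ln (((1 - d) / d) / \<epsilon>)"
    using ln_mult_pos[of "(1 - d) / d" "1 / \<epsilon>"] d_pos d_half assms by simp
  show ?thesis
    unfolding tau_inf_le_def
  proof (intro allI impI ballI)
    fix t x assume t: "0 < t \<and> inv_neg_log contraction * (ln ((1 - d) / d) + ln (1 / \<epsilon>)) \<le> real t"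
      and x: "x \<in> V"
    have "(1 - d) / d * contraction ^ t \<le> \<epsilon>"
      using t eq assms d_half d_pos by (intro contraction_time) auto
    with rel_sup_dist_le_contraction[OF x, of t] show "rel_sup_dist V P \<pi> t x \<le> \<epsilon>" by linarith
  qed
qed

theorem tau_inf_le_sup_time:
  assumes "expanding_chain V (reversal \<pi> P) \<pi> d" "0 < \<epsilon>"
  shows "tau_inf_le V P \<pi> \<epsilon> (sup_time \<epsilon>)"
  unfolding tau_inf_le_def using rel_sup_dist_le_sup_time[OF assms(1) _ assms(2)] by blast

text \<open>
  An eigenvector for an eigenvalue other than \<open>1\<close> has mean zero under \<open>\<pi>\<close>.  On such functions \<open>P\<^sup>t\<close> acts
  like \<open>P\<^sup>t - \<pi>\<close>, whose entries are at most a constant times \<open>contraction\<^sup>t\<close>, so the modulus of the eigenvalue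
  cannot exceed the contraction factor.
\<close>

theorem eigenvalue_le_contraction:
  assumes "complex_eigenvalue V P \<mu>" "\<mu> \<noteq> 1"
  shows "cmod \<mu> \<le> contraction"
proof -
  from assms(1) obtain f where f: "\<exists>x\<in>V. f x \<noteq> 0" "\<And>x. x \<in> V \<Longrightarrow> (\<Sum>y\<in>V. complex_of_real (P x y) * f y) = \<mu> * f x"
    by (auto simp: is_eigenvalue_def)
  from f(1) obtain x where x: "x \<in> V" "f x \<noteq> 0" by blast
  have pow: "(\<Sum>y\<in>V. complex_of_real (kernel_pow V P t x y) * f y) = \<mu> ^ t * f x" if "x \<in> V" for t x
    using that
  proof (induction t arbitrary: x)
    case 0
    then show ?case using finite_V by (simp add: if_distrib if_distribR cong: if_cong)
  next
    case (Suc t)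
    have "(\<Sum>y\<in>V. complex_of_real (kernel_pow V P (Suc t) x y) * f y)
        = (\<Sum>y\<in>V. \<Sum>z\<in>V. of_real (P x z) * (of_real (kernel_pow V P t z y) * f y))"
      by (simp add: sum_distrib_right mult.assoc)
    also have "\<dots> = (\<Sum>z\<in>V. of_real (P x z) * (\<Sum>y\<in>V. of_real (kernel_pow V P t z y) * f y))"
      by (subst sum.swap) (simp add: sum_distrib_left)
    also have "\<dots> = (\<Sum>z\<in>V. \<mu> ^ t * (of_real (P x z) * f z))"
      using Suc.IH by (intro sum.cong refl) simp
    also have "\<dots> = \<mu> ^ t * (\<mu> * f x)" by (simp only: f(2)[OF Suc.prems] flip: sum_distrib_left)
    finally show ?case by simp
  qed
  have mean0: "(\<Sum>y\<in>V. complex_of_real (\<pi> y) * f y) = 0"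
  proof -
    have "\<mu> * (\<Sum>x\<in>V. complex_of_real (\<pi> x) * f x) = (\<Sum>x\<in>V. of_real (\<pi> x) * (\<mu> * f x))"
      by (simp add: sum_distrib_left mult_ac)
    also have "\<dots> = (\<Sum>x\<in>V. \<Sum>y\<in>V. of_real (\<pi> x * P x y) * f y)"
      by (intro sum.cong refl) (simp add: f(2)[symmetric] sum_distrib_left mult.assoc)
    also have "\<dots> = (\<Sum>y\<in>V. of_real (\<Sum>x\<in>V. \<pi> x * P x y) * f y)"
      by (subst sum.swap) (simp add: sum_distrib_right)
    also have "\<dots> = (\<Sum>y\<in>V. of_real (\<pi> y) * f y)" by (simp add: stat_eq)
    finally show ?thesis using assms(2) by simp
  qed
  define K where "K = (\<Sum>y\<in>V. cmod (f y))"
  have K: "cmod \<mu> ^ t * cmod (f x) \<le> K * contraction ^ t" for t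
  proof -
    have "\<mu> ^ t * f x = (\<Sum>y\<in>V. of_real (kernel_pow V P t x y - \<pi> y) * f y)"
      using pow[OF x(1), of t] mean0 by (simp add: left_diff_distrib sum_subtractf)
    also have "cmod \<dots> \<le> (\<Sum>y\<in>V. cmod (f y) * contraction ^ t)"
    proof (rule sum_norm_le)
      fix y assume y: "y \<in> V"
      have "(1 - d) * contraction ^ t \<le> 1 * contraction ^ t"
        using d_pos contraction_bounds by (intro mult_right_mono) auto
      then have "\<bar>kernel_pow V P t x y - \<pi> y\<bar> \<le> contraction ^ t"
        using pointwise_le_tv_dist[OF x(1) y, of t] tv_dist_le[OF x(1), of t] by linarith
      then show "cmod (of_real (kernel_pow V P t x y - \<pi> y) * f y) \<le> cmod (f y) * contraction ^ t"
        unfolding norm_mult norm_of_real mult.commute[of _ "cmod (f y)"] by (intro mult_left_mono) auto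
    qed
    finally show ?thesis by (simp add: K_def norm_mult norm_power sum_distrib_right)
  qed
  show ?thesis
  proof (rule ccontr)
    assume *: "\<not> ?thesis"
    have fx: "0 < cmod (f x)" using x by simp
    show False
    proof (cases "contraction = 0")
      case True
      then show False using K[of 1] * fx by (simp add: mult_le_0_iff)
    next
      case False
      then have c: "0 < contraction" using contraction_bounds by simp
      then have "1 < cmod \<mu> / contraction" using * by simp
      then obtain t where "K / cmod (f x) < (cmod \<mu> / contraction) ^ t" using real_arch_pow by blast
      then show False using K[of t] fx c by (simp add: field_simps power_divide)
    qed
  qed
qed

end

section \<open>Overlap from vertex expansion, and lazy chains\<close>

context stationary_chain begin

lemma flow_reversal: "A \<subseteq> V \<Longrightarrow> stationary_chain.flow (reversal \<pi> P) \<pi> A y = (\<Sum>x\<in>A. \<pi> y * P y x)"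
  unfolding stationary_chain.flow_def[OF reversal_chain]
  using stat_pos by (intro sum.cong) (force simp: reversal_def)+

lemma reversal_pos: "x \<in> V \<Longrightarrow> y \<in> V \<Longrightarrow> 0 < reversal \<pi> P x y \<Longrightarrow> 0 < P y x"
  using P_nonneg[of y x] by (cases "P y x = 0") (auto simp: reversal_def)

lemma flow_pos: "A \<subseteq> V \<Longrightarrow> x \<in> A \<Longrightarrow> y \<in> V \<Longrightarrow> 0 < P x y \<Longrightarrow> 0 < flow A y"
  unfolding flow_def
  by (rule sum_pos2[of A x]) (auto intro!: mult_nonneg_nonneg stat_nonneg P_nonneg mult_pos_pos stat_pos finite_subset_V)

lemma flow_pos_obtains:
  assumes "A \<subseteq> V" "y \<in> V" "0 < flow A y"
  obtains x where "x \<in> A" "0 < P x y"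
proof -
  have "\<exists>x\<in>A. 0 < P x y"
  proof (rule ccontr)
    assume "\<not> ?thesis"
    then have "flow A y \<le> 0"
      unfolding flow_def using assms stat_nonneg
      by (intro sum_nonpos mult_nonneg_nonpos) (auto simp: not_less)
    with assms show False by simp
  qed
  then show thesis using that by blast
qed

lemma overlap_compl: "A \<subseteq> V \<Longrightarrow> overlap (V - A) = overlap A"
  unfolding overlap_def by (simp add: double_diff min.commute)

lemma overlap_ge_single:
  assumes "A \<subseteq> V" "y \<in> V"
  shows "min (flow A y) (flow (V - A) y) \<le> overlap A"
  unfolding overlap_def using assms finite_V
  by (intro member_le_sum[where f = "\<lambda>y. min (flow A y) (flow (V - A) y)"]) (auto intro: flow_nonneg)

lemma overlap_ge_pair:
  assumes "A \<subseteq> V" "y \<in> V" "z \<in> V" "y \<noteq> z"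
    and "q \<le> flow A y" "q \<le> flow (V - A) y" "q \<le> flow A z" "q \<le> flow (V - A) z"
  shows "2 * q \<le> overlap A"
proof -
  have "2 * q \<le> (\<Sum>u\<in>{y, z}. min (flow A u) (flow (V - A) u))" using assms by simp
  also have "\<dots> \<le> overlap A"
    unfolding overlap_def using assms finite_V by (intro sum_mono2) (auto intro: flow_nonneg)
  finally show ?thesis .
qed

lemma flow_ge_quantum:
  assumes q: "\<And>x y. x \<in> V \<Longrightarrow> y \<in> V \<Longrightarrow> 0 < P x y \<Longrightarrow> q \<le> \<pi> x * P x y"
    and A: "A \<subseteq> V" "y \<in> V" "0 < flow A y"
  shows "q \<le> flow A y"
proof -
  obtain x where x: "x \<in> A" "0 < P x y" by (rule flow_pos_obtains[OF A])
  have "q \<le> \<pi> x * P x y" using q x A by blast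
  also have "\<dots> \<le> flow A y"
    unfolding flow_def using x A finite_subset_V[OF A(1)]
    by (intro member_le_sum[where f = "\<lambda>x. \<pi> x * P x y"]) (auto intro!: mult_nonneg_nonneg stat_nonneg P_nonneg)
  finally show ?thesis .
qed

text \<open>
  Two states that receive flow both from \<open>A\<close> and from its complement contribute at least \<open>q\<close> each to the
  overlap.  If the overlap is smaller than \<open>2 q\<close>, then all states with at most one exception receive
  flow from one side only.
\<close>

lemma overlap_dichotomy:
  assumes q: "\<And>x y. x \<in> V \<Longrightarrow> y \<in> V \<Longrightarrow> 0 < P x y \<Longrightarrow> q \<le> \<pi> x * P x y"
    and A: "A \<subseteq> V" and small: "overlap A < 2 * q"
  obtains "\<And>y. y \<in> V \<Longrightarrow> flow A y = 0 \<or> flow (V - A) y = 0"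
  | v where "v \<in> V" "0 < flow A v" "0 < flow (V - A) v" "\<And>y. y \<in> V - {v} \<Longrightarrow> flow A y = 0 \<or> flow (V - A) y = 0"
proof -
  have nn: "0 \<le> flow A y" "0 \<le> flow (V - A) y" if "y \<in> V" for y using flow_nonneg that A by auto
  show thesis
  proof (cases "\<exists>v\<in>V. 0 < flow A v \<and> 0 < flow (V - A) v")
    case False
    have "flow A y = 0 \<or> flow (V - A) y = 0" if "y \<in> V" for y
      using False nn[OF that] that by force
    then show thesis by (rule that(1))
  next
    case True
    then obtain v where v: "v \<in> V" "0 < flow A v" "0 < flow (V - A) v" by blast
    have "flow A y = 0 \<or> flow (V - A) y = 0" if y: "y \<in> V - {v}" for y
    proof (rule ccontr)
      assume "\<not> ?thesis"
      then have "0 < flow A y" "0 < flow (V - A) y" using nn[of y] y by auto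
      then have "2 * q \<le> overlap A"
        using A y v by (intro overlap_ge_pair[of A y v] flow_ge_quantum q) auto
      with small show False by simp
    qed
    with v show thesis using that(2) by blast
  qed
qed

text \<open>
  As the overlap is symmetric, let \<open>A\<close> have measure at most \<open>1/2\<close>.  Suppose the overlap is too small and
  take for \<open>v\<close> the exceptional state, or any state that receives flow from \<open>A\<close> if there is none.  All
  other states that \<open>A\<close> leads to receive flow from \<open>A\<close> only, so their total mass is just this
  flow.  Hence \<open>N(A) - {v}\<close> has mass at most \<open>\<pi>(A)\<close> minus the flow into \<open>v\<close>, against the
  assumption.
\<close>

lemma overlap_of_expansion:
  assumes q: "\<And>x y. x \<in> V \<Longrightarrow> y \<in> V \<Longrightarrow> 0 < P x y \<Longrightarrow> q \<le> \<pi> x * P x y"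
    and ex: "\<And>A v. A \<subseteq> V \<Longrightarrow> sum \<pi> A \<le> 1/2 \<Longrightarrow> v \<in> V \<Longrightarrow> sum \<pi> A \<le> sum \<pi> (out_nbhd V P A - {v})"
    and A: "A \<subseteq> V" "A \<noteq> {}" "A \<noteq> V"
  shows "2 * q \<le> overlap A"
proof -
  have main: "2 * q \<le> overlap A" if A: "A \<subseteq> V" "A \<noteq> {}" and half: "sum \<pi> A \<le> 1/2" for A
  proof (rule ccontr)
    assume "\<not> ?thesis"
    then have small: "overlap A < 2 * q" by simp
    have "\<exists>v\<in>V. 0 < flow A v \<and> (\<forall>y\<in>V - {v}. flow A y = 0 \<or> flow (V - A) y = 0)"
      using q A(1) small
    proof (rule overlap_dichotomy)
      assume *: "\<And>y. y \<in> V \<Longrightarrow> flow A y = 0 \<or> flow (V - A) y = 0"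
      have "\<exists>v\<in>V. 0 < flow A v"
      proof (rule ccontr)
        assume "\<not> ?thesis"
        then have "(\<Sum>y\<in>V. flow A y) \<le> 0" by (intro sum_nonpos) (auto simp: not_less)
        then show False using stat_measure_pos[OF A] flow_total[OF A(1)] by simp
      qed
      with * show ?thesis by blast
    qed blast+
    then obtain v where v: "v \<in> V" "0 < flow A v" "\<And>y. y \<in> V - {v} \<Longrightarrow> flow A y = 0 \<or> flow (V - A) y = 0"
      by blast
    let ?N = "out_nbhd V P A - {v}"
    have "sum \<pi> ?N = sum (flow A) ?N"
    proof (intro sum.cong refl)
      fix y assume y: "y \<in> ?N"
      then obtain x where "y \<in> V - {v}" "x \<in> A" "0 < P x y" by (auto simp: out_nbhd_def)
      then show "\<pi> y = flow A y" using v(3)[of y] flow_pos[of A x y] flow_compl[of A y] A by auto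
    qed
    also have "\<dots> \<le> sum (flow A) (V - {v})"
      using finite_V A by (intro sum_mono2) (auto simp: out_nbhd_def intro: flow_nonneg)
    also have "\<dots> = sum \<pi> A - flow A v"
      using sum.remove[OF finite_V v(1), of "flow A"] flow_total[OF A(1)] by simp
    finally show False using ex[OF A(1) half v(1)] v(2) by simp
  qed
  show ?thesis
  proof (cases "sum \<pi> A \<le> 1/2")
    case True
    then show ?thesis by (rule main[OF A(1,2)])
  next
    case False
    then have "2 * q \<le> overlap (V - A)" using A by (intro main) (auto simp: stat_measure_compl)
    then show ?thesis by (simp add: overlap_compl[OF A(1)])
  qed
qed

text \<open>
  In the reversed chain the flow from a set into \<open>y\<close> is the flow of the original chain from \<open>y\<close> into that
  set.  If the overlap of \<open>A\<close> is too small, then all states except possibly one state \<open>v\<close> lead only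
  into \<open>A\<close> or only into its complement.  Let \<open>B\<close> be the set of those that lead only into \<open>A\<close>, so that
  \<open>\<pi>(A) = \<pi>(B) + Q\<close> with \<open>Q\<close> the flow from \<open>v\<close> into \<open>A\<close>, where one may take \<open>Q < 2 q\<close> after
  exchanging \<open>A\<close> with its complement.  One of \<open>B\<close> and its complement has measure at most \<open>1/2\<close>, and the
  expansion condition fails for it:
  \<^item> for \<open>B\<close>, whose successors lie in \<open>A\<close>, remove any state of \<open>A\<close>; its mass is at least \<open>2 q\<close>;
  \<^item> for the complement of \<open>B\<close>, whose successors lie outside \<open>A\<close> except for those of \<open>v\<close>, remove the
    only successor of \<open>v\<close> in \<open>A\<close> (a second one would make \<open>Q\<close> at least \<open>2 q\<close>), or, if \<open>Q = 0\<close>, any state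
    outside \<open>A\<close>.
\<close>

lemma reversal_overlap_of_expansion:
  assumes qpos: "0 < q"
    and q: "\<And>x y. x \<in> V \<Longrightarrow> y \<in> V \<Longrightarrow> 0 < P x y \<Longrightarrow> q \<le> \<pi> x * P x y"
    and ex: "\<And>A v. A \<subseteq> V \<Longrightarrow> sum \<pi> A \<le> 1/2 \<Longrightarrow> v \<in> V \<Longrightarrow> sum \<pi> A \<le> sum \<pi> (out_nbhd V P A - {v})"
    and mass: "\<And>x. x \<in> V \<Longrightarrow> 2 * q \<le> \<pi> x"
    and A: "A \<subseteq> V" "A \<noteq> {}" "A \<noteq> V"
  shows "2 * q \<le> stationary_chain.overlap V (reversal \<pi> P) \<pi> A"
proof (rule ccontr)
  interpret rev: stationary_chain V "reversal \<pi> P" \<pi> by (rule reversal_chain)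
  assume "\<not> ?thesis"
  then have small: "rev.overlap A < 2 * q" by simp
  have rq: "q \<le> \<pi> x * reversal \<pi> P x y" if "x \<in> V" "y \<in> V" "0 < reversal \<pi> P x y" for x y
  proof -
    have "\<pi> x * reversal \<pi> P x y = \<pi> y * P y x" using stat_pos[OF that(1)] by (simp add: reversal_def)
    moreover have "0 < P y x"
      by (rule reversal_pos[OF that])
    ultimately show ?thesis using q that by simp
  qed
  have out_pos: "0 < rev.flow C y" if "C \<subseteq> V" "x \<in> C" "y \<in> V" "0 < P y x" for C x y
    using that stat_pos[of y] stat_pos[of x] by (intro rev.flow_pos[of C x]) (auto simp: reversal_def)
  have False
    if A: "A \<subseteq> V" "A \<noteq> {}" "A \<noteq> V" and v: "v \<in> V" "rev.flow A v < 2 * q"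
      and pure: "\<And>y. y \<in> V - {v} \<Longrightarrow> rev.flow A y = 0 \<or> rev.flow (V - A) y = 0" for A v
  proof -
    define B where "B = {y \<in> V - {v}. rev.flow (V - A) y = 0}"
    have B: "B \<subseteq> V" "v \<notin> B" by (auto simp: B_def)
    have outB: "out_nbhd V P B \<subseteq> A"
      using out_pos[of "V - A"] by (fastforce simp: out_nbhd_def B_def)
    have rest: "rev.flow A y = 0" if "y \<in> V - B" "y \<noteq> v" for y using pure[of y] that by (auto simp: B_def)
    have massA: "sum \<pi> A = sum \<pi> B + rev.flow A v"
    proof -
      have "sum \<pi> A = sum (rev.flow A) V" using rev.flow_total[OF A(1)] by simp
      also have "\<dots> = sum (rev.flow A) (V - B) + sum (rev.flow A) B"
        by (rule sum.subset_diff[OF B(1) finite_V])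
      also have "sum (rev.flow A) (V - B) = rev.flow A v"
        using v B rest finite_V by (subst sum.remove[of _ v]) (auto intro!: sum.neutral)
      also have "sum (rev.flow A) B = sum \<pi> B"
        using rev.flow_compl[OF A(1)] B by (intro sum.cong) (force simp: B_def)+
      finally show ?thesis by simp
    qed
    show False
    proof (cases "sum \<pi> B \<le> 1/2")
      case True
      obtain u where u: "u \<in> A" using A by blast
      then have uV: "u \<in> V" using A by blast
      have "sum \<pi> B \<le> sum \<pi> (out_nbhd V P B - {u})" by (rule ex[OF B(1) True uV])
      also have "\<dots> \<le> sum \<pi> (A - {u})"
        using outB A stat_nonneg finite_subset_V[OF A(1)] by (intro sum_mono2) auto
      also have "\<dots> = sum \<pi> A - \<pi> u" using u finite_subset_V[OF A(1)] by (simp add: sum_diff1)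
      finally show False using mass[OF uV] massA v(2) by simp
    next
      case False
      let ?D = "V - B"
      have D: "?D \<subseteq> V" "sum \<pi> ?D \<le> 1/2" using False B by (auto simp: stat_measure_compl)
      have strict: "sum \<pi> ?D \<le> sum \<pi> S"
        if u: "u \<in> V" and S: "S \<subseteq> V" "out_nbhd V P ?D - {u} \<subseteq> S" for u S
      proof -
        have "sum \<pi> ?D \<le> sum \<pi> (out_nbhd V P ?D - {u})" by (rule ex[OF D u])
        also have "\<dots> \<le> sum \<pi> S"
          using S stat_nonneg finite_subset_V[OF S(1)] by (intro sum_mono2) auto
        finally show ?thesis .
      qed
      have massD: "sum \<pi> ?D = sum \<pi> (V - A) + rev.flow A v"
        using massA stat_measure_compl A B by simp
      have from_D: "y = v" if "y \<in> ?D" "x \<in> A" "0 < P y x" for x y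
        using out_pos[OF A(1) that(2) _ that(3)] rest[of y] that by auto
      show False
      proof (cases "rev.flow A v = 0")
        case True
        obtain u where u: "u \<in> V - A" using A by blast
        have "out_nbhd V P ?D - {u} \<subseteq> (V - A) - {u}"
          using from_D out_pos[OF A(1) _ v(1)] True by (fastforce simp: out_nbhd_def)
        then have "sum \<pi> ?D \<le> sum \<pi> ((V - A) - {u})" using u by (intro strict) auto
        also have "\<dots> = sum \<pi> (V - A) - \<pi> u" using u finite_V by (simp add: sum_diff1)
        finally show False using massD True stat_pos[of u] u by simp
      next
        case nz: False
        have nonneg: "0 \<le> rev.flow A v" by (rule rev.flow_nonneg[OF A(1) v(1)])
        obtain u where u: "u \<in> A" "0 < P v u"
        proof (rule rev.flow_pos_obtains[OF A(1) v(1)])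
          show "0 < rev.flow A v" using nz nonneg by simp
          fix x assume "x \<in> A" "0 < reversal \<pi> P x v"
          then show thesis using that[of x] reversal_pos[of x v] v A by blast
        qed
        have only: "x = u" if x: "x \<in> A" "0 < P v x" for x
        proof (rule ccontr)
          assume ne: "x \<noteq> u"
          have "q \<le> \<pi> v * P v x" "q \<le> \<pi> v * P v u" using q x u v A by blast+
          then have "2 * q \<le> (\<Sum>z\<in>{x, u}. \<pi> v * P v z)" using ne by simp
          also have "\<dots> \<le> rev.flow A v"
            unfolding flow_reversal[OF A(1)] using x u v A finite_subset_V[OF A(1)]
            by (intro sum_mono2) (auto intro!: mult_nonneg_nonneg stat_nonneg P_nonneg)
          finally show False using v(2) by simp
        qed
        have "out_nbhd V P ?D - {u} \<subseteq> V - A"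
          using from_D only by (fastforce simp: out_nbhd_def)
        then have "sum \<pi> ?D \<le> sum \<pi> (V - A)" using u A by (intro strict[of u]) auto
        then show False using massD nz nonneg by simp
      qed
    qed
  qed
  note key = this
  have cc: "V - (V - A) = A" using A by blast
  have nontriv: "V - A \<subseteq> V" "V - A \<noteq> {}" "V - A \<noteq> V" using A by auto
  show False using rq A(1) small
  proof (rule rev.overlap_dichotomy)
    assume pure: "\<And>y. y \<in> V \<Longrightarrow> rev.flow A y = 0 \<or> rev.flow (V - A) y = 0"
    obtain v where v: "v \<in> V" using A by blast
    from pure[OF v] show False
    proof
      assume "rev.flow A v = 0"
      then show False using key[OF A v] pure qpos by simp
    next
      assume "rev.flow (V - A) v = 0"
      then show False using key[OF nontriv v] pure qpos unfolding cc by (metis Diff_iff mult_pos_pos zero_less_numeral)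
    qed
  next
    fix v assume v: "v \<in> V" and pure: "\<And>y. y \<in> V - {v} \<Longrightarrow> rev.flow A y = 0 \<or> rev.flow (V - A) y = 0"
    have "rev.flow A v < 2 * q \<or> rev.flow (V - A) v < 2 * q"
      using rev.overlap_ge_single[OF A(1) v] small by (auto simp: min_def split: if_splits)
    then show False
    proof
      assume "rev.flow A v < 2 * q"
      then show False using key[OF A v] pure by blast
    next
      assume "rev.flow (V - A) v < 2 * q"
      then show False using key[OF nontriv v] pure unfolding cc by blast
    qed
  qed
qed

lemma lazy_chain: "stationary_chain V (lazy_kernel P) \<pi>"
proof
  show "(\<Sum>y\<in>V. lazy_kernel P x y) = 1" if "x \<in> V" for x
    using that finite_V P_row[OF that] by (simp add: lazy_kernel_def sum.distrib flip: sum_divide_distrib)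
  show "(\<Sum>x\<in>V. \<pi> x * lazy_kernel P x y) = \<pi> y" if "y \<in> V" for y
  proof -
    have "(\<Sum>x\<in>V. \<pi> x * lazy_kernel P x y) = (\<Sum>x\<in>V. (if x = y then \<pi> x else 0) + \<pi> x * P x y) / 2"
      unfolding sum_divide_distrib by (intro sum.cong) (auto simp: lazy_kernel_def algebra_simps)
    then show ?thesis using that finite_V stat_eq[OF that] by (simp add: sum.distrib)
  qed
qed (use finite_V stat_pos stat_sum P_nonneg in \<open>auto simp: lazy_kernel_def\<close>)

text \<open>
  Because of the holding probability \<open>1/2\<close> a state of \<open>A\<close> receives at least half of its mass from \<open>A\<close>, so
  the smaller flow into it is half of the original flow from the complement.  The overlap is
  thus half of the sum of the flows from \<open>A\<close> to its complement and back, and both are at least \<open>d\<close>.  In the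
  reversed chain these two flows are exchanged.
\<close>

lemma lazy_expanding:
  assumes d: "0 < d" and two: "2 \<le> card V"
    and cut: "\<And>A. A \<subseteq> V \<Longrightarrow> A \<noteq> {} \<Longrightarrow> A \<noteq> V \<Longrightarrow> d \<le> (\<Sum>x\<in>A. \<Sum>y\<in>V - A. \<pi> x * P x y)"
  shows "expanding_chain V (lazy_kernel P) \<pi> d" "expanding_chain V (reversal \<pi> (lazy_kernel P)) \<pi> d"
proof -
  interpret lz: stationary_chain V "lazy_kernel P" \<pi> by (rule lazy_chain)
  interpret rev: stationary_chain V "reversal \<pi> (lazy_kernel P)" \<pi> by (rule lz.reversal_chain)
  have half: "d \<le> (\<Sum>y\<in>V. min (g A y) (g (V - A) y))"
    if g: "\<And>A y. A \<subseteq> V \<Longrightarrow> y \<in> V \<Longrightarrow> g A y = ((if y \<in> A then \<pi> y else 0) + h A y) / 2"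
      and h: "\<And>A y. A \<subseteq> V \<Longrightarrow> y \<in> V \<Longrightarrow> 0 \<le> h A y" "\<And>A y. A \<subseteq> V \<Longrightarrow> y \<in> V \<Longrightarrow> h A y \<le> \<pi> y"
      and cut: "d \<le> (\<Sum>y\<in>A. h (V - A) y)" "d \<le> (\<Sum>y\<in>V - A. h A y)"
      and A: "A \<subseteq> V" for g h :: "'a set \<Rightarrow> 'a \<Rightarrow> real" and A
  proof -
    have "(\<Sum>y\<in>V. min (g A y) (g (V - A) y)) = (\<Sum>y\<in>V - A. min (g A y) (g (V - A) y)) + (\<Sum>y\<in>A. min (g A y) (g (V - A) y))"
      by (rule sum.subset_diff[OF A finite_V])
    also have "(\<Sum>y\<in>V - A. min (g A y) (g (V - A) y)) = (\<Sum>y\<in>V - A. h A y / 2)"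
    proof (intro sum.cong refl)
      fix y assume y: "y \<in> V - A"
      then show "min (g A y) (g (V - A) y) = h A y / 2"
        using g[of A y] g[of "V - A" y] h(2)[of A y] h(1)[of "V - A" y] A by (simp add: min_def)
    qed
    also have "(\<Sum>y\<in>A. min (g A y) (g (V - A) y)) = (\<Sum>y\<in>A. h (V - A) y / 2)"
    proof (intro sum.cong refl)
      fix y assume y: "y \<in> A"
      then show "min (g A y) (g (V - A) y) = h (V - A) y / 2"
        using g[of A y] g[of "V - A" y] h(2)[of "V - A" y] h(1)[of A y] A by (auto simp: min_def)
    qed
    finally show ?thesis using cut by (simp flip: sum_divide_distrib)
  qed
  have swapped: "d \<le> (\<Sum>y\<in>V - A. flow A y)" "d \<le> (\<Sum>y\<in>A. flow (V - A) y)"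
    if "A \<subseteq> V" "A \<noteq> {}" "A \<noteq> V" for A
  proof -
    have f: "(\<Sum>y\<in>B. flow A y) = (\<Sum>x\<in>A. \<Sum>y\<in>B. \<pi> x * P x y)" for A B
      unfolding flow_def by (rule sum.swap)
    have "V - (V - A) = A" using that by blast
    then show "d \<le> (\<Sum>y\<in>V - A. flow A y)" "d \<le> (\<Sum>y\<in>A. flow (V - A) y)"
      unfolding f using cut[of A] cut[of "V - A"] that by auto
  qed
  have outgoing: "d \<le> (\<Sum>y\<in>A. \<Sum>x\<in>V - A. \<pi> y * P y x)" "d \<le> (\<Sum>y\<in>V - A. \<Sum>x\<in>A. \<pi> y * P y x)"
    if "A \<subseteq> V" "A \<noteq> {}" "A \<noteq> V" for A
  proof -
    have "V - (V - A) = A" using that by blast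
    then show "d \<le> (\<Sum>y\<in>A. \<Sum>x\<in>V - A. \<pi> y * P y x)" "d \<le> (\<Sum>y\<in>V - A. \<Sum>x\<in>A. \<pi> y * P y x)"
      using cut[of A] cut[of "V - A"] that by auto
  qed
  have lzflow: "lz.flow A y = ((if y \<in> A then \<pi> y else 0) + flow A y) / 2" if "A \<subseteq> V" for A y
  proof -
    have "lz.flow A y = (\<Sum>x\<in>A. (if x = y then \<pi> x else 0) + \<pi> x * P x y) / 2"
      unfolding lz.flow_def sum_divide_distrib by (intro sum.cong) (auto simp: lazy_kernel_def algebra_simps)
    then show ?thesis using finite_subset_V[OF that] by (simp add: flow_def sum.distrib)
  qed
  have revflow: "rev.flow A y = ((if y \<in> A then \<pi> y else 0) + (\<Sum>x\<in>A. \<pi> y * P y x)) / 2" if "A \<subseteq> V" for A y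
  proof -
    have "rev.flow A y = (\<Sum>x\<in>A. (if x = y then \<pi> y else 0) + \<pi> y * P y x) / 2"
      unfolding lz.flow_reversal[OF that] sum_divide_distrib
      by (intro sum.cong) (auto simp: lazy_kernel_def algebra_simps)
    then show ?thesis using finite_subset_V[OF that] by (simp add: sum.distrib)
  qed
  show "expanding_chain V (lazy_kernel P) \<pi> d"
  proof
    fix A assume "A \<subseteq> V" "A \<noteq> {}" "A \<noteq> V"
    then show "d \<le> lz.overlap A"
      unfolding lz.overlap_def
      by (intro half[where h = flow] lzflow flow_nonneg flow_le swapped) auto
  qed (use d two in auto)
  show "expanding_chain V (reversal \<pi> (lazy_kernel P)) \<pi> d"
  proof
    interpret r: stationary_chain V "reversal \<pi> P" \<pi> by (rule reversal_chain)
    fix A assume A: "A \<subseteq> V" "A \<noteq> {}" "A \<noteq> V"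
    show "d \<le> rev.overlap A"
      unfolding rev.overlap_def
    proof (intro half[where h = "\<lambda>A y. \<Sum>x\<in>A. \<pi> y * P y x"] revflow outgoing)
      show "(\<Sum>x\<in>B. \<pi> y * P y x) \<le> \<pi> y" if "B \<subseteq> V" "y \<in> V" for B y
        using r.flow_le[OF that] by (simp only: flow_reversal[OF that(1)])
      show "0 \<le> (\<Sum>x\<in>B. \<pi> y * P y x)" if "B \<subseteq> V" "y \<in> V" for B y
        using r.flow_nonneg[OF that] by (simp only: flow_reversal[OF that(1)])
    qed (use A in auto)
  qed (use d two in auto)
qed

lemma spectral_gap_ge:
  assumes two: "2 \<le> card V" and irred: "\<And>x y. x \<in> V \<Longrightarrow> y \<in> V \<Longrightarrow> \<exists>t. 0 < kernel_pow V P t x y"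
    and poincare: "\<And>f. c * variance_on V \<pi> f \<le> dirichlet_form V \<pi> P f"
  shows "c \<le> spectral_gap V P \<pi>"
proof -
  have "spectral_gap V P \<pi> = (INF f\<in>{f. variance_on V \<pi> f \<noteq> 0}. dirichlet_form V \<pi> P f / variance_on V \<pi> f)"
    by (rule spectral_gap_variational[OF finite_V two stat_pos stat_sum P_nonneg P_row stat_eq irred])
  also have "\<dots> \<ge> c"
  proof (rule cINF_greatest)
    obtain f where "variance_on V \<pi> f = 1"
      by (rule rayleigh_minimizer[OF finite_V two stat_pos stat_sum])
    then show "{f. variance_on V \<pi> f \<noteq> 0} \<noteq> {}" by force
  next
    fix f assume "f \<in> {f. variance_on V \<pi> f \<noteq> 0}"
    moreover have "0 \<le> variance_on V \<pi> f"
      unfolding variance_on_dirichlet by (rule dirichlet_form_nonneg) (auto intro: stat_nonneg)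
    ultimately have "0 < variance_on V \<pi> f" by simp
    then show "c \<le> dirichlet_form V \<pi> P f / variance_on V \<pi> f"
      using poincare[of f] by (simp add: pos_le_divide_eq)
  qed
  finally show ?thesis .
qed

lemma dirichlet_form_lazy: "dirichlet_form V \<pi> (lazy_kernel P) f = dirichlet_form V \<pi> P f / 2"
proof -
  have "(\<Sum>x\<in>V. \<Sum>y\<in>V. (f x - f y)\<^sup>2 * \<pi> x * lazy_kernel P x y) = (\<Sum>x\<in>V. \<Sum>y\<in>V. (f x - f y)\<^sup>2 * \<pi> x * P x y / 2)"
    by (intro sum.cong refl) (auto simp: lazy_kernel_def)
  then show ?thesis unfolding dirichlet_form_def by (simp flip: sum_divide_distrib)
qed

end

section \<open>The Wirtinger inequality on a cycle\<close>

text \<open>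
  For \<open>j \<noteq> l\<close> this is a geometric sum with an \<open>n\<close>-th root of unity other than \<open>1\<close> as its ratio.
\<close>

lemma roots_of_unity_orthogonal:
  assumes "j < n" "l < n"
  shows "(\<Sum>k<n. cis (2 * pi * (real j - real l) * real k / real n)) = (if j = l then of_nat n else 0)"
proof (cases "j = l")
  case False
  define u where "u = cis (2 * pi * (real j - real l) / real n)"
  have n: "0 < n" using assms by simp
  have "real n * (2 * pi * (real j - real l) / real n) = 2 * pi * (real j - real l)"
    using n by simp
  then have "u ^ n = cis (2 * pi * (real j - real l))"
    unfolding u_def Complex.DeMoivre by (rule arg_cong)
  also have "\<dots> = cis (2 * pi * of_int (int j - int l))" by simp
  also have "\<dots> = 1" by (rule cis_multiple_2pi) simp
  finally have un: "u ^ n = 1" .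
  have "u \<noteq> 1"
  proof
    assume "u = 1"
    then have "cos (2 * pi * (real j - real l) / real n) = 1" by (simp add: u_def complex_eq_iff)
    then obtain i :: int where "2 * pi * (real j - real l) / real n = of_int i * 2 * pi"
      unfolding cos_one_2pi_int by blast
    then have "(2 * pi) * (real j - real l) = (2 * pi) * (of_int i * real n)"
      using n by (simp add: field_simps)
    then have "real j - real l = of_int i * real n" by (rule mult_left_cancel[THEN iffD1, rotated]) simp
    then have "of_int (int j - int l) = (of_int (i * int n) :: real)" by simp
    then have eq: "int j - int l = i * int n" by (simp only: of_int_eq_iff)
    moreover have "\<bar>int j - int l\<bar> < int n" using assms by simp
    ultimately have "\<bar>i\<bar> * int n < 1 * int n" by (simp add: abs_mult)
    then have "i = 0" using n by (simp only: mult_less_cancel_right) auto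
    with eq False show False by simp
  qed
  have "(\<Sum>k<n. cis (2 * pi * (real j - real l) * real k / real n)) = (\<Sum>k<n. u ^ k)"
    unfolding u_def Complex.DeMoivre by (intro sum.cong refl arg_cong[of _ _ cis]) simp
  also have "\<dots> = 0" using \<open>u \<noteq> 1\<close> un by (simp add: geometric_sum)
  finally show ?thesis using False by simp
qed simp

definition fourier :: "nat \<Rightarrow> (nat \<Rightarrow> real) \<Rightarrow> nat \<Rightarrow> complex" where
  "fourier n h k = (\<Sum>j<n. of_real (h j) * cis (2 * pi * real j * real k / real n))"

lemma parseval: "(\<Sum>k<n. (cmod (fourier n h k))\<^sup>2) = real n * (\<Sum>j<n. (h j)\<^sup>2)"
proof -
  have "complex_of_real (\<Sum>k<n. (cmod (fourier n h k))\<^sup>2) = (\<Sum>k<n. fourier n h k * cnj (fourier n h k))"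
    unfolding of_real_sum complex_norm_square ..
  also have "\<dots> = (\<Sum>k<n. \<Sum>j<n. \<Sum>l<n. of_real (h j * h l) * cis (2 * pi * (real j - real l) * real k / real n))"
  proof (intro sum.cong refl)
    fix k
    have e: "cis (2 * pi * real j * real k / real n) * cnj (cis (2 * pi * real l * real k / real n))
        = cis (2 * pi * (real j - real l) * real k / real n)" for j l
      unfolding cis_cnj cis_mult by (intro arg_cong[of _ _ cis]) (simp add: algebra_simps diff_divide_distrib)
    have "of_real (h j) * cis (2 * pi * real j * real k / real n)
          * cnj (of_real (h l) * cis (2 * pi * real l * real k / real n))
        = of_real (h j * h l) * cis (2 * pi * (real j - real l) * real k / real n)" for j l
      unfolding e[symmetric] by simp
    then show "fourier n h k * cnj (fourier n h k)
        = (\<Sum>j<n. \<Sum>l<n. of_real (h j * h l) * cis (2 * pi * (real j - real l) * real k / real n))"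
      unfolding fourier_def cnj_sum sum_product by (simp only:)
  qed
  also have "\<dots> = (\<Sum>j<n. \<Sum>l<n. of_real (h j * h l) * (\<Sum>k<n. cis (2 * pi * (real j - real l) * real k / real n)))"
    unfolding sum_distrib_left by (subst sum.swap, subst (2) sum.swap) (rule refl)
  also have "\<dots> = (\<Sum>j<n. \<Sum>l<n. of_real (h j * h l) * (if j = l then of_nat n else 0))"
    by (intro sum.cong refl) (simp add: roots_of_unity_orthogonal)
  also have "\<dots> = of_real (real n * (\<Sum>j<n. (h j)\<^sup>2))"
    by (simp add: if_distrib[of "\<lambda>t. _ * t"] power2_eq_square sum_distrib_left mult_ac cong: if_cong)
  finally show ?thesis by (simp only: of_real_eq_iff)
qed

lemma fourier_shift:
  assumes "0 < n"
  shows "fourier n h k = cis (2 * pi * real k / real n) * fourier n (\<lambda>j. h (Suc j mod n)) k"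
proof -
  have bij: "bij_betw (\<lambda>j. Suc j mod n) {..<n} {..<n}"
  proof (rule bij_betw_byWitness[where f' = "\<lambda>j. (j + (n - 1)) mod n"])
    have "(Suc j mod n + (n - 1)) mod n = j" if "j < n" for j
      using that assms by (cases "Suc j = n") auto
    then show "\<forall>j\<in>{..<n}. (Suc j mod n + (n - 1)) mod n = j" by simp
    show "\<forall>j\<in>{..<n}. Suc ((j + (n - 1)) mod n) mod n = j"
      using assms by (auto simp: mod_Suc_eq)
  qed (use assms in auto)
  have periodic: "cis (2 * pi * real (Suc j mod n) * real k / real n) = cis (2 * pi * real (Suc j) * real k / real n)" for j
  proof -
    have "real (Suc j) = real n * real (Suc j div n) + real (Suc j mod n)"
      by (metis mult_div_mod_eq of_nat_add of_nat_mult)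
    then have "2 * pi * real (Suc j) * real k / real n
        = 2 * pi * real (Suc j mod n) * real k / real n + 2 * pi * real (Suc j div n * k)"
      using assms by (simp add: field_simps)
    moreover have "cis (2 * pi * real (Suc j div n * k)) = 1"
      by (rule cis_multiple_2pi) simp
    ultimately show ?thesis by (simp only: cis_mult[symmetric]) simp
  qed
  have "fourier n h k = (\<Sum>j<n. of_real (h (Suc j mod n)) * cis (2 * pi * real (Suc j mod n) * real k / real n))"
    unfolding fourier_def by (rule sum.reindex_bij_betw[OF bij, symmetric])
  also have "\<dots> = (\<Sum>j<n. cis (2 * pi * real k / real n) * (of_real (h (Suc j mod n)) * cis (2 * pi * real j * real k / real n)))"
  proof (intro sum.cong refl)
    fix j
    have "cis (2 * pi * real (Suc j) * real k / real n)
        = cis (2 * pi * real k / real n) * cis (2 * pi * real j * real k / real n)"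
      unfolding cis_mult by (intro arg_cong[of _ _ cis]) (simp add: field_simps add_divide_distrib)
    then show "of_real (h (Suc j mod n)) * cis (2 * pi * real (Suc j mod n) * real k / real n)
        = cis (2 * pi * real k / real n) * (of_real (h (Suc j mod n)) * cis (2 * pi * real j * real k / real n))"
      unfolding periodic by simp
  qed
  finally show ?thesis by (simp add: fourier_def sum_distrib_left)
qed

lemma cos_roots_of_unity_le:
  assumes "0 < k" "k < n"
  shows "cos (2 * pi * real k / real n) \<le> cos (2 * pi / real n)"
proof -
  have n: "0 < real n" using assms by simp
  have small: "cos (2 * pi * real i / real n) \<le> cos (2 * pi / real n)" if "1 \<le> i" "2 * i \<le> n" for i
  proof (rule cos_monotone_0_pi_le)
    have "2 * real i \<le> real n" using that(2) by (metis of_nat_le_iff of_nat_mult of_nat_numeral)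
    then have "pi * (2 * real i) \<le> pi * real n" by (intro mult_left_mono) auto
    then show "2 * pi * real i / real n \<le> pi" using n by (simp add: field_simps)
    show "2 * pi / real n \<le> 2 * pi * real i / real n"
      using that n by (intro divide_right_mono) auto
  qed simp
  show ?thesis
  proof (cases "2 * k \<le> n")
    case True
    then show ?thesis using small[of k] assms by simp
  next
    case False
    have "2 * pi * real k / real n = 2 * pi - 2 * pi * real (n - k) / real n"
      using assms by (simp add: of_nat_diff field_simps)
    then have "cos (2 * pi * real k / real n) = cos (2 * pi * real (n - k) / real n)"
      by (simp add: cos_diff)
    then show ?thesis using small[of "n - k"] False assms by simp
  qed
qed

text \<open>
  Up to a factor of modulus \<open>1\<close>, the Fourier coefficient of the difference at frequency \<open>k\<close> is the one of
  \<open>h\<close> times \<open>z - 1\<close> with \<open>z\<close> the corresponding root of unity, and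
  \<open>\<bar>z - 1\<bar>\<^sup>2 = 2 (1 - cos (2 pi k / n))\<close>.  Frequency \<open>0\<close> is absent since \<open>h\<close> has mean zero, and among the
  others the factor is smallest for \<open>k = 1\<close>.
\<close>

lemma discrete_wirtinger:
  fixes h :: "nat \<Rightarrow> real"
  assumes n: "0 < n" and mean: "(\<Sum>j<n. h j) = 0"
  shows "2 * (1 - cos (2 * pi / real n)) * (\<Sum>j<n. (h j)\<^sup>2) \<le> (\<Sum>j<n. (h j - h (Suc j mod n))\<^sup>2)"
proof -
  let ?D = "\<lambda>j. h j - h (Suc j mod n)"
  let ?c = "2 * (1 - cos (2 * pi / real n))"
  have "?c * (cmod (fourier n h k))\<^sup>2 \<le> (cmod (fourier n ?D k))\<^sup>2" if k: "k < n" for k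
  proof (cases "k = 0")
    case True
    then have "fourier n h k = of_real (\<Sum>j<n. h j)" by (simp add: fourier_def)
    then show ?thesis using mean by simp
  next
    case False
    define z where "z = cis (2 * pi * real k / real n)"
    let ?H = "fourier n (\<lambda>j. h (Suc j mod n)) k"
    have H: "fourier n h k = z * ?H" unfolding z_def by (rule fourier_shift[OF n])
    have "fourier n ?D k = fourier n h k - ?H"
      by (simp add: fourier_def left_diff_distrib sum_subtractf)
    also have "\<dots> = (z - 1) * ?H" unfolding H by (simp add: algebra_simps)
    finally have D: "(cmod (fourier n ?D k))\<^sup>2 = (cmod (z - 1))\<^sup>2 * (cmod ?H)\<^sup>2"
      by (simp add: norm_mult power_mult_distrib)
    have "(cmod (z - 1))\<^sup>2 = 2 * (1 - cos (2 * pi * real k / real n))"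
      using sin_cos_squared_add[of "2 * pi * real k / real n"]
      unfolding z_def cmod_power2 by (simp add: power2_eq_square algebra_simps)
    also have "\<dots> \<ge> ?c" using cos_roots_of_unity_le[of k n] k False by simp
    finally have "?c * (cmod ?H)\<^sup>2 \<le> (cmod (z - 1))\<^sup>2 * (cmod ?H)\<^sup>2" by (intro mult_right_mono) auto
    then show ?thesis unfolding D unfolding H by (simp add: norm_mult z_def)
  qed
  then have "(\<Sum>k<n. ?c * (cmod (fourier n h k))\<^sup>2) \<le> (\<Sum>k<n. (cmod (fourier n ?D k))\<^sup>2)"
    by (intro sum_mono) auto
  then have "real n * (?c * (\<Sum>j<n. (h j)\<^sup>2)) \<le> real n * (\<Sum>j<n. (?D j)\<^sup>2)"
    unfolding sum_distrib_left[symmetric] parseval by (simp add: mult_ac)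
  then show ?thesis using n by simp
qed

section \<open>The simple random walk on an Eulerian digraph\<close>

locale eulerian_walk = fin_digraph G for G :: "('a, 'b) pre_digraph" +
  assumes strong: "strongly_connected G"
    and balanced: "\<And>x. x \<in> verts G \<Longrightarrow> in_degree G x = out_degree G x"
    and two_verts: "2 \<le> card (verts G)"
begin

definition arc_mult :: "'a \<Rightarrow> 'a \<Rightarrow> nat" where
  "arc_mult x y = card {e \<in> arcs G. tail G e = x \<and> head G e = y}"

definition arc_count :: real where "arc_count = real (card (arcs G))"

lemma sum_arcs: "(\<Sum>x\<in>verts G. \<Sum>y\<in>verts G. f x y * real (arc_mult x y)) = (\<Sum>e\<in>arcs G. f (tail G e) (head G e))"
proof -
  have "(\<Sum>e\<in>arcs G. f (tail G e) (head G e))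
      = (\<Sum>x\<in>verts G. \<Sum>e\<in>{e \<in> arcs G. tail G e = x}. f (tail G e) (head G e))"
    by (rule sum.group[symmetric]) auto
  also have "\<dots> = (\<Sum>x\<in>verts G. \<Sum>y\<in>verts G. \<Sum>e\<in>{e \<in> {e \<in> arcs G. tail G e = x}. head G e = y}. f (tail G e) (head G e))"
    by (intro sum.cong refl sum.group[symmetric]) auto
  also have "\<dots> = (\<Sum>x\<in>verts G. \<Sum>y\<in>verts G. f x y * real (arc_mult x y))"
  proof (intro sum.cong refl)
    fix x y
    have "{e \<in> {e \<in> arcs G. tail G e = x}. head G e = y} = {e \<in> arcs G. tail G e = x \<and> head G e = y}" by auto
    then have "(\<Sum>e\<in>{e \<in> {e \<in> arcs G. tail G e = x}. head G e = y}. f (tail G e) (head G e))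
        = (\<Sum>e\<in>{e \<in> arcs G. tail G e = x \<and> head G e = y}. f x y)"
      by (intro sum.cong) auto
    then show "(\<Sum>e\<in>{e \<in> {e \<in> arcs G. tail G e = x}. head G e = y}. f (tail G e) (head G e)) = f x y * real (arc_mult x y)"
      by (simp add: arc_mult_def mult.commute)
  qed
  finally show ?thesis ..
qed

lemma out_degree_arc_mult: "x \<in> verts G \<Longrightarrow> (\<Sum>y\<in>verts G. real (arc_mult x y)) = real (out_degree G x)"
proof -
  assume x: "x \<in> verts G"
  have "(\<Sum>y\<in>verts G. real (arc_mult x y)) = (\<Sum>u\<in>verts G. \<Sum>y\<in>verts G. (if u = x then 1 else 0) * real (arc_mult u y))"
    using x by (subst sum.remove[of _ x]) (auto intro!: sum.neutral)
  also have "\<dots> = (\<Sum>e\<in>arcs G. if tail G e = x then 1 else 0)"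
    by (rule sum_arcs)
  also have "\<dots> = real (out_degree G x)"
    by (simp add: out_degree_def out_arcs_def Collect_conj_eq flip: sum.inter_filter)
  finally show ?thesis .
qed

lemma in_degree_arc_mult: "y \<in> verts G \<Longrightarrow> (\<Sum>x\<in>verts G. real (arc_mult x y)) = real (out_degree G y)"
proof -
  assume y: "y \<in> verts G"
  have "(\<Sum>x\<in>verts G. real (arc_mult x y)) = (\<Sum>x\<in>verts G. \<Sum>u\<in>verts G. (if u = y then 1 else 0) * real (arc_mult x u))"
    using y by (intro sum.cong refl, subst sum.remove[of _ y]) (auto intro!: sum.neutral)
  also have "\<dots> = (\<Sum>e\<in>arcs G. if head G e = y then 1 else 0)"
    by (rule sum_arcs)
  also have "\<dots> = real (in_degree G y)"
    by (simp add: in_degree_def in_arcs_def Collect_conj_eq flip: sum.inter_filter)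
  finally show ?thesis using balanced[OF y] by simp
qed

lemma crossing_arc:
  assumes "A \<subseteq> verts G" "A \<noteq> {}" "A \<noteq> verts G"
  obtains e where "e \<in> arcs G" "tail G e \<in> A" "head G e \<in> verts G - A"
proof -
  obtain u v where uv: "u \<in> A" "v \<in> verts G - A" using assms by blast
  then have "u \<rightarrow>\<^sup>*\<^bsub>G\<^esub> v" using strong assms by (auto simp: strongly_connected_def)
  then obtain p where p: "awalk u p v" by (auto simp: reachable_awalk)
  have "p \<noteq> []" using p uv by (auto simp: awalk_Nil_iff)
  with p have "\<exists>e\<in>set p. tail G e \<in> A \<and> head G e \<in> verts G - A"
    using uv by (intro awalk_vertex_props[where P = "\<lambda>w. w \<in> A"]) (auto dest: awalk_verts_in_verts[rotated 2])
  with p that show thesis by auto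
qed

lemma out_degree_pos: "x \<in> verts G \<Longrightarrow> 0 < out_degree G x"
proof -
  assume x: "x \<in> verts G"
  have "{x} \<noteq> verts G"
  proof
    assume "{x} = verts G"
    from this[symmetric] two_verts show False by simp
  qed
  then obtain e where "e \<in> arcs G" "tail G e = x"
    using crossing_arc[of "{x}"] x by blast
  then show "0 < out_degree G x" unfolding out_degree_def by (auto simp: card_gt_0_iff)
qed

lemma arc_count_pos: "0 < arc_count"
proof -
  obtain x where "x \<in> verts G" using two_verts by fastforce
  then have "out_arcs G x \<noteq> {}" using out_degree_pos[of x] by (auto simp: out_degree_def)
  then have "arcs G \<noteq> {}" by auto
  then show ?thesis by (simp add: arc_count_def card_gt_0_iff)
qed

lemma arc_flow: "x \<in> verts G \<Longrightarrow> srw_stat G x * srw G x y = real (arc_mult x y) / arc_count"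
  using out_degree_pos[of x] by (simp add: srw_stat_def srw_def arc_mult_def arc_count_def)

sublocale srw: stationary_chain "verts G" "srw G" "srw_stat G"
proof
  show "0 < srw_stat G x" if "x \<in> verts G" for x
    using out_degree_pos[OF that] arc_count_pos by (simp add: srw_stat_def arc_count_def)
  show "sum (srw_stat G) (verts G) = 1"
  proof -
    have "sum (srw_stat G) (verts G) = (\<Sum>x\<in>verts G. \<Sum>y\<in>verts G. 1 * real (arc_mult x y)) / arc_count"
      by (simp add: srw_stat_def arc_count_def out_degree_arc_mult flip: sum_divide_distrib)
    also have "\<dots> = arc_count / arc_count" unfolding sum_arcs by (simp add: arc_count_def)
    also have "\<dots> = 1" using arc_count_pos by simp
    finally show ?thesis .
  qed
  show "(\<Sum>y\<in>verts G. srw G x y) = 1" if "x \<in> verts G" for x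
    using out_degree_arc_mult[OF that] out_degree_pos[OF that]
    by (simp add: srw_def arc_mult_def flip: sum_divide_distrib)
  show "(\<Sum>x\<in>verts G. srw_stat G x * srw G x y) = srw_stat G y" if "y \<in> verts G" for y
  proof -
    have "(\<Sum>x\<in>verts G. srw_stat G x * srw G x y) = (\<Sum>x\<in>verts G. real (arc_mult x y)) / arc_count"
      unfolding sum_divide_distrib by (intro sum.cong refl arc_flow)
    then show ?thesis using in_degree_arc_mult[OF that] by (simp add: srw_stat_def arc_count_def)
  qed
qed (auto simp: srw_def)

lemma srw_arc: "e \<in> arcs G \<Longrightarrow> 0 < srw G (tail G e) (head G e)"
proof -
  assume e: "e \<in> arcs G"
  then have "0 < card {a \<in> arcs G. tail G a = tail G e \<and> head G a = head G e}"
    by (auto simp: card_gt_0_iff)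
  then show ?thesis using out_degree_pos[of "tail G e"] e by (simp add: srw_def)
qed

lemma arc_flow_ge:
  assumes "x \<in> verts G" "y \<in> verts G" "0 < srw G x y"
  shows "1 / arc_count \<le> srw_stat G x * srw G x y"
proof -
  have "0 < arc_mult x y" using assms(3) by (auto simp: srw_def arc_mult_def zero_less_divide_iff)
  then show ?thesis unfolding arc_flow[OF assms(1)] using arc_count_pos by (intro divide_right_mono) auto
qed

text \<open>
  For a general kernel on the vertices, as it is applied to the walk and to the lazy walk.
\<close>

lemma irreducible:
  assumes K: "\<And>x y. x \<in> verts G \<Longrightarrow> y \<in> verts G \<Longrightarrow> 0 \<le> K x y"
    and arc: "\<And>e. e \<in> arcs G \<Longrightarrow> 0 < K (tail G e) (head G e)"
    and xy: "x \<in> verts G" "y \<in> verts G"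
  shows "\<exists>t. 0 < kernel_pow (verts G) K t x y"
proof -
  have "0 < kernel_pow (verts G) K (length p) x y" if "awalk x p y" for p x
    using that
  proof (induction p arbitrary: x)
    case Nil
    then show ?case by (simp add: awalk_Nil_iff)
  next
    case (Cons e p)
    then have e: "e \<in> arcs G" "tail G e = x" "awalk (head G e) p y" by (auto simp: awalk_Cons_iff)
    have y: "y \<in> verts G" using e(3) by auto
    have "0 < (\<Sum>z\<in>verts G. K x z * kernel_pow (verts G) K (length p) z y)"
    proof (rule sum_pos2[of _ "head G e"])
      show "0 < K x (head G e) * kernel_pow (verts G) K (length p) (head G e) y"
        using arc[OF e(1)] e Cons.IH[OF e(3)] by simp
      show "0 \<le> K x z * kernel_pow (verts G) K (length p) z y" if "z \<in> verts G" for z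
        using e that y K by (intro mult_nonneg_nonneg kernel_pow_nonneg K) auto
    qed (use e in auto)
    then show ?case by simp
  qed
  moreover obtain p where "awalk x p y"
    using strong xy by (auto simp: strongly_connected_def reachable_awalk)
  ultimately show ?thesis by blast
qed

lemma cut_ge:
  assumes "A \<subseteq> verts G" "A \<noteq> {}" "A \<noteq> verts G"
  shows "1 / arc_count \<le> (\<Sum>x\<in>A. \<Sum>y\<in>verts G - A. srw_stat G x * srw G x y)"
proof -
  obtain e where e: "e \<in> arcs G" "tail G e \<in> A" "head G e \<in> verts G - A" by (rule crossing_arc[OF assms])
  have fin: "finite A" by (rule srw.finite_subset_V[OF assms(1)])
  have nn: "0 \<le> srw_stat G x * srw G x y" for x y by (simp add: srw_stat_def srw_def)
  have "1 / arc_count \<le> srw_stat G (tail G e) * srw G (tail G e) (head G e)"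
    using e by (intro arc_flow_ge srw_arc) auto
  also have "\<dots> \<le> (\<Sum>y\<in>verts G - A. srw_stat G (tail G e) * srw G (tail G e) y)"
    using e nn by (intro member_le_sum) auto
  also have "\<dots> \<le> (\<Sum>x\<in>A. \<Sum>y\<in>verts G - A. srw_stat G x * srw G x y)"
    using e nn fin by (intro member_le_sum[where f = "\<lambda>x. \<Sum>y\<in>verts G - A. srw_stat G x * srw G x y"] sum_nonneg) auto
  finally show ?thesis .
qed

text \<open>
  An Eulerian circuit, as a cyclic enumeration of the arcs in which each arc starts where its predecessor
  ends.
\<close>

lemma arc_cycle:
  obtains p where "distinct p" "set p = arcs G" "length p = card (arcs G)"
    "\<And>i. i < length p \<Longrightarrow> head G (p ! i) = tail G (p ! (Suc i mod length p))"
proof -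
  have "connected G"
    using strong by (auto simp: connected_def strongly_connected_def intro: reachable_mk_symmetricI)
  then obtain u p where "euler_trail u p u" using closed_euler1 balanced by blast
  then have p: "cas u p u" "distinct p" "set p = arcs G" by (auto simp: euler_trail_def trail_def)
  have links: "tail G (p ! 0) = u \<and> (\<forall>i<length p. head G (p ! i) = (if Suc i < length p then tail G (p ! Suc i) else v))"
    if "cas u p v" "p \<noteq> []" for u v p
    using that
  proof (induction p arbitrary: u)
    case (Cons e p)
    show ?case
    proof (cases "p = []")
      case True
      then show ?thesis using Cons.prems by auto
    next
      case False
      with Cons have IH: "tail G (p ! 0) = head G e"
        "\<And>i. i < length p \<Longrightarrow> head G (p ! i) = (if Suc i < length p then tail G (p ! Suc i) else v)"
        by auto
      show ?thesis
      proof (intro conjI allI impI)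
        show "tail G ((e # p) ! 0) = u" using Cons.prems by simp
        fix i assume "i < length (e # p)"
        then show "head G ((e # p) ! i) = (if Suc i < length (e # p) then tail G ((e # p) ! Suc i) else v)"
          using IH False by (cases i) auto
      qed
    qed
  qed simp
  show thesis
  proof (rule that[OF p(2,3)])
    show "length p = card (arcs G)" using p distinct_card by fastforce
    fix i assume i: "i < length p"
    then have "p \<noteq> []" by auto
    then show "head G (p ! i) = tail G (p ! (Suc i mod length p))"
      using links[OF p(1)] i by (cases "Suc i = length p") auto
  qed
qed

text \<open>
  Along an Eulerian circuit \<open>p\<close> a vertex appears as a tail as often as its out-degree says, so the values
  of \<open>f\<close> at the tails of \<open>p\<close>, with the uniform distribution on the positions, have the distribution of \<open>f\<close>
  under \<open>\<pi>\<close>.  The increments of this cyclic sequence are those of \<open>f\<close> along the arcs.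
\<close>

lemma poincare: "(1 - cos (2 * pi / arc_count)) * variance_on (verts G) (srw_stat G) f \<le> dirichlet_form (verts G) (srw_stat G) (srw G) f"
proof -
  let ?V = "verts G" and ?\<pi> = "srw_stat G"
  obtain p where p: "distinct p" "set p = arcs G" "length p = card (arcs G)"
    "\<And>i. i < length p \<Longrightarrow> head G (p ! i) = tail G (p ! (Suc i mod length p))"
    by (rule arc_cycle) blast
  let ?n = "length p"
  have n: "0 < ?n" "arc_count = real ?n" using p(3) arc_count_pos by (auto simp: arc_count_def)
  have along: "(\<Sum>i<?n. \<phi> (p ! i)) = (\<Sum>e\<in>arcs G. \<phi> e)" for \<phi> :: "'b \<Rightarrow> real"
    by (rule sum.reindex_bij_betw) (rule bij_betw_nth[OF p(1) refl p(2)[symmetric]])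
  have stat: "(\<Sum>x\<in>?V. ?\<pi> x * \<phi> x) = (\<Sum>i<?n. \<phi> (tail G (p ! i))) / arc_count" for \<phi>
  proof -
    have "(\<Sum>x\<in>?V. ?\<pi> x * \<phi> x) = (\<Sum>x\<in>?V. \<phi> x * real (out_degree G x)) / arc_count"
      by (simp add: srw_stat_def arc_count_def sum_divide_distrib mult.commute)
    also have "(\<Sum>x\<in>?V. \<phi> x * real (out_degree G x)) = (\<Sum>x\<in>?V. \<Sum>y\<in>?V. \<phi> x * real (arc_mult x y))"
      by (intro sum.cong refl) (simp add: out_degree_arc_mult flip: sum_distrib_left)
    finally show ?thesis unfolding sum_arcs along[symmetric] .
  qed
  define c where "c = (\<Sum>x\<in>?V. ?\<pi> x * f x)"
  define g where "g x = f x - c" for x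
  have g0: "(\<Sum>x\<in>?V. ?\<pi> x * g x) = 0"
    unfolding g_def right_diff_distrib sum_subtractf sum_distrib_right[symmetric] srw.stat_sum c_def by simp
  have "variance_on ?V ?\<pi> f = variance_on ?V ?\<pi> g" by (simp add: variance_on_def g_def)
  also have "\<dots> = (\<Sum>x\<in>?V. ?\<pi> x * (g x)\<^sup>2)"
    unfolding variance_on_dirichlet dirichlet_form_bilin
    by (subst covariance_eq) (auto simp: srw.stat_pos srw.stat_sum g0 power2_eq_square mult.assoc)
  finally have var: "variance_on ?V ?\<pi> f = (\<Sum>i<?n. (g (tail G (p ! i)))\<^sup>2) / arc_count"
    unfolding stat .
  have "dirichlet_form ?V ?\<pi> (srw G) f = 1/2 * ((\<Sum>x\<in>?V. \<Sum>y\<in>?V. (g x - g y)\<^sup>2 * real (arc_mult x y)) / arc_count)"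
    unfolding dirichlet_form_def sum_divide_distrib
    by (intro arg_cong[of _ _ "\<lambda>s. 1/2 * s"] sum.cong refl) (simp add: g_def mult.assoc arc_flow)
  also have "(\<Sum>x\<in>?V. \<Sum>y\<in>?V. (g x - g y)\<^sup>2 * real (arc_mult x y)) = (\<Sum>i<?n. (g (tail G (p ! i)) - g (head G (p ! i)))\<^sup>2)"
    unfolding sum_arcs along[of "\<lambda>e. (g (tail G e) - g (head G e))\<^sup>2"] ..
  also have "\<dots> = (\<Sum>i<?n. (g (tail G (p ! i)) - g (tail G (p ! (Suc i mod ?n))))\<^sup>2)"
    by (intro sum.cong refl) (simp add: p(4))
  finally have dir: "dirichlet_form ?V ?\<pi> (srw G) f
      = 1/2 * ((\<Sum>i<?n. (g (tail G (p ! i)) - g (tail G (p ! (Suc i mod ?n))))\<^sup>2) / arc_count)" .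
  have "(\<Sum>i<?n. g (tail G (p ! i))) = 0" using stat[of g] g0 arc_count_pos by simp
  from discrete_wirtinger[OF n(1) this]
  have "(1 - cos (2 * pi / arc_count)) * (\<Sum>i<?n. (g (tail G (p ! i)))\<^sup>2)
      \<le> 1/2 * (\<Sum>i<?n. (g (tail G (p ! i)) - g (tail G (p ! (Suc i mod ?n))))\<^sup>2)"
    unfolding n(2) mult.assoc by linarith
  from divide_right_mono[OF this less_imp_le[OF arc_count_pos]] show ?thesis
    unfolding var dir times_divide_eq_right .
qed

lemma srw_gap: "1 - cos (2 * pi / arc_count) \<le> spectral_gap (verts G) (srw G) (srw_stat G)"
  by (rule srw.spectral_gap_ge[OF two_verts irreducible poincare]) (auto intro: srw.P_nonneg srw_arc)

lemma lazy_srw_gap: "1/2 * (1 - cos (2 * pi / arc_count)) \<le> spectral_gap (verts G) (lazy_kernel (srw G)) (srw_stat G)"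
proof -
  interpret lz: stationary_chain "verts G" "lazy_kernel (srw G)" "srw_stat G" by (rule srw.lazy_chain)
  show ?thesis
  proof (rule lz.spectral_gap_ge[OF two_verts irreducible])
    show "0 < lazy_kernel (srw G) (tail G e) (head G e)" if "e \<in> arcs G" for e
      using srw_arc[OF that] by (cases "tail G e = head G e") (simp_all add: lazy_kernel_def)
    show "1/2 * (1 - cos (2 * pi / arc_count)) * variance_on (verts G) (srw_stat G) f
        \<le> dirichlet_form (verts G) (srw_stat G) (lazy_kernel (srw G)) f" for f
      using poincare[of f] by (simp add: srw.dirichlet_form_lazy)
  qed (auto intro: lz.P_nonneg)
qed

lemma lazy_srw_expanding:
  "expanding_chain (verts G) (lazy_kernel (srw G)) (srw_stat G) (1 / arc_count)"
  "expanding_chain (verts G) (reversal (srw_stat G) (lazy_kernel (srw G))) (srw_stat G) (1 / arc_count)"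
  using srw.lazy_expanding[OF _ two_verts cut_ge] arc_count_pos by simp_all

lemma srw_expanding:
  assumes ex: "\<And>A v. A \<subseteq> verts G \<Longrightarrow> sum (srw_stat G) A \<le> 1/2 \<Longrightarrow> v \<in> verts G \<Longrightarrow>
      sum (srw_stat G) A \<le> sum (srw_stat G) (out_nbhd (verts G) (srw G) A - {v})"
  shows "expanding_chain (verts G) (srw G) (srw_stat G) (2 / arc_count)"
    "expanding_chain (verts G) (reversal (srw_stat G) (srw G)) (srw_stat G) (2 / arc_count)"
proof -
  show *: "expanding_chain (verts G) (srw G) (srw_stat G) (2 / arc_count)"
  proof
    show "2 / arc_count \<le> srw.overlap A" if "A \<subseteq> verts G" "A \<noteq> {}" "A \<noteq> verts G" for A
      using srw.overlap_of_expansion[OF arc_flow_ge ex that] by simp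
  qed (use arc_count_pos two_verts in auto)
  interpret expanding_chain "verts G" "srw G" "srw_stat G" "2 / arc_count" by (rule *)
  interpret rev: stationary_chain "verts G" "reversal (srw_stat G) (srw G)" "srw_stat G" by (rule srw.reversal_chain)
  show "expanding_chain (verts G) (reversal (srw_stat G) (srw G)) (srw_stat G) (2 / arc_count)"
  proof
    show "2 / arc_count \<le> rev.overlap A" if "A \<subseteq> verts G" "A \<noteq> {}" "A \<noteq> verts G" for A
      using srw.reversal_overlap_of_expansion[OF _ arc_flow_ge ex _ that] single_measure(1) arc_count_pos by simp
  qed (use arc_count_pos two_verts in auto)
qed

end

section \<open>The bounds for Eulerian digraphs\<close>

lemma tau_inf_le_min: "tau_inf_le V P \<pi> \<epsilon> S \<Longrightarrow> tau_inf_le V P \<pi> \<epsilon> T \<Longrightarrow> tau_inf_le V P \<pi> \<epsilon> (min S T)"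
  unfolding tau_inf_le_def min_def by auto

theorem corollary1p1:
  fixes G :: "('a, 'b) pre_digraph" and m :: nat
  assumes "eulerian_digraph G"
    and "card (verts G) \<ge> 2"
    and "m = card (arcs G)"
  shows
    "spectral_gap (verts G) (srw G) (srw_stat G) \<ge> 1 - cos (2 * pi / real m)
     \<and>
     ((\<forall>A. A \<subseteq> verts G \<and> sum (srw_stat G) A \<le> 1/2 \<longrightarrow>
         (\<forall>v\<in>verts G. sum (srw_stat G) (out_nbhd (verts G) (srw G) A - {v}) \<ge> sum (srw_stat G) A))
      \<longrightarrow>
        (\<forall>\<mu>. complex_eigenvalue (verts G) (srw G) \<mu> \<and> \<mu> \<noteq> 1 \<longrightarrow>
            1 - cmod \<mu> \<ge> 1 - cos (2 * pi / real m))
        \<and>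
        (\<forall>\<epsilon>>0.
            tau_le (verts G) (srw G) (srw_stat G) \<epsilon>
              (inv_neg_log (cos (2 * pi / real m)) * ln ((1 - 2 / real m) / \<epsilon>))
            \<and>
            tau_inf_le (verts G) (srw G) (srw_stat G) \<epsilon>
              (if \<epsilon> \<le> 1
               then min (inv_neg_log (cos (2 * pi / real m)) * (ln ((real m - 2) / 2) + ln (1 / \<epsilon>)))
                        ((real m)\<^sup>2 / 6 + (real m)\<^sup>2 / 8 * ln (1 / \<epsilon>))
               else (real m)\<^sup>2 * ((1 + 3 * \<epsilon>) / (3 * (1 + \<epsilon>) ^ 3)))))
     \<and>
     (spectral_gap (verts G) (lazy_kernel (srw G)) (srw_stat G) \<ge> 1/2 * (1 - cos (2 * pi / real m))
      \<and>
      (\<forall>\<mu>. complex_eigenvalue (verts G) (lazy_kernel (srw G)) \<mu> \<and> \<mu> \<noteq> 1 \<longrightarrow>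
          1 - cmod \<mu> \<ge> 1 - cos (pi / real m))
      \<and>
      (\<forall>\<epsilon>>0.
          tau_le (verts G) (lazy_kernel (srw G)) (srw_stat G) \<epsilon>
            (inv_neg_log (cos (pi / real m)) * ln ((1 - 1 / real m) / \<epsilon>))
          \<and>
          tau_inf_le (verts G) (lazy_kernel (srw G)) (srw_stat G) \<epsilon>
            (if \<epsilon> \<le> 1
             then min (inv_neg_log (cos (pi / real m)) * (ln (real m - 1) + ln (1 / \<epsilon>)))
                      (2 * (real m)\<^sup>2 / 3 + (real m)\<^sup>2 / 2 * ln (1 / \<epsilon>))
             else 4 * (real m)\<^sup>2 * ((1 + 3 * \<epsilon>) / (3 * (1 + \<epsilon>) ^ 3)))))"
proof -
  interpret fin_digraph G using assms(1) by (simp add: eulerian_digraph_def)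
  interpret eulerian_walk G using assms(1,2) by unfold_locales (auto simp: eulerian_digraph_def)
  have m: "arc_count = real m" "0 < real m" using assms(3) arc_count_pos by (simp_all add: arc_count_def)
  let ?V = "verts G" and ?\<pi> = "srw_stat G" and ?L = "lazy_kernel (srw G)"
  have part2: "(\<forall>\<mu>. complex_eigenvalue ?V (srw G) \<mu> \<and> \<mu> \<noteq> 1 \<longrightarrow> 1 - cmod \<mu> \<ge> 1 - cos (2 * pi / real m))
        \<and> (\<forall>\<epsilon>>0. tau_le ?V (srw G) ?\<pi> \<epsilon>
              (inv_neg_log (cos (2 * pi / real m)) * ln ((1 - 2 / real m) / \<epsilon>))
            \<and> tau_inf_le ?V (srw G) ?\<pi> \<epsilon>
              (if \<epsilon> \<le> 1
               then min (inv_neg_log (cos (2 * pi / real m)) * (ln ((real m - 2) / 2) + ln (1 / \<epsilon>)))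
                        ((real m)\<^sup>2 / 6 + (real m)\<^sup>2 / 8 * ln (1 / \<epsilon>))
               else (real m)\<^sup>2 * ((1 + 3 * \<epsilon>) / (3 * (1 + \<epsilon>) ^ 3))))"
    if ex: "\<forall>A. A \<subseteq> ?V \<and> sum ?\<pi> A \<le> 1/2 \<longrightarrow> (\<forall>v\<in>?V. sum ?\<pi> (out_nbhd ?V (srw G) A - {v}) \<ge> sum ?\<pi> A)"
  proof -
    have chains: "expanding_chain ?V (srw G) ?\<pi> (2 / real m)" "expanding_chain ?V (reversal ?\<pi> (srw G)) ?\<pi> (2 / real m)"
      using srw_expanding ex unfolding m(1) by blast+
    interpret E: expanding_chain ?V "srw G" ?\<pi> "2 / real m" by (rule chains)
    have c: "E.contraction = cos (2 * pi / real m)" by (simp add: E.contraction_def mult.commute)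
    have r: "(1 - 2 / real m) / (2 / real m) = (real m - 2) / 2" using m(2) by (simp add: field_simps)
    have s: "E.sup_time \<epsilon> = (if \<epsilon> \<le> 1 then (real m)\<^sup>2 / 6 + (real m)\<^sup>2 / 8 * ln (1 / \<epsilon>)
        else (real m)\<^sup>2 * ((1 + 3 * \<epsilon>) / (3 * (1 + \<epsilon>) ^ 3)))" for \<epsilon>
      unfolding E.sup_time_def by (simp add: power_divide algebra_simps)
    show ?thesis
    proof (intro conjI allI impI)
      fix \<mu> assume "complex_eigenvalue ?V (srw G) \<mu> \<and> \<mu> \<noteq> 1"
      then show "1 - cmod \<mu> \<ge> 1 - cos (2 * pi / real m)" using E.eigenvalue_le_contraction c by simp
    next
      fix \<epsilon> :: real assume \<epsilon>: "0 < \<epsilon>"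
      show "tau_le ?V (srw G) ?\<pi> \<epsilon> (inv_neg_log (cos (2 * pi / real m)) * ln ((1 - 2 / real m) / \<epsilon>))"
        using E.tau_le_contraction[OF \<epsilon>] unfolding c .
      note sup = E.tau_inf_le_contraction[OF \<epsilon>, unfolded c r] E.tau_inf_le_sup_time[OF chains(2) \<epsilon>, unfolded s]
      show "tau_inf_le ?V (srw G) ?\<pi> \<epsilon> (if \<epsilon> \<le> 1
               then min (inv_neg_log (cos (2 * pi / real m)) * (ln ((real m - 2) / 2) + ln (1 / \<epsilon>)))
                        ((real m)\<^sup>2 / 6 + (real m)\<^sup>2 / 8 * ln (1 / \<epsilon>))
               else (real m)\<^sup>2 * ((1 + 3 * \<epsilon>) / (3 * (1 + \<epsilon>) ^ 3)))"
        using sup by (cases "\<epsilon> \<le> 1") (simp_all only: if_True if_False tau_inf_le_min)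
    qed
  qed
  have part3: "(\<forall>\<mu>. complex_eigenvalue ?V ?L \<mu> \<and> \<mu> \<noteq> 1 \<longrightarrow> 1 - cmod \<mu> \<ge> 1 - cos (pi / real m))
      \<and> (\<forall>\<epsilon>>0. tau_le ?V ?L ?\<pi> \<epsilon> (inv_neg_log (cos (pi / real m)) * ln ((1 - 1 / real m) / \<epsilon>))
          \<and> tau_inf_le ?V ?L ?\<pi> \<epsilon>
            (if \<epsilon> \<le> 1
             then min (inv_neg_log (cos (pi / real m)) * (ln (real m - 1) + ln (1 / \<epsilon>)))
                      (2 * (real m)\<^sup>2 / 3 + (real m)\<^sup>2 / 2 * ln (1 / \<epsilon>))
             else 4 * (real m)\<^sup>2 * ((1 + 3 * \<epsilon>) / (3 * (1 + \<epsilon>) ^ 3))))"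
  proof -
    note chains = lazy_srw_expanding[unfolded m(1)]
    interpret E: expanding_chain ?V ?L ?\<pi> "1 / real m" by (rule chains)
    have c: "E.contraction = cos (pi / real m)" by (simp add: E.contraction_def)
    have r: "(1 - 1 / real m) / (1 / real m) = real m - 1" using m(2) by (simp add: field_simps)
    have s: "E.sup_time \<epsilon> = (if \<epsilon> \<le> 1 then 2 * (real m)\<^sup>2 / 3 + (real m)\<^sup>2 / 2 * ln (1 / \<epsilon>)
        else 4 * (real m)\<^sup>2 * ((1 + 3 * \<epsilon>) / (3 * (1 + \<epsilon>) ^ 3)))" for \<epsilon>
      unfolding E.sup_time_def by (simp add: power_divide algebra_simps)
    show ?thesis
    proof (intro conjI allI impI)
      fix \<mu> assume "complex_eigenvalue ?V ?L \<mu> \<and> \<mu> \<noteq> 1"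
      then show "1 - cmod \<mu> \<ge> 1 - cos (pi / real m)" using E.eigenvalue_le_contraction c by simp
    next
      fix \<epsilon> :: real assume \<epsilon>: "0 < \<epsilon>"
      show "tau_le ?V ?L ?\<pi> \<epsilon> (inv_neg_log (cos (pi / real m)) * ln ((1 - 1 / real m) / \<epsilon>))"
        using E.tau_le_contraction[OF \<epsilon>] unfolding c .
      note sup = E.tau_inf_le_contraction[OF \<epsilon>, unfolded c r] E.tau_inf_le_sup_time[OF chains(2) \<epsilon>, unfolded s]
      show "tau_inf_le ?V ?L ?\<pi> \<epsilon> (if \<epsilon> \<le> 1
             then min (inv_neg_log (cos (pi / real m)) * (ln (real m - 1) + ln (1 / \<epsilon>)))
                      (2 * (real m)\<^sup>2 / 3 + (real m)\<^sup>2 / 2 * ln (1 / \<epsilon>))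
             else 4 * (real m)\<^sup>2 * ((1 + 3 * \<epsilon>) / (3 * (1 + \<epsilon>) ^ 3)))"
        using sup by (cases "\<epsilon> \<le> 1") (simp_all only: if_True if_False tau_inf_le_min)
    qed
  qed
  show ?thesis
    using srw_gap lazy_srw_gap part2 part3 unfolding m(1) by blast
qed

end
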